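(* Let $N\ge 2$, let $0<b<1$ with $b^2\in\mathbb{R}\setminus\mathbb{Q}$, and put $q=e^{\pi i b^2}$, $\tilde q=e^{\pi i b^{-2}}$. The generators $z_{ij}$ $(1\le i,j\le N)$ of the quantum group $GL_q^+(N,\mathbb{R})$ can be represented, through the matrix product $Z=(z_{ij})=U^-\,T\,U^+$ with $U^-=U^-(b_{m,n})$, $T=\mathrm{diag}(U_1,\dots,U_N)$, $U^+=U^+(a_{m,n})$, by $N^2$ operators $$\{b_{m,n},\,U_k,\,a_{m,n}\},\qquad 1\le n\le m\le N-1,\quad 1\le k\le N,$$ on a Hilbert space, where each of these is a positive self-adjoint operator and any two of them commute or $q^2$-commute, so that $Z$ is a $GL_q(N)$ matrix and (1) the variables $\{U_k,a_{m,n}\}$ generate the upper triangular quantum Borel subgroup $T_{>0}U^+_{>0}$; (2) the variables $\{b_{m,n},U_k\}$ generate the lower triangular quantum Borel subgroup $U^-_{>0}T_{>0}$; (3) the variables $a_{m,n}$ commute with the variables $b_{m',n'}$. Furthermore, the corresponding decomposition for the other part $GL^+_{\tilde q}(N,\mathbb{R})$ of the modular double is obtained by replacing every variable $x\in\{b_{m,n},U_k,a_{m,n}\}$ by $\tilde x:=x^{1/b^2}$; that is, the matrix formed in the same way from the operators $\tilde b_{m,n},\tilde U_k,\tilde a_{m,n}$ is a $GL_{\tilde q}(N)$ matrix with the analogous properties with respect to $\tilde q$.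
   Context: **$GL_q(N)$ matrix.** An $N\times N$ matrix $Z=(z_{ij})$ with entries in an associative algebra is a $GL_q(N)$ matrix if for all $i<i'$, $j<j'$ the entries $\alpha=z_{ij},\ \beta=z_{ij'},\ \gamma=z_{i'j},\ \delta=z_{i'j'}$ satisfy $\alpha\beta=\beta\alpha$, $\gamma\delta=\delta\gamma$, $\alpha\gamma=q^2\gamma\alpha$, $\beta\delta=q^2\delta\beta$, $\beta\gamma=q^2\gamma\beta$, $\alpha\delta-\beta\gamma=\delta\alpha-\gamma\beta$. A $GL_{\tilde q}(N)$ matrix is defined with $q$ replaced by $\tilde q$. **Unipotent factors.** Let $E_{i,j}$ be the matrix units and $I$ the identity. Then $U^+=U^+(a_{m,n})=A_1A_2\cdots A_{N-1}$ with $A_s=I+\sum_{m=s}^{N-1}a_{m,s}E_{m,m+1}$, and $U^-=U^-(b_{m,n})=B_1B_2\cdots B_{N-1}$ with $B_s=I+\sum_{m=N-s}^{N-1}b_{m,\,m-(N-1)+s}E_{m+1,m}$ (so $B_1$ contains only $b_{N-1,1}$ and $B_{N-1}$ contains $b_{1,1},b_{2,2},\dots,b_{N-1,N-1}$). **Commutation of operators.** For positive (essentially) self-adjoint operators $u,v$ on a Hilbert space, the relation $uv=q^{2}vu$ means $u^{is}v^{it}=q^{-2st}v^{it}u^{is}$ for all $s,t\in\mathbb{R}$ (unitaries defined by functional calculus); "$u,v$ $q^2$-commute" means $uv=q^2vu$ or $vu=q^2uv$ in this sense, and "commute" means $u^{is}v^{it}=v^{it}u^{is}$ for all $s,t\in\mathbb{R}$.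 The $GL_q(N)$ relations for the entries of $Z$, which are polynomials in these operators, are understood as consequences of these relations computed algebraically. **Quantum Borel subgroups.** The upper (resp. lower) triangular quantum Borel subgroup $T_{>0}U^+_{>0}$ (resp. $U^-_{>0}T_{>0}$) refers to the upper triangular matrix $TU^+$ (resp. lower triangular matrix $U^-T$), which is a $GL_q(N)$ matrix whose entries are polynomials in the listed variables. $GL_q^+(N,\mathbb{R})$ denotes $GL_q(N)$ represented in this way by positive operators, and the modular double is $GL_{q\tilde q}^+(N,\mathbb{R})=GL_q^+(N,\mathbb{R})\otimes GL^+_{\tilde q}(N,\mathbb{R})$. *)

theory Defs
  imports
    "HOL-Analysis.Analysis"
    "HOL-Algebra.QuotRing"
    "HOL-Library.Poly_Mapping"
    "Jordan_Normal_Form.VS_Connect"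
begin

section \<open>Complex Hilbert spaces and unbounded operators\<close>

text \<open>
  Hilbert spaces are given by a carrier and operations, so that a statement can assert the
  existence of one.  For such assertions the carrier type \<open>((nat \<Rightarrow> real) \<Rightarrow> complex) set\<close> is large
  enough for every separable Hilbert space: it contains the equivalence classes of functions that
  make up the spaces \<open>L\<^sup>2\<close> over finitely or countably many real variables.  The ring multiplication inherited from the module record plays no role.
  The inner product is conjugate-linear in its first argument.
\<close>

record 'h hilbert = "(complex, 'h) module" +
  hinner :: "'h \<Rightarrow> 'h \<Rightarrow> complex"

definition hnorm :: "('h, 'm) hilbert_scheme \<Rightarrow> 'h \<Rightarrow> real" where
  "hnorm H x = sqrt (Re (hinner H x x))"

locale complex_hilbert_space = module "class_ring :: complex ring" H
  for H :: "('h, 'm) hilbert_scheme" (structure) +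
  assumes hinner_add_right:
      "\<lbrakk>x \<in> carrier H; y \<in> carrier H; z \<in> carrier H\<rbrakk>
        \<Longrightarrow> hinner H x (y \<oplus>\<^bsub>H\<^esub> z) = hinner H x y + hinner H x z"
    and hinner_smult_right:
      "\<lbrakk>x \<in> carrier H; y \<in> carrier H\<rbrakk> \<Longrightarrow> hinner H x (c \<odot>\<^bsub>H\<^esub> y) = c * hinner H x y"
    and hinner_cnj:
      "\<lbrakk>x \<in> carrier H; y \<in> carrier H\<rbrakk> \<Longrightarrow> hinner H y x = cnj (hinner H x y)"
    and hinner_pos:
      "\<lbrakk>x \<in> carrier H; x \<noteq> \<zero>\<^bsub>H\<^esub>\<rbrakk> \<Longrightarrow> 0 < Re (hinner H x x)"
    and complete:
      "\<lbrakk>\<And>n. \<sigma> n \<in> carrier H;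
        \<forall>e>0. \<exists>M::nat. \<forall>m\<ge>M. \<forall>n\<ge>M. hnorm H (\<sigma> m \<ominus>\<^bsub>H\<^esub> \<sigma> n) < e\<rbrakk>
        \<Longrightarrow> \<exists>x\<in>carrier H. (\<lambda>n. hnorm H (\<sigma> n \<ominus>\<^bsub>H\<^esub> x)) \<longlonglongrightarrow> 0"

text \<open>
  A (possibly unbounded, partially defined) operator is represented by its graph; the domain of
  the operator is \<^term>\<open>Domain A\<close>, and equality of operators includes equality of domains.
\<close>

definition op_comp :: "'h rel \<Rightarrow> 'h rel \<Rightarrow> 'h rel" where
  "op_comp A B = B O A"

definition op_scale :: "('h, 'm) hilbert_scheme \<Rightarrow> complex \<Rightarrow> 'h rel \<Rightarrow> 'h rel" where
  "op_scale H c A = {(x, c \<odot>\<^bsub>H\<^esub> y) | x y. (x, y) \<in> A}"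

definition densely_defined_operator :: "('h, 'm) hilbert_scheme \<Rightarrow> 'h rel \<Rightarrow> bool" where
  "densely_defined_operator H A \<longleftrightarrow>
     A \<subseteq> carrier H \<times> carrier H \<and> single_valued A \<and>
     (\<forall>(x, y)\<in>A. \<forall>(x', y')\<in>A. (x \<oplus>\<^bsub>H\<^esub> x', y \<oplus>\<^bsub>H\<^esub> y') \<in> A) \<and>
     (\<forall>(x, y)\<in>A. \<forall>c. (c \<odot>\<^bsub>H\<^esub> x, c \<odot>\<^bsub>H\<^esub> y) \<in> A) \<and>
     (\<forall>x\<in>carrier H. \<forall>e>0. \<exists>y\<in>Domain A. hnorm H (x \<ominus>\<^bsub>H\<^esub> y) < e)"

definition adjoint_op :: "('h, 'm) hilbert_scheme \<Rightarrow> 'h rel \<Rightarrow> 'h rel" where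
  "adjoint_op H A =
     {(y, z). y \<in> carrier H \<and> z \<in> carrier H \<and> (\<forall>(x, w)\<in>A. hinner H w y = hinner H x z)}"

definition self_adjoint :: "('h, 'm) hilbert_scheme \<Rightarrow> 'h rel \<Rightarrow> bool" where
  "self_adjoint H A \<longleftrightarrow> densely_defined_operator H A \<and> adjoint_op H A = A"

text \<open>
  Positivity is strict, i.e. it includes injectivity: this is what makes the imaginary powers
  \<open>A\<^sup>i\<^sup>s\<close> unitary.
\<close>

definition positive_self_adjoint :: "('h, 'm) hilbert_scheme \<Rightarrow> 'h rel \<Rightarrow> bool" where
  "positive_self_adjoint H A \<longleftrightarrow>
     self_adjoint H A \<and>
     (\<forall>(x, y)\<in>A. x \<noteq> \<zero>\<^bsub>H\<^esub> \<longrightarrow> hinner H x y \<in> \<real> \<and> 0 < Re (hinner H x y))"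


section \<open>Borel functional calculus\<close>

text \<open>
  In the countable additivity condition weak convergence of the quadratic forms is enough: since
  each \<open>E B\<close> is an orthogonal projection, it implies strong countable additivity.
\<close>

definition projection_valued_measure ::
    "('h, 'm) hilbert_scheme \<Rightarrow> (real set \<Rightarrow> 'h \<Rightarrow> 'h) \<Rightarrow> bool" where
  "projection_valued_measure H E \<longleftrightarrow>
     (\<forall>B\<in>sets borel. \<forall>x\<in>carrier H. E B x \<in> carrier H \<and> E B (E B x) = E B x \<and>
        (\<forall>y\<in>carrier H. hinner H (E B x) y = hinner H x (E B y))) \<and>
     (\<forall>x\<in>carrier H. E UNIV x = x) \<and>
     (\<forall>B\<in>sets borel. \<forall>C\<in>sets borel. \<forall>x\<in>carrier H. E (B \<inter> C) x = E B (E C x)) \<and>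
     (\<forall>F :: nat \<Rightarrow> real set. range F \<subseteq> sets borel \<longrightarrow> disjoint_family F \<longrightarrow>
        (\<forall>x\<in>carrier H. (\<lambda>n. hinner H x (E (F n) x)) sums hinner H x (E (\<Union>n. F n) x)))"

definition spectral_distr ::
    "('h, 'm) hilbert_scheme \<Rightarrow> (real set \<Rightarrow> 'h \<Rightarrow> 'h) \<Rightarrow> 'h \<Rightarrow> real measure" where
  "spectral_distr H E x =
     measure_of UNIV (sets borel) (\<lambda>B. ennreal (Re (hinner H x (E B x))))"

text \<open>
  The integral of \<open>f\<close> against the complex measure \<open>B \<mapsto> \<langle>z, E B x\<rangle>\<close>, written out by polarization.
\<close>

definition spectral_form ::
    "('h, 'm) hilbert_scheme \<Rightarrow> (real set \<Rightarrow> 'h \<Rightarrow> 'h) \<Rightarrow> (real \<Rightarrow> complex) \<Rightarrow> 'h \<Rightarrow> 'h \<Rightarrow> complex" where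
  "spectral_form H E f z x =
     (\<Sum>k<4. \<i> ^ k * (\<integral>l. f l \<partial>spectral_distr H E (x \<oplus>\<^bsub>H\<^esub> (\<i> ^ k) \<odot>\<^bsub>H\<^esub> z))) / 4"

definition spectral_dom ::
    "('h, 'm) hilbert_scheme \<Rightarrow> (real set \<Rightarrow> 'h \<Rightarrow> 'h) \<Rightarrow> (real \<Rightarrow> complex) \<Rightarrow> 'h set" where
  "spectral_dom H E f =
     {x \<in> carrier H. integrable (spectral_distr H E x) (\<lambda>l. (cmod (f l))\<^sup>2)}"

text \<open>
  The operator \<open>\<integral> f dE\<close>.  Testing only against \<open>z\<close> in the (dense) domain determines the value, and
  guarantees that all integrals in \<^const>\<open>spectral_form\<close> converge.
\<close>

definition spectral_integral ::
    "('h, 'm) hilbert_scheme \<Rightarrow> (real set \<Rightarrow> 'h \<Rightarrow> 'h) \<Rightarrow> (real \<Rightarrow> complex) \<Rightarrow> 'h rel" where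
  "spectral_integral H E f =
     {(x, y). x \<in> spectral_dom H E f \<and> y \<in> carrier H \<and>
        (\<forall>z\<in>spectral_dom H E f. hinner H z y = spectral_form H E f z x)}"

definition has_spectral_measure ::
    "('h, 'm) hilbert_scheme \<Rightarrow> 'h rel \<Rightarrow> (real set \<Rightarrow> 'h \<Rightarrow> 'h) \<Rightarrow> bool" where
  "has_spectral_measure H A E \<longleftrightarrow>
     projection_valued_measure H E \<and> A = spectral_integral H E complex_of_real"

text \<open>
  \<open>has_power H A z B\<close> says that \<open>B = A\<^sup>z\<close> in the sense of functional calculus.  By the spectral
  theorem a self-adjoint \<open>A\<close> has exactly one spectral measure, so that \<open>B\<close> exists and is unique.
  For positive \<open>A\<close> the spectral measure is concentrated on \<open>(0, \<infinity>)\<close>; the value of the integrand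
  elsewhere is irrelevant.
\<close>

definition has_power :: "('h, 'm) hilbert_scheme \<Rightarrow> 'h rel \<Rightarrow> complex \<Rightarrow> 'h rel \<Rightarrow> bool" where
  "has_power H A z B \<longleftrightarrow>
     (\<exists>E. has_spectral_measure H A E \<and>
          B = spectral_integral H E (\<lambda>l. if 0 < l then complex_of_real l powr z else 0))"


section \<open>Commutation and \<open>q\<^sup>2\<close>-commutation of positive operators\<close>

text \<open>
  All notions depend on \<open>q = exp (\<pi> i \<theta>)\<close> through the real parameter \<open>\<theta>\<close>, because the power
  \<open>q\<^sup>-\<^sup>2\<^sup>s\<^sup>t\<close> means \<open>exp (- 2 \<pi> i \<theta> s t)\<close>; for \<open>\<theta> > 1\<close> this is not the principal branch of the
  power of the complex number \<open>q\<close>.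
\<close>

definition q_of :: "real \<Rightarrow> complex" where
  "q_of \<theta> = exp (\<i> * of_real (pi * \<theta>))"

definition weyl_relation ::
    "('h, 'm) hilbert_scheme \<Rightarrow> (real \<Rightarrow> real \<Rightarrow> complex) \<Rightarrow> 'h rel \<Rightarrow> 'h rel \<Rightarrow> bool" where
  "weyl_relation H \<omega> u v \<longleftrightarrow>
     (\<exists>P Q. (\<forall>s. has_power H u (\<i> * of_real s) (P s)) \<and>
            (\<forall>t. has_power H v (\<i> * of_real t) (Q t)) \<and>
            (\<forall>s t. op_comp (P s) (Q t) = op_scale H (\<omega> s t) (op_comp (Q t) (P s))))"

definition op_commute :: "('h, 'm) hilbert_scheme \<Rightarrow> 'h rel \<Rightarrow> 'h rel \<Rightarrow> bool" where
  "op_commute H u v \<longleftrightarrow> weyl_relation H (\<lambda>s t. 1) u v"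

text \<open>The relation \<open>u v = q\<^sup>2 v u\<close>.\<close>

definition op_q_relation :: "('h, 'm) hilbert_scheme \<Rightarrow> real \<Rightarrow> 'h rel \<Rightarrow> 'h rel \<Rightarrow> bool" where
  "op_q_relation H \<theta> u v \<longleftrightarrow>
     weyl_relation H (\<lambda>s t. exp (- 2 * \<i> * of_real (pi * \<theta> * s * t))) u v"

definition op_q_commute :: "('h, 'm) hilbert_scheme \<Rightarrow> real \<Rightarrow> 'h rel \<Rightarrow> 'h rel \<Rightarrow> bool" where
  "op_q_commute H \<theta> u v \<longleftrightarrow> op_q_relation H \<theta> u v \<or> op_q_relation H \<theta> v u"


section \<open>\<open>GL\<^sub>q(N)\<close> matrices\<close>

text \<open>
  An associative unital complex algebra is a ring together with a homomorphism \<open>\<iota>\<close> from the complex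
  numbers to its centre.
\<close>

locale complex_assoc_algebra = ring R
  for R :: "('r, 'm) ring_scheme" (structure) and \<iota> :: "complex \<Rightarrow> 'r" +
  assumes scalar_hom: "\<iota> \<in> Ring.ring_hom class_ring R"
    and scalar_central: "x \<in> carrier R \<Longrightarrow> \<iota> c \<otimes> x = x \<otimes> \<iota> c"

text \<open>Matrix indices run from \<open>0\<close> to \<open>N - 1\<close>, as usual for the type of matrices used here.\<close>

definition GLq_matrix ::
    "('r, 'm) ring_scheme \<Rightarrow> (complex \<Rightarrow> 'r) \<Rightarrow> complex \<Rightarrow> nat \<Rightarrow> 'r mat \<Rightarrow> bool" where
  "GLq_matrix R \<iota> q N Z \<longleftrightarrow>
     complex_assoc_algebra R \<iota> \<and>
     Z \<in> carrier_mat N N \<and>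
     (\<forall>i<N. \<forall>j<N. Z $$ (i, j) \<in> carrier R) \<and>
     (\<forall>i i' j j'. i < i' \<and> i' < N \<and> j < j' \<and> j' < N \<longrightarrow>
       (let \<alpha> = Z $$ (i, j); \<beta> = Z $$ (i, j'); \<gamma> = Z $$ (i', j); \<delta> = Z $$ (i', j') in
          \<alpha> \<otimes>\<^bsub>R\<^esub> \<beta> = \<beta> \<otimes>\<^bsub>R\<^esub> \<alpha> \<and>
          \<gamma> \<otimes>\<^bsub>R\<^esub> \<delta> = \<delta> \<otimes>\<^bsub>R\<^esub> \<gamma> \<and>
          \<alpha> \<otimes>\<^bsub>R\<^esub> \<gamma> = \<iota> (q\<^sup>2) \<otimes>\<^bsub>R\<^esub> (\<gamma> \<otimes>\<^bsub>R\<^esub> \<alpha>) \<and>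
          \<beta> \<otimes>\<^bsub>R\<^esub> \<delta> = \<iota> (q\<^sup>2) \<otimes>\<^bsub>R\<^esub> (\<delta> \<otimes>\<^bsub>R\<^esub> \<beta>) \<and>
          \<beta> \<otimes>\<^bsub>R\<^esub> \<gamma> = \<iota> (q\<^sup>2) \<otimes>\<^bsub>R\<^esub> (\<gamma> \<otimes>\<^bsub>R\<^esub> \<beta>) \<and>
          \<alpha> \<otimes>\<^bsub>R\<^esub> \<delta> \<ominus>\<^bsub>R\<^esub> \<beta> \<otimes>\<^bsub>R\<^esub> \<gamma> = \<delta> \<otimes>\<^bsub>R\<^esub> \<alpha> \<ominus>\<^bsub>R\<^esub> \<gamma> \<otimes>\<^bsub>R\<^esub> \<beta>))"


section \<open>The variables and the algebra of their commutation relations\<close>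

datatype var = B_var nat nat | U_var nat | A_var nat nat

definition b_vars :: "nat \<Rightarrow> var set" where
  "b_vars N = {B_var m n | m n. 1 \<le> n \<and> n \<le> m \<and> m \<le> N - 1}"

definition U_vars :: "nat \<Rightarrow> var set" where
  "U_vars N = {U_var k | k. 1 \<le> k \<and> k \<le> N}"

definition a_vars :: "nat \<Rightarrow> var set" where
  "a_vars N = {A_var m n | m n. 1 \<le> n \<and> n \<le> m \<and> m \<le> N - 1}"

definition all_vars :: "nat \<Rightarrow> var set" where
  "all_vars N = b_vars N \<union> U_vars N \<union> a_vars N"

text \<open>
  Lists form the free monoid, written additively; finitely supported functions on them with the
  convolution product then form the free algebra of noncommutative polynomials.
\<close>

instantiation list :: (type) monoid_add
begin

definition zero_list :: "'a list" where
  "zero_list = []"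

definition plus_list :: "'a list \<Rightarrow> 'a list \<Rightarrow> 'a list" where
  "plus_list xs ys = xs @ ys"

instance
  by standard (simp_all add: zero_list_def plus_list_def)

end

type_synonym ncpoly = "var list \<Rightarrow>\<^sub>0 complex"

definition nc_scalar :: "complex \<Rightarrow> ncpoly" where
  "nc_scalar c = Poly_Mapping.single [] c"

definition nc_var :: "var \<Rightarrow> ncpoly" where
  "nc_var v = Poly_Mapping.single [v] 1"

definition free_algebra :: "var set \<Rightarrow> ncpoly ring" where
  "free_algebra V =
     \<lparr>carrier = {p. Poly_Mapping.keys p \<subseteq> lists V}, mult = (*), one = 1, zero = 0, add = (+)\<rparr>"

lemma ring_free_algebra: "ring (free_algebra V)"
proof -
  have mult_closed: "Poly_Mapping.keys (p * r) \<subseteq> lists V"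
    if "Poly_Mapping.keys p \<subseteq> lists V" "Poly_Mapping.keys r \<subseteq> lists V" for p r :: ncpoly
  proof
    fix w assume "w \<in> Poly_Mapping.keys (p * r)"
    then obtain x y where "w = x @ y" "x \<in> Poly_Mapping.keys p" "y \<in> Poly_Mapping.keys r"
      using keys_mult[of p r] by (auto simp: plus_list_def)
    with that show "w \<in> lists V" by auto
  qed
  have add_closed: "Poly_Mapping.keys (p + r) \<subseteq> lists V"
    if "Poly_Mapping.keys p \<subseteq> lists V" "Poly_Mapping.keys r \<subseteq> lists V" for p r :: ncpoly
    using keys_add[of p r] that by blast
  show ?thesis
  proof (rule ringI)
    show "abelian_group (free_algebra V)"
    proof (rule abelian_groupI)
      fix x assume "x \<in> carrier (free_algebra V)"
      then show "\<exists>y\<in>carrier (free_algebra V). y \<oplus>\<^bsub>free_algebra V\<^esub> x = \<zero>\<^bsub>free_algebra V\<^esub>"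
        by (intro bexI[of _ "- x"]) (simp_all add: free_algebra_def)
    qed (simp_all add: free_algebra_def add_closed add.assoc add.commute)
    show "monoid (free_algebra V)"
      by unfold_locales (simp_all add: free_algebra_def mult_closed mult.assoc zero_list_def)
  qed (simp_all add: free_algebra_def algebra_simps)
qed

text \<open>
  For a family \<open>X\<close> of positive operators indexed by the variables, the relations between the
  variables in \<open>V\<close> are precisely the relations \<open>u v = v u\<close> and \<open>u v = q\<^sup>2 v u\<close> that hold, in the
  sense of unitary powers, between the corresponding operators \<open>X v\<close>.  A polynomial identity
  between the variables is a consequence of these relations, computed algebraically, iff it holds
  in the quotient of the free algebra by the two-sided ideal that they generate.
\<close>

definition comm_ideal ::
    "('h, 'm) hilbert_scheme \<Rightarrow> real \<Rightarrow> (var \<Rightarrow> 'h rel) \<Rightarrow> var set \<Rightarrow> ncpoly set" where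
  "comm_ideal H \<theta> X V =
     Idl\<^bsub>free_algebra V\<^esub>
       ({nc_var v * nc_var w - nc_var w * nc_var v | v w.
           v \<in> V \<and> w \<in> V \<and> op_commute H (X v) (X w)} \<union>
        {nc_var v * nc_var w - nc_scalar ((q_of \<theta>)\<^sup>2) * nc_var w * nc_var v | v w.
           v \<in> V \<and> w \<in> V \<and> op_q_relation H \<theta> (X v) (X w)})"

definition var_algebra ::
    "('h, 'm) hilbert_scheme \<Rightarrow> real \<Rightarrow> (var \<Rightarrow> 'h rel) \<Rightarrow> var set \<Rightarrow> ncpoly set ring" where
  "var_algebra H \<theta> X V = free_algebra V Quot comm_ideal H \<theta> X V"

definition to_var_algebra ::
    "('h, 'm) hilbert_scheme \<Rightarrow> real \<Rightarrow> (var \<Rightarrow> 'h rel) \<Rightarrow> var set \<Rightarrow> ncpoly \<Rightarrow> ncpoly set" where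
  "to_var_algebra H \<theta> X V p = comm_ideal H \<theta> X V +>\<^bsub>free_algebra V\<^esub> p"

text \<open>
  \<open>Z\<close> is a matrix of polynomials in the variables \<open>V\<close> (membership of its entries in the carrier of
  the free algebra on \<open>V\<close>), and it is a \<open>GL\<^sub>q(N)\<close> matrix by virtue of the commutation relations.
\<close>

definition is_GLq_in_vars ::
    "('h, 'm) hilbert_scheme \<Rightarrow> real \<Rightarrow> (var \<Rightarrow> 'h rel) \<Rightarrow> var set \<Rightarrow> nat \<Rightarrow> ncpoly mat \<Rightarrow> bool" where
  "is_GLq_in_vars H \<theta> X V N Z \<longleftrightarrow>
     (\<forall>i<N. \<forall>j<N. Z $$ (i, j) \<in> carrier (free_algebra V)) \<and>
     GLq_matrix (var_algebra H \<theta> X V) (\<lambda>c. to_var_algebra H \<theta> X V (nc_scalar c)) (q_of \<theta>) N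
       (map_mat (to_var_algebra H \<theta> X V) Z)"


section \<open>The Gauss--Lusztig decomposition\<close>

text \<open>
  The matrix unit \<open>E\<^bsub>m,m+1\<^esub>\<close> of the one-based convention sits at position \<open>(m - 1, m)\<close>, and
  \<open>E\<^bsub>m+1,m\<^esub>\<close> at position \<open>(m, m - 1)\<close>.
\<close>

definition A_factor :: "nat \<Rightarrow> nat \<Rightarrow> ncpoly mat" where
  "A_factor N s = mat N N (\<lambda>(i, j).
     if i = j then 1
     else if j = i + 1 \<and> s \<le> j then nc_var (A_var j s)
     else 0)"

definition B_factor :: "nat \<Rightarrow> nat \<Rightarrow> ncpoly mat" where
  "B_factor N s = mat N N (\<lambda>(i, j).
     if i = j then 1
     else if i = j + 1 \<and> N - s \<le> i then nc_var (B_var i (i + s - (N - 1)))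
     else 0)"

definition U_plus :: "nat \<Rightarrow> ncpoly mat" where
  "U_plus N = foldr (*) (map (A_factor N) [1..<N]) (1\<^sub>m N)"

definition U_minus :: "nat \<Rightarrow> ncpoly mat" where
  "U_minus N = foldr (*) (map (B_factor N) [1..<N]) (1\<^sub>m N)"

definition T_diag :: "nat \<Rightarrow> ncpoly mat" where
  "T_diag N = mat N N (\<lambda>(i, j). if i = j then nc_var (U_var (i + 1)) else 0)"

definition Z_matrix :: "nat \<Rightarrow> ncpoly mat" where
  "Z_matrix N = U_minus N * T_diag N * U_plus N"

locale gauss_lusztig_representation =
  fixes H :: "('h, 'm) hilbert_scheme" and N :: nat and \<theta> :: real and X :: "var \<Rightarrow> 'h rel"
  assumes positive: "v \<in> all_vars N \<Longrightarrow> positive_self_adjoint H (X v)"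
    and pairwise: "\<lbrakk>v \<in> all_vars N; w \<in> all_vars N; v \<noteq> w\<rbrakk>
      \<Longrightarrow> op_commute H (X v) (X w) \<or> op_q_commute H \<theta> (X v) (X w)"
    and Z_GLq: "is_GLq_in_vars H \<theta> X (all_vars N) N (Z_matrix N)"
    and upper_borel:
      "upper_triangular (T_diag N * U_plus N)"
      "is_GLq_in_vars H \<theta> X (U_vars N \<union> a_vars N) N (T_diag N * U_plus N)"
    and lower_borel:
      "upper_triangular (transpose_mat (U_minus N * T_diag N))"
      "is_GLq_in_vars H \<theta> X (b_vars N \<union> U_vars N) N (U_minus N * T_diag N)"
    and a_b_commute: "\<lbrakk>v \<in> a_vars N; w \<in> b_vars N\<rbrakk> \<Longrightarrow> op_commute H (X v) (X w)"

end

theory Submission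
  imports Defs "HOL-Probability.Probability"
begin

text \<open>
  The proof separates into algebra, which finds suitable relations between the variables, and
  analysis, which realises them by operators.

  \<^bold>\<open>Algebra.\<close>  Each factor \<open>A\<^sub>s\<close> is a product of matrices \<open>I + a E\<^bsub>m,m+1\<^esub>\<close>, and each \<open>B\<^sub>s\<close> of matrices
  \<open>I + b E\<^bsub>m+1,m\<^esub>\<close>.  Hence \<open>Z\<close> arises from the diagonal matrix \<open>T\<close> by a sequence of elementary column
  operations, followed by elementary row operations.  Such an operation preserves the \<open>GL\<^sub>q(N)\<close>
  relations as soon as its multiplier commutes with all entries except those of one column, or row,
  with which it \<open>q\<^sup>2\<close>-commutes (\<open>glq_col_op\<close>, \<open>glq_row_op\<close>).  Requiring this at every stage leads to one
  relation between any two variables: \<open>v w = q\<^bsup>2 e\<^esup> w v\<close> with \<open>e = comm_exp v w \<in> {-1, 0, 1}\<close>, and \<open>e = 0\<close>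
  if one of them is an \<open>a\<close> and the other one a \<open>b\<close>.  Stopping before the row operations, or leaving out
  the column operations, gives the two Borel subgroups.  So every family of positive operators with
  these relations is a representation of the required kind (\<open>Gauss_Lusztig_from_relations\<close>).

  \<^bold>\<open>Analysis.\<close>  The relations are those of exponentials of field operators: if \<open>\<Phi>(w)\<close> generates the Weyl
  operators \<open>W(s w)\<close> of a vector \<open>w \<in> \<complex>\<^sup>n\<close>, then \<open>u = exp \<Phi>(v)\<close> and \<open>u' = exp \<Phi>(w)\<close> satisfy
  \<open>u\<^bsup>is\<^esup> u'\<^bsup>it\<^esup> = exp (- 2 i s t Im \<langle>v, w\<rangle>) u'\<^bsup>it\<^esup> u\<^bsup>is\<^esup>\<close> (\<open>weyl_relation_exp_field\<close>), and vectors with the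
  prescribed numbers \<open>Im \<langle>v, w\<rangle> = \<pi> b\<^sup>2 e\<close> are easily written down (\<open>var_vector\<close>).  The power \<open>x\<^bsup>1/b\<^sup>2\<^esup>\<close> of a
  variable is the exponential of \<open>\<Phi>(w / b\<^sup>2)\<close>.  Passing to these powers divides \<open>Im \<langle>v, w\<rangle>\<close> by \<open>b\<^sup>4\<close>, that
  is, it replaces \<open>\<pi> b\<^sup>2 e\<close> by \<open>\<pi> b\<^sup>-\<^sup>2 e\<close>: these are the same relations for \<open>\<tilde>q\<close>, which is why the
  modular double comes for free.

  The field operators live on the space \<open>L\<^sup>2\<close> of a finite product of standard normal distributions.
  There multiplication by \<open>exp (i s x\<^sub>j)\<close> is the Weyl operator of \<open>i s\<close> times a unit vector, and
  multiplication operators have explicit spectral measures (\<open>spectral_integral_eq\<close>).  Every other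
  direction is reached by rotating the coordinates of \<open>\<complex>\<^sup>n\<close> by phases.  The rotation acts on \<open>L\<^sup>2\<close> as a
  unitary (the phase \<open>i\<close> gives a form of the Fourier transform), which is constructed from its action
  on the exponential vectors: it preserves their inner products \<open>exp \<langle>z, w\<rangle>\<close>, and they are total
  (\<open>exp_vec_total\<close>), so it extends to the whole space (\<open>unitary_extension\<close>).  The Weyl relations are
  likewise checked on exponential vectors.
\<close>

section \<open>Square integrable functions\<close>

definition square_integrable :: "'a measure \<Rightarrow> ('a \<Rightarrow> complex) \<Rightarrow> bool" where
  "square_integrable M f \<longleftrightarrow> f \<in> borel_measurable M \<and> integrable M (\<lambda>x. (cmod (f x))\<^sup>2)"

definition l2_inner :: "'a measure \<Rightarrow> ('a \<Rightarrow> complex) \<Rightarrow> ('a \<Rightarrow> complex) \<Rightarrow> complex" where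
  "l2_inner M f g = (\<integral>x. cnj (f x) * g x \<partial>M)"

definition l2_sqnorm :: "'a measure \<Rightarrow> ('a \<Rightarrow> complex) \<Rightarrow> real" where
  "l2_sqnorm M f = (\<integral>x. (cmod (f x))\<^sup>2 \<partial>M)"

lemma cnj_measurable [measurable]: "f \<in> borel_measurable M \<Longrightarrow> (\<lambda>x. cnj (f x)) \<in> borel_measurable M"
  by (rule borel_measurable_continuous_on[OF continuous_on_cnj[OF continuous_on_id]])

lemma square_integrable_measurable [measurable_dest]:
  "square_integrable M f \<Longrightarrow> f \<in> borel_measurable M"
  by (simp add: square_integrable_def)

lemma square_integrable_integrable:
  "square_integrable M f \<Longrightarrow> integrable M (\<lambda>x. (cmod (f x))\<^sup>2)"
  by (simp add: square_integrable_def)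

lemma cmod_add_square_le: "(cmod (a + b))\<^sup>2 \<le> 2 * (cmod a)\<^sup>2 + 2 * (cmod b)\<^sup>2"
proof -
  have "(cmod (a + b))\<^sup>2 \<le> (cmod a + cmod b)\<^sup>2"
    by (intro power_mono norm_triangle_ineq) simp
  also have "\<dots> \<le> 2 * (cmod a)\<^sup>2 + 2 * (cmod b)\<^sup>2"
    using sum_squares_bound[of "cmod a" "cmod b"] by (simp add: power2_sum)
  finally show ?thesis .
qed

lemma square_integrable_dominated:
  assumes "square_integrable M f" "g \<in> borel_measurable M"
    and "AE x in M. cmod (g x) \<le> C * cmod (f x)"
  shows "square_integrable M g"
  unfolding square_integrable_def
proof
  show "integrable M (\<lambda>x. (cmod (g x))\<^sup>2)"
  proof (rule Bochner_Integration.integrable_bound)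
    show "integrable M (\<lambda>x. C\<^sup>2 * (cmod (f x))\<^sup>2)"
      using assms(1) by (simp add: square_integrable_def)
    show "AE x in M. norm ((cmod (g x))\<^sup>2) \<le> norm (C\<^sup>2 * (cmod (f x))\<^sup>2)"
      using assms(3)
    proof eventually_elim
      case (elim x)
      then have "(cmod (g x))\<^sup>2 \<le> (C * cmod (f x))\<^sup>2"
        by (intro power_mono) auto
      then show ?case by (simp add: power_mult_distrib)
    qed
  qed (use assms in measurable)
qed fact

lemma square_integrable_cong_AE:
  assumes "square_integrable M f" "g \<in> borel_measurable M" "AE x in M. g x = f x"
  shows "square_integrable M g"
  by (rule square_integrable_dominated[OF assms(1,2), of 1]) (use assms(3) in auto)

lemma square_integrable_zero [simp]: "square_integrable M (\<lambda>x. 0)"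
  by (simp add: square_integrable_def)

lemma square_integrable_cmult:
  assumes "square_integrable M f" shows "square_integrable M (\<lambda>x. c * f x)"
  using assms
  by (intro square_integrable_dominated[OF assms, of _ "cmod c"]) (auto simp: norm_mult)

lemma square_integrable_add:
  assumes "square_integrable M f" "square_integrable M g"
  shows "square_integrable M (\<lambda>x. f x + g x)"
  unfolding square_integrable_def
proof
  show "integrable M (\<lambda>x. (cmod (f x + g x))\<^sup>2)"
  proof (rule Bochner_Integration.integrable_bound)
    show "integrable M (\<lambda>x. 2 * (cmod (f x))\<^sup>2 + 2 * (cmod (g x))\<^sup>2)"
      using assms by (simp add: square_integrable_def)
    show "AE x in M. norm ((cmod (f x + g x))\<^sup>2) \<le> norm (2 * (cmod (f x))\<^sup>2 + 2 * (cmod (g x))\<^sup>2)"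
      using cmod_add_square_le by auto
  qed (use assms in measurable)
qed (use assms in measurable)

lemma square_integrable_diff:
  assumes "square_integrable M f" "square_integrable M g"
  shows "square_integrable M (\<lambda>x. f x - g x)"
  using square_integrable_add[OF assms(1) square_integrable_cmult[OF assms(2), of "-1"]] by simp

lemma square_integrable_bounded_mult:
  assumes "square_integrable M f" "g \<in> borel_measurable M" "\<And>x. cmod (g x) \<le> C"
  shows "square_integrable M (\<lambda>x. g x * f x)"
  using assms
  by (intro square_integrable_dominated[OF assms(1), of _ C])
    (auto simp: norm_mult intro!: mult_right_mono)

lemmas square_integrable_intros =
  square_integrable_add square_integrable_diff square_integrable_cmult

lemma l2_inner_integrable:
  assumes "square_integrable M f" "square_integrable M g"
  shows "integrable M (\<lambda>x. cnj (f x) * g x)"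
proof (rule Bochner_Integration.integrable_bound)
  show "integrable M (\<lambda>x. (cmod (f x))\<^sup>2 + (cmod (g x))\<^sup>2)"
    using assms by (simp add: square_integrable_def)
  have "cmod a * cmod b \<le> (cmod a)\<^sup>2 + (cmod b)\<^sup>2" for a b
    using sum_squares_bound[of "cmod a" "cmod b"] mult_nonneg_nonneg[OF norm_ge_zero norm_ge_zero, of a b]
    by linarith
  then show "AE x in M. norm (cnj (f x) * g x) \<le> norm ((cmod (f x))\<^sup>2 + (cmod (g x))\<^sup>2)"
    by (simp add: norm_mult)
qed (use assms in measurable)

lemma l2_inner_add_right:
  assumes "square_integrable M f" "square_integrable M g" "square_integrable M h"
  shows "l2_inner M f (\<lambda>x. g x + h x) = l2_inner M f g + l2_inner M f h"
  unfolding l2_inner_def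
  using l2_inner_integrable[OF assms(1,2)] l2_inner_integrable[OF assms(1,3)]
  by (simp add: algebra_simps)

lemma l2_inner_diff_right:
  assumes "square_integrable M f" "square_integrable M g" "square_integrable M h"
  shows "l2_inner M f (\<lambda>x. g x - h x) = l2_inner M f g - l2_inner M f h"
  unfolding l2_inner_def
  using l2_inner_integrable[OF assms(1,2)] l2_inner_integrable[OF assms(1,3)]
  by (simp add: algebra_simps)

lemma l2_inner_cmult_right: "l2_inner M f (\<lambda>x. c * g x) = c * l2_inner M f g"
proof -
  have "l2_inner M f (\<lambda>x. c * g x) = (\<integral>x. c * (cnj (f x) * g x) \<partial>M)"
    unfolding l2_inner_def by (simp add: mult_ac)
  then show ?thesis unfolding l2_inner_def by simp
qed

lemma l2_inner_cnj: "l2_inner M g f = cnj (l2_inner M f g)"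
  unfolding l2_inner_def by (subst Bochner_Integration.integral_cnj[symmetric]) (simp add: mult.commute)

lemma l2_inner_add_left:
  assumes "square_integrable M f" "square_integrable M g" "square_integrable M h"
  shows "l2_inner M (\<lambda>x. g x + h x) f = l2_inner M g f + l2_inner M h f"
  using l2_inner_add_right[OF assms] by (subst (1 2 3) l2_inner_cnj) simp

lemma l2_inner_diff_left:
  assumes "square_integrable M f" "square_integrable M g" "square_integrable M h"
  shows "l2_inner M (\<lambda>x. g x - h x) f = l2_inner M g f - l2_inner M h f"
  using l2_inner_diff_right[OF assms] by (subst (1 2 3) l2_inner_cnj) simp

lemma l2_inner_cmult_left: "l2_inner M (\<lambda>x. c * g x) f = cnj c * l2_inner M g f"
  by (subst (1 2) l2_inner_cnj) (simp add: l2_inner_cmult_right)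

lemma l2_inner_cong_AE:
  assumes "AE x in M. f x = f' x" "AE x in M. g x = g' x"
    and "square_integrable M f" "square_integrable M g" "square_integrable M f'" "square_integrable M g'"
  shows "l2_inner M f g = l2_inner M f' g'"
  unfolding l2_inner_def
proof (rule integral_cong_AE)
  show "AE x in M. cnj (f x) * g x = cnj (f' x) * g' x"
    using assms(1,2) by eventually_elim simp
qed (use assms in measurable)

lemma l2_inner_self: "l2_inner M f f = complex_of_real (l2_sqnorm M f)"
proof -
  have "cnj z * z = complex_of_real ((cmod z)\<^sup>2)" for z
    by (metis complex_norm_square mult.commute)
  then show ?thesis
    unfolding l2_inner_def l2_sqnorm_def by (simp only: integral_complex_of_real)
qed

lemma l2_sqnorm_nonneg [simp]: "0 \<le> l2_sqnorm M f"
  unfolding l2_sqnorm_def by simp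

lemma l2_sqnorm_diff_commute: "l2_sqnorm M (\<lambda>x. f x - g x) = l2_sqnorm M (\<lambda>x. g x - f x)"
  unfolding l2_sqnorm_def by (simp add: norm_minus_commute)

lemma l2_sqnorm_eq_0:
  assumes "square_integrable M f" "l2_sqnorm M f = 0"
  shows "AE x in M. f x = 0"
proof -
  have "AE x in M. (cmod (f x))\<^sup>2 = 0"
    using assms by (subst integral_nonneg_eq_0_iff_AE[symmetric])
      (auto simp: square_integrable_def l2_sqnorm_def)
  then show ?thesis by simp
qed

lemma l2_sqnorm_add_le:
  assumes "square_integrable M f" "square_integrable M g"
  shows "l2_sqnorm M (\<lambda>x. f x + g x) \<le> 2 * l2_sqnorm M f + 2 * l2_sqnorm M g"
proof -
  have "l2_sqnorm M (\<lambda>x. f x + g x) \<le> (\<integral>x. 2 * (cmod (f x))\<^sup>2 + 2 * (cmod (g x))\<^sup>2 \<partial>M)"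
    unfolding l2_sqnorm_def
    using square_integrable_add[OF assms] assms
    by (intro integral_mono cmod_add_square_le) (simp_all add: square_integrable_def)
  also have "\<dots> = 2 * l2_sqnorm M f + 2 * l2_sqnorm M g"
    using assms unfolding l2_sqnorm_def by (simp add: square_integrable_def)
  finally show ?thesis .
qed

lemma l2_sqnorm_diff_le:
  assumes "square_integrable M f" "square_integrable M g" "square_integrable M h"
  shows "l2_sqnorm M (\<lambda>x. f x - h x) \<le>
    2 * l2_sqnorm M (\<lambda>x. f x - g x) + 2 * l2_sqnorm M (\<lambda>x. g x - h x)"
  using l2_sqnorm_add_le[of M "\<lambda>x. f x - g x" "\<lambda>x. g x - h x"] assms
  by (simp add: square_integrable_intros)

lemma l2_sqnorm_diff_expand:
  assumes "square_integrable M f" "square_integrable M g"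
  shows "complex_of_real (l2_sqnorm M (\<lambda>x. f x - g x)) =
    l2_inner M f f - l2_inner M f g - l2_inner M g f + l2_inner M g g"
  unfolding l2_inner_self[symmetric]
  using assms by (simp add: l2_inner_diff_left l2_inner_diff_right square_integrable_intros)

lemma l2_Cauchy_Schwarz:
  assumes "square_integrable M f" "square_integrable M g"
  shows "(cmod (l2_inner M f g))\<^sup>2 \<le> l2_sqnorm M f * l2_sqnorm M g"
proof (cases "l2_sqnorm M g = 0")
  case True
  then have "AE x in M. g x = 0"
    using assms(2) by (rule l2_sqnorm_eq_0[rotated])
  then have "l2_inner M f g = l2_inner M f (\<lambda>x. 0)"
    using assms by (intro l2_inner_cong_AE) auto
  then show ?thesis by (simp add: l2_inner_def)
next
  case False
  define n where "n = l2_sqnorm M g"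
  have n: "n > 0" using False l2_sqnorm_nonneg[of M g] unfolding n_def by linarith
  define a where "a = l2_inner M f g"
  \<comment> \<open>the multiple of \<open>g\<close> that is closest to \<open>f\<close>\<close>
  define c where "c = cnj a / of_real n"
  have a': "l2_inner M g f = cnj a"
    unfolding a_def by (rule l2_inner_cnj)
  have "complex_of_real (l2_sqnorm M (\<lambda>x. f x - c * g x)) =
    l2_inner M f f - c * a - cnj c * cnj a + cnj c * (c * of_real n)"
    using assms
    by (simp add: l2_sqnorm_diff_expand square_integrable_cmult l2_inner_cmult_left
        l2_inner_cmult_right l2_inner_self[of M g] a' n_def flip: a_def)
  also have "\<dots> = of_real (l2_sqnorm M f) - a * cnj a / of_real n"
    using n by (simp add: c_def l2_inner_self field_simps)
  also have "\<dots> = of_real (l2_sqnorm M f - (cmod a)\<^sup>2 / n)"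
    by (simp add: complex_norm_square[symmetric])
  finally have "l2_sqnorm M (\<lambda>x. f x - c * g x) = l2_sqnorm M f - (cmod a)\<^sup>2 / n"
    by (simp only: of_real_eq_iff)
  then have "0 \<le> l2_sqnorm M f - (cmod a)\<^sup>2 / n"
    by (metis l2_sqnorm_nonneg)
  then show ?thesis
    using n by (simp add: a_def n_def field_simps)
qed

lemma l2_inner_tendsto_right:
  assumes "square_integrable M h" "\<And>n. square_integrable M (f n)" "square_integrable M g"
    and "(\<lambda>n. l2_sqnorm M (\<lambda>x. f n x - g x)) \<longlonglongrightarrow> 0"
  shows "(\<lambda>n. l2_inner M h (f n)) \<longlonglongrightarrow> l2_inner M h g"
proof -
  have "(\<lambda>n. (cmod (l2_inner M h (f n) - l2_inner M h g))\<^sup>2) \<longlonglongrightarrow> 0"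
  proof (rule tendsto_sandwich[of "\<lambda>_. 0"])
    show "(\<lambda>n. l2_sqnorm M h * l2_sqnorm M (\<lambda>x. f n x - g x)) \<longlonglongrightarrow> 0"
      using tendsto_mult_left[OF assms(4), of "l2_sqnorm M h"] by simp
    show "\<forall>\<^sub>F n in sequentially. (cmod (l2_inner M h (f n) - l2_inner M h g))\<^sup>2 \<le>
        l2_sqnorm M h * l2_sqnorm M (\<lambda>x. f n x - g x)"
      using l2_Cauchy_Schwarz[OF assms(1) square_integrable_diff[OF assms(2,3)]]
      by (simp add: l2_inner_diff_right assms)
  qed auto
  then have "(\<lambda>n. sqrt ((cmod (l2_inner M h (f n) - l2_inner M h g))\<^sup>2)) \<longlonglongrightarrow> 0"
    using tendsto_real_sqrt by fastforce
  then show ?thesis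
    by (simp add: LIM_zero_cancel tendsto_norm_zero_iff)
qed

text \<open>
  On a probability space the \<open>L\<^sup>2\<close> norm dominates the \<open>L\<^sup>1\<close> norm.  The increments of a rapidly
  converging subsequence are therefore summable almost everywhere, which gives a pointwise limit,
  and Fatou's lemma shows that it is also the limit in square mean.
\<close>

lemma (in prob_space) Riesz_Fischer:
  assumes sq: "\<And>n. square_integrable M (f n)"
    and cauchy: "\<And>e. e > 0 \<Longrightarrow> \<exists>K::nat. \<forall>m\<ge>K. \<forall>n\<ge>K. l2_sqnorm M (\<lambda>x. f m x - f n x) < e"
  shows "\<exists>g. square_integrable M g \<and> (\<lambda>n. l2_sqnorm M (\<lambda>x. f n x - g x)) \<longlonglongrightarrow> 0"
proof -
  have [measurable]: "f n \<in> borel_measurable M" for n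
    using sq by measurable
  define tol where "tol k = ((1/2::real) ^ k)\<^sup>2" for k
  have tol: "tol k > 0" for k by (simp add: tol_def)
  define K where "K k = (SOME K. \<forall>m\<ge>K. \<forall>n\<ge>K. l2_sqnorm M (\<lambda>x. f m x - f n x) < tol k)" for k
  have K: "\<forall>m\<ge>K k. \<forall>n\<ge>K k. l2_sqnorm M (\<lambda>x. f m x - f n x) < tol k" for k
    unfolding K_def by (rule someI_ex) (rule cauchy[OF tol])
  \<comment> \<open>the indices of the subsequence; the summand \<open>k\<close> makes them unbounded\<close>
  define s where "s k = (\<Sum>j\<le>k. K j) + k" for k
  have s_K: "K k \<le> s k" for k
    unfolding s_def by (simp add: member_le_sum trans_le_add1)
  have s_ge: "k \<le> s k" for k unfolding s_def by simp
  have s_mono: "s k \<le> s (Suc k)" for k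
    unfolding s_def by simp
  define d where "d k x = f (s (Suc k)) x - f (s k) x" for k x
  have d_sq: "square_integrable M (d k)" for k
    unfolding d_def using sq by (intro square_integrable_diff)
  have [measurable]: "d k \<in> borel_measurable M" for k
    using d_sq by measurable
  have d_int: "integrable M (d k)" for k
    using l2_inner_integrable[OF _ d_sq[of k], of "\<lambda>x. 1"]
    by (simp add: square_integrable_def)
  have d_small: "(\<integral>x. cmod (d k x) \<partial>M) \<le> (1/2) ^ k" for k
  proof -
    have "(cmod (l2_inner M (\<lambda>x. 1) (\<lambda>x. of_real (cmod (d k x)))))\<^sup>2 \<le>
      l2_sqnorm M (\<lambda>x. 1) * l2_sqnorm M (\<lambda>x. of_real (cmod (d k x)))"
      using d_sq[of k]
      by (intro l2_Cauchy_Schwarz) (simp_all add: square_integrable_def)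
    also have "\<dots> = l2_sqnorm M (d k)"
      unfolding l2_sqnorm_def by (simp add: prob_space)
    also have "\<dots> \<le> ((1/2) ^ k)\<^sup>2"
      using K[of k] s_K[of k] order_trans[OF s_K s_mono, of k]
      unfolding d_def tol_def by (simp add: less_imp_le)
    finally have "\<bar>\<integral>x. cmod (d k x) \<partial>M\<bar> \<le> (1/2) ^ k"
      unfolding l2_inner_def by (simp add: power2_le_iff_abs_le)
    then show ?thesis by simp
  qed
  have "(\<integral>\<^sup>+x. suminf (\<lambda>k. ennreal (cmod (d k x))) \<partial>M) = suminf (\<lambda>k. \<integral>\<^sup>+x. ennreal (cmod (d k x)) \<partial>M)"
    by (rule nn_integral_suminf) measurable
  also have "\<dots> \<le> suminf (\<lambda>k. ennreal ((1/2) ^ k))"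
    using d_int d_small by (intro suminf_le) (auto simp: nn_integral_eq_integral intro: ennreal_leI)
  also have "\<dots> = ennreal (suminf (\<lambda>k. (1/2) ^ k))"
    by (rule suminf_ennreal2) (simp_all add: summable_geometric)
  finally have "(\<integral>\<^sup>+x. suminf (\<lambda>k. ennreal (cmod (d k x))) \<partial>M) \<noteq> \<infinity>"
    by (auto simp: top_unique)
  then have "AE x in M. suminf (\<lambda>k. ennreal (cmod (d k x))) \<noteq> \<infinity>"
    by (intro nn_integral_PInf_AE) auto
  then have lim: "AE x in M. convergent (\<lambda>k. f (s k) x)"
  proof eventually_elim
    case (elim x)
    then have "summable (\<lambda>k. cmod (d k x))"
      by (intro summable_suminf_not_top) (auto simp: top.not_eq_extremum)
    then have "summable (\<lambda>k. d k x)"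
      by (rule summable_norm_cancel)
    then have "convergent (\<lambda>n. \<Sum>k<n. d k x)"
      by (simp add: summable_iff_convergent)
    then have "convergent (\<lambda>n. (\<Sum>k<n. d k x) + f (s 0) x)"
      by (intro convergent_add convergent_const)
    moreover have "(\<Sum>k<n. d k x) + f (s 0) x = f (s n) x" for n
      unfolding d_def by (simp add: sum_lessThan_telescope[of "\<lambda>k. f (s k) x"])
    ultimately show ?case by simp
  qed
  define g where "g x = lim (\<lambda>k. f (s k) x)" for x
  have [measurable]: "g \<in> borel_measurable M"
    unfolding g_def by measurable
  have lim_g: "AE x in M. (\<lambda>k. f (s k) x) \<longlonglongrightarrow> g x"
    using lim by eventually_elim (simp add: g_def convergent_LIMSEQ_iff)
  have est: "square_integrable M (\<lambda>x. f m x - g x) \<and> l2_sqnorm M (\<lambda>x. f m x - g x) \<le> tol k"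
    if m: "m \<ge> K k" for m k
  proof -
    have "(\<integral>\<^sup>+x. ennreal ((cmod (f m x - g x))\<^sup>2) \<partial>M) =
        (\<integral>\<^sup>+x. liminf (\<lambda>j. ennreal ((cmod (f m x - f (s j) x))\<^sup>2)) \<partial>M)"
    proof (rule nn_integral_cong_AE, use lim_g in eventually_elim)
      case (elim x)
      then have "(\<lambda>j. ennreal ((cmod (f m x - f (s j) x))\<^sup>2)) \<longlonglongrightarrow> ennreal ((cmod (f m x - g x))\<^sup>2)"
        by (intro tendsto_intros)
      then show ?case
        by (rule lim_imp_Liminf[OF sequentially_bot, symmetric])
    qed
    also have "\<dots> \<le> liminf (\<lambda>j. \<integral>\<^sup>+x. ennreal ((cmod (f m x - f (s j) x))\<^sup>2) \<partial>M)"
      by (rule nn_integral_liminf) measurable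
    also have "\<dots> \<le> ennreal (tol k)"
    proof (rule Liminf_le)
      show "\<forall>\<^sub>F j in sequentially. (\<integral>\<^sup>+x. ennreal ((cmod (f m x - f (s j) x))\<^sup>2) \<partial>M) \<le> ennreal (tol k)"
        unfolding eventually_sequentially
      proof (intro exI allI impI)
        fix j assume "K k \<le> j"
        then have "K k \<le> s j" using s_ge[of j] by linarith
        then have "l2_sqnorm M (\<lambda>x. f m x - f (s j) x) \<le> tol k"
          using K[of k] m by (simp add: less_imp_le)
        moreover have "square_integrable M (\<lambda>x. f m x - f (s j) x)"
          using sq by (intro square_integrable_diff)
        ultimately show "(\<integral>\<^sup>+x. ennreal ((cmod (f m x - f (s j) x))\<^sup>2) \<partial>M) \<le> ennreal (tol k)"
          unfolding l2_sqnorm_def square_integrable_def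
          by (subst nn_integral_eq_integral) (auto intro: ennreal_leI)
      qed
    qed simp
    finally have fin: "(\<integral>\<^sup>+x. ennreal ((cmod (f m x - g x))\<^sup>2) \<partial>M) \<le> ennreal (tol k)" .
    then have int: "integrable M (\<lambda>x. (cmod (f m x - g x))\<^sup>2)"
      by (intro integrableI_bounded) (auto intro: le_less_trans)
    then have "ennreal (\<integral>x. (cmod (f m x - g x))\<^sup>2 \<partial>M) \<le> ennreal (tol k)"
      using fin by (simp add: nn_integral_eq_integral)
    then show ?thesis
      using int tol[of k] unfolding square_integrable_def l2_sqnorm_def
      by (simp add: ennreal_le_iff)
  qed
  have "square_integrable M (\<lambda>x. f (K 0) x - (f (K 0) x - g x))"
    by (rule square_integrable_diff[OF sq conjunct1[OF est[OF order_refl]]])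
  then have g_sq: "square_integrable M g" by simp
  moreover have "(\<lambda>n. l2_sqnorm M (\<lambda>x. f n x - g x)) \<longlonglongrightarrow> 0"
  proof (rule LIMSEQ_I)
    fix e :: real assume e: "e > 0"
    have "tol \<longlonglongrightarrow> 0"
      using tendsto_power[OF LIMSEQ_power_zero[of "1/2::real"], of 2] unfolding tol_def by simp
    then obtain k where "tol k < e"
      using order_tendstoD(2)[OF _ e] by (metis eventually_sequentially order_refl)
    then show "\<exists>no. \<forall>n\<ge>no. norm (l2_sqnorm M (\<lambda>x. f n x - g x) - 0) < e"
      using est[of k] by (intro exI[of _ "K k"]) fastforce
  qed
  ultimately show ?thesis by blast
qed

section \<open>Unitaries determined by total families\<close>

text \<open>
  A minimising sequence for the distance to a linear subspace \<open>L\<close> is Cauchy by the parallelogram law,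
  and the residuals \<open>f - l\<^sub>n\<close> become orthogonal to \<open>L\<close>.  If \<open>L\<close> has trivial orthogonal complement,
  the residuals therefore tend to zero.
\<close>

lemma (in prob_space) dense_if_trivial_orthocomplement:
  assumes L_sq: "\<And>l. l \<in> L \<Longrightarrow> square_integrable M l"
    and L_zero: "(\<lambda>x. 0) \<in> L"
    and L_add: "\<And>l k. l \<in> L \<Longrightarrow> k \<in> L \<Longrightarrow> (\<lambda>x. l x + k x) \<in> L"
    and L_cmult: "\<And>l c. l \<in> L \<Longrightarrow> (\<lambda>x. c * l x) \<in> L"
    and triv: "\<And>f. square_integrable M f \<Longrightarrow> (\<And>l. l \<in> L \<Longrightarrow> l2_inner M l f = 0) \<Longrightarrow> AE x in M. f x = 0"
    and f: "square_integrable M f"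
  shows "\<exists>l. (\<forall>n. l n \<in> L) \<and> (\<lambda>n::nat. l2_sqnorm M (\<lambda>x. f x - l n x)) \<longlonglongrightarrow> 0"
proof -
  define D where "D = (\<lambda>l. l2_sqnorm M (\<lambda>x. f x - l x)) ` L"
  define d where "d = Inf D"
  have D_ne: "D \<noteq> {}" using L_zero unfolding D_def by auto
  have D_bdd: "bdd_below D" unfolding D_def by (rule bdd_belowI[of _ 0]) auto
  have d_le: "d \<le> l2_sqnorm M (\<lambda>x. f x - l x)" if "l \<in> L" for l
    unfolding d_def using that by (intro cInf_lower D_bdd) (auto simp: D_def)
  have "\<exists>l\<in>L. l2_sqnorm M (\<lambda>x. f x - l x) < d + e" if "e > 0" for e
    using cInf_lessD[OF D_ne, of "d + e"] that unfolding d_def D_def by auto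
  then have "\<exists>l\<in>L. l2_sqnorm M (\<lambda>x. f x - l x) < d + inverse (real (Suc n))" for n
    by simp
  then obtain l where l: "\<And>n. l n \<in> L"
    "\<And>n. l2_sqnorm M (\<lambda>x. f x - l n x) < d + inverse (real (Suc n))"
    by metis
  define r where "r n x = f x - l n x" for n x
  have r_sq: "square_integrable M (r n)" for n
    unfolding r_def using f L_sq[OF l(1)] by (rule square_integrable_diff)
  have r_lt: "l2_sqnorm M (r n) < d + inverse (real (Suc n))" for n
    using l(2) unfolding r_def .
  have par: "l2_sqnorm M (\<lambda>x. r m x - r n x) \<le> 2 * inverse (real (Suc m)) + 2 * inverse (real (Suc n))"
    for m n
  proof -
    define s where "s x = (1/2) * (r m x + r n x)" for x
    have s_sq: "square_integrable M s"
      unfolding s_def using r_sq by (intro square_integrable_intros)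
    have "(cmod (a - b))\<^sup>2 + (cmod (a + b))\<^sup>2 = 2 * (cmod a)\<^sup>2 + 2 * (cmod b)\<^sup>2" for a b
      unfolding cmod_power2 by (simp add: power2_eq_square algebra_simps)
    then have "(cmod (a - b))\<^sup>2 + 4 * (cmod ((1/2) * (a + b)))\<^sup>2 = 2 * (cmod a)\<^sup>2 + 2 * (cmod b)\<^sup>2" for a b
      by (simp add: norm_mult power_mult_distrib power2_eq_square)
    then have eq: "(cmod (r m x - r n x))\<^sup>2 + 4 * (cmod (s x))\<^sup>2 = 2 * (cmod (r m x))\<^sup>2 + 2 * (cmod (r n x))\<^sup>2" for x
      unfolding s_def by blast
    note int = square_integrable_integrable[OF r_sq] square_integrable_integrable[OF s_sq]
      square_integrable_integrable[OF square_integrable_diff[OF r_sq r_sq]]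
    have "l2_sqnorm M (\<lambda>x. r m x - r n x) + 4 * l2_sqnorm M s =
        (\<integral>x. (cmod (r m x - r n x))\<^sup>2 + 4 * (cmod (s x))\<^sup>2 \<partial>M)"
      unfolding l2_sqnorm_def using int by simp
    also have "\<dots> = 2 * l2_sqnorm M (r m) + 2 * l2_sqnorm M (r n)"
      unfolding eq l2_sqnorm_def using int by simp
    finally have "l2_sqnorm M (\<lambda>x. r m x - r n x) + 4 * l2_sqnorm M s =
        2 * l2_sqnorm M (r m) + 2 * l2_sqnorm M (r n)" .
    moreover have "s = (\<lambda>x. f x - (1/2) * (l m x + l n x))"
      unfolding s_def r_def by (auto simp: field_simps)
    then have "d \<le> l2_sqnorm M s"
      using d_le[OF L_cmult[OF L_add[OF l(1) l(1)]], of "1/2" m n] by simp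
    ultimately show ?thesis
      using r_lt[of m] r_lt[of n] by linarith
  qed
  have inv_lim: "(\<lambda>n. inverse (real (Suc n))) \<longlonglongrightarrow> 0"
    by (rule LIMSEQ_inverse_real_of_nat)
  have "\<exists>g. square_integrable M g \<and> (\<lambda>n. l2_sqnorm M (\<lambda>x. r n x - g x)) \<longlonglongrightarrow> 0"
  proof (rule Riesz_Fischer[OF r_sq])
    fix e :: real assume "e > 0"
    then obtain K where K: "\<forall>n\<ge>K. inverse (real (Suc n)) < e / 4"
      using order_tendstoD(2)[OF inv_lim, of "e / 4"] by (auto simp: eventually_sequentially)
    have "l2_sqnorm M (\<lambda>x. r m x - r n x) < e" if "m \<ge> K" "n \<ge> K" for m n
      using par[of m n] K[rule_format, OF that(1)] K[rule_format, OF that(2)] by linarith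
    then show "\<exists>K. \<forall>m\<ge>K. \<forall>n\<ge>K. l2_sqnorm M (\<lambda>x. r m x - r n x) < e"
      by (intro exI[of _ K] allI impI)
  qed
  then obtain g where g: "square_integrable M g" "(\<lambda>n. l2_sqnorm M (\<lambda>x. r n x - g x)) \<longlonglongrightarrow> 0"
    by blast
  have "l2_inner M k g = 0" if k: "k \<in> L" for k
  proof -
    note k_sq = L_sq[OF k]
    have bound: "(cmod (l2_inner M k (r n)))\<^sup>2 \<le> l2_sqnorm M k * inverse (real (Suc n))" for n
    proof (cases "l2_sqnorm M k = 0")
      case True
      then show ?thesis using l2_Cauchy_Schwarz[OF k_sq r_sq[of n]] by simp
    next
      case False
      define p where "p = l2_sqnorm M k"
      have p: "p > 0" using False l2_sqnorm_nonneg[of M k] unfolding p_def by linarith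
      define a where "a = l2_inner M k (r n)"
      \<comment> \<open>the component of \<open>r\<^sub>n\<close> along \<open>k\<close>: removing it cannot bring the square norm below \<open>d\<close>\<close>
      define c where "c = a / of_real p"
      have a': "l2_inner M (r n) k = cnj a"
        unfolding a_def by (rule l2_inner_cnj)
      have "complex_of_real (l2_sqnorm M (\<lambda>x. r n x - c * k x)) =
          l2_inner M (r n) (r n) - c * cnj a - cnj c * a + cnj c * (c * of_real p)"
        using r_sq[of n] k_sq
        by (simp add: l2_sqnorm_diff_expand square_integrable_cmult l2_inner_cmult_left
            l2_inner_cmult_right l2_inner_self[of M k] a' p_def flip: a_def)
      also have "\<dots> = of_real (l2_sqnorm M (r n)) - a * cnj a / of_real p"
        using p by (simp add: c_def l2_inner_self field_simps)
      also have "\<dots> = of_real (l2_sqnorm M (r n) - (cmod a)\<^sup>2 / p)"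
        by (simp add: complex_norm_square[symmetric])
      finally have "l2_sqnorm M (\<lambda>x. r n x - c * k x) = l2_sqnorm M (r n) - (cmod a)\<^sup>2 / p"
        by (simp only: of_real_eq_iff)
      moreover have "(\<lambda>x. r n x - c * k x) = (\<lambda>x. f x - (l n x + c * k x))"
        by (auto simp: r_def)
      then have "d \<le> l2_sqnorm M (\<lambda>x. r n x - c * k x)"
        using d_le[OF L_add[OF l(1)[of n] L_cmult[OF k, of c]]] by simp
      ultimately have "(cmod a)\<^sup>2 / p \<le> inverse (real (Suc n))"
        using r_lt[of n] by linarith
      then show ?thesis
        using p by (simp add: a_def p_def field_simps)
    qed
    have "(\<lambda>n. (cmod (l2_inner M k (r n)))\<^sup>2) \<longlonglongrightarrow> 0"
    proof (rule tendsto_sandwich[of "\<lambda>_. 0"])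
      show "(\<lambda>n. l2_sqnorm M k * inverse (real (Suc n))) \<longlonglongrightarrow> 0"
        using tendsto_mult_left[OF inv_lim, of "l2_sqnorm M k"] by simp
    qed (use bound in auto)
    moreover have "(\<lambda>n. (cmod (l2_inner M k (r n)))\<^sup>2) \<longlonglongrightarrow> (cmod (l2_inner M k g))\<^sup>2"
      by (intro tendsto_intros l2_inner_tendsto_right k_sq r_sq g)
    ultimately have "(cmod (l2_inner M k g))\<^sup>2 = 0"
      by (rule LIMSEQ_unique[symmetric])
    then show ?thesis by simp
  qed
  then have "AE x in M. g x = 0"
    using triv[OF g(1)] by blast
  then have "l2_sqnorm M (\<lambda>x. r n x - g x) = l2_sqnorm M (r n)" for n
    using r_sq[of n] g(1) unfolding l2_sqnorm_def by (intro integral_cong_AE) auto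
  then show ?thesis
    using g(2) l(1) unfolding r_def by auto
qed

text \<open>
  The graph of the linear map that takes \<open>g i\<close> to \<open>h i\<close>.  As a relation it exists before the map is
  known to be well defined.
\<close>

inductive_set pair_span :: "('i \<Rightarrow> 'a \<Rightarrow> complex) \<Rightarrow> ('i \<Rightarrow> 'a \<Rightarrow> complex) \<Rightarrow>
    (('a \<Rightarrow> complex) \<times> ('a \<Rightarrow> complex)) set"
  for g h :: "'i \<Rightarrow> 'a \<Rightarrow> complex" where
  base: "(g i, h i) \<in> pair_span g h"
| zero: "((\<lambda>x. 0), (\<lambda>x. 0)) \<in> pair_span g h"
| add: "(k, k') \<in> pair_span g h \<Longrightarrow> (l, l') \<in> pair_span g h \<Longrightarrow>
    ((\<lambda>x. k x + l x), (\<lambda>x. k' x + l' x)) \<in> pair_span g h"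
| cmult: "(k, k') \<in> pair_span g h \<Longrightarrow> ((\<lambda>x. c * k x), (\<lambda>x. c * k' x)) \<in> pair_span g h"

lemma pair_span_swap: "(k, k') \<in> pair_span g h \<Longrightarrow> (k', k) \<in> pair_span h g"
  by (induction rule: pair_span.induct) (auto intro: pair_span.intros)

locale gram_isometric_families = prob_space M for M :: "'a measure" +
  fixes g h :: "'i \<Rightarrow> 'a \<Rightarrow> complex"
  assumes g_sq: "\<And>i. square_integrable M (g i)"
    and h_sq: "\<And>i. square_integrable M (h i)"
    and gram: "\<And>i j. l2_inner M (g i) (g j) = l2_inner M (h i) (h j)"
    and g_total: "\<And>f. square_integrable M f \<Longrightarrow> (\<And>i. l2_inner M (g i) f = 0) \<Longrightarrow> AE x in M. f x = 0"
    and h_total: "\<And>f. square_integrable M f \<Longrightarrow> (\<And>i. l2_inner M (h i) f = 0) \<Longrightarrow> AE x in M. f x = 0"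
begin

lemma swap: "gram_isometric_families M h g"
  by unfold_locales (simp_all add: g_sq h_sq gram g_total h_total)

lemma span_sq:
  assumes "(k, k') \<in> pair_span g h"
  shows "square_integrable M k" "square_integrable M k'"
proof -
  from assms have "square_integrable M k \<and> square_integrable M k'"
  proof (induction rule: pair_span.induct)
    case (add k k' l l')
    then show ?case by (intro conjI square_integrable_add) simp_all
  next
    case (cmult k k' c)
    then show ?case by (intro conjI square_integrable_cmult) simp_all
  qed (simp_all add: g_sq h_sq)
  then show "square_integrable M k" "square_integrable M k'" by simp_all
qed

lemma span_isometric:
  assumes "(k, k') \<in> pair_span g h" "(l, l') \<in> pair_span g h"
  shows "l2_inner M k l = l2_inner M k' l'"
proof -
  have 1: "l2_inner M (g i) l = l2_inner M (h i) l'" for i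
    using assms(2)
  proof (induction rule: pair_span.induct)
    case (add k k' l l')
    then show ?case
      by (simp only: l2_inner_add_right[OF g_sq span_sq(1) span_sq(1)]
          l2_inner_add_right[OF h_sq span_sq(2) span_sq(2)])
  next
    case (cmult k k' c)
    then show ?case by (simp only: l2_inner_cmult_right)
  qed (simp_all only: gram, simp add: l2_inner_def)
  show ?thesis
    using assms(1)
  proof (induction rule: pair_span.induct)
    case (add k k' m m')
    then show ?case
      by (simp only: l2_inner_add_left[OF span_sq(1)[OF assms(2)] span_sq(1) span_sq(1)]
          l2_inner_add_left[OF span_sq(2)[OF assms(2)] span_sq(2) span_sq(2)])
  next
    case (cmult k k' c)
    then show ?case by (simp only: l2_inner_cmult_left)
  qed (simp_all only: 1, simp add: l2_inner_def)
qed

text \<open>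
  The closure of the graph \<open>pair_span g h\<close>, which is the graph of the unitary.
\<close>

definition span_limit :: "('a \<Rightarrow> complex) \<Rightarrow> ('a \<Rightarrow> complex) \<Rightarrow> bool" where
  "span_limit f f' \<longleftrightarrow> square_integrable M f \<and> square_integrable M f' \<and>
     (\<exists>k k'. (\<forall>n::nat. (k n, k' n) \<in> pair_span g h) \<and>
        (\<lambda>n. l2_sqnorm M (\<lambda>x. k n x - f x)) \<longlonglongrightarrow> 0 \<and> (\<lambda>n. l2_sqnorm M (\<lambda>x. k' n x - f' x)) \<longlonglongrightarrow> 0)"

lemma span_limit_base: "span_limit (g i) (h i)"
  unfolding span_limit_def
  by (intro conjI g_sq h_sq exI[of _ "\<lambda>n. g i"] exI[of _ "\<lambda>n. h i"])
    (auto simp: pair_span.base l2_sqnorm_def)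

lemma span_limit_isometric:
  assumes f: "span_limit f f'" and p: "span_limit p p'"
  shows "l2_inner M f p = l2_inner M f' p'"
proof -
  obtain k k' where k: "\<And>n::nat. (k n, k' n) \<in> pair_span g h"
    "(\<lambda>n. l2_sqnorm M (\<lambda>x. k n x - f x)) \<longlonglongrightarrow> 0" "(\<lambda>n. l2_sqnorm M (\<lambda>x. k' n x - f' x)) \<longlonglongrightarrow> 0"
    using f unfolding span_limit_def by blast
  obtain l l' where l: "\<And>n::nat. (l n, l' n) \<in> pair_span g h"
    "(\<lambda>n. l2_sqnorm M (\<lambda>x. l n x - p x)) \<longlonglongrightarrow> 0" "(\<lambda>n. l2_sqnorm M (\<lambda>x. l' n x - p' x)) \<longlonglongrightarrow> 0"
    using p unfolding span_limit_def by blast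
  note sq = span_sq[OF k(1)] span_sq[OF l(1)] f[unfolded span_limit_def] p[unfolded span_limit_def]
  have 1: "l2_inner M (k n) p = l2_inner M (k' n) p'" for n
  proof (rule LIMSEQ_unique)
    show "(\<lambda>m. l2_inner M (k n) (l m)) \<longlonglongrightarrow> l2_inner M (k n) p"
      using sq l by (intro l2_inner_tendsto_right) auto
    show "(\<lambda>m. l2_inner M (k n) (l m)) \<longlonglongrightarrow> l2_inner M (k' n) p'"
      unfolding span_isometric[OF k(1) l(1)]
      using sq l by (intro l2_inner_tendsto_right) auto
  qed
  have "l2_inner M p f = l2_inner M p' f'"
  proof (rule LIMSEQ_unique)
    show "(\<lambda>n. l2_inner M p (k n)) \<longlonglongrightarrow> l2_inner M p f"
      using sq k by (intro l2_inner_tendsto_right) auto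
    have "l2_inner M p (k n) = l2_inner M p' (k' n)" for n
      using 1[of n] by (metis l2_inner_cnj)
    then show "(\<lambda>n. l2_inner M p (k n)) \<longlonglongrightarrow> l2_inner M p' f'"
      using sq k by (simp, intro l2_inner_tendsto_right) auto
  qed
  then show ?thesis by (metis l2_inner_cnj)
qed

lemma span_diff_sqnorm:
  assumes "(k, k') \<in> pair_span g h" "(l, l') \<in> pair_span g h"
  shows "l2_sqnorm M (\<lambda>x. k x - l x) = l2_sqnorm M (\<lambda>x. k' x - l' x)"
proof -
  have "complex_of_real (l2_sqnorm M (\<lambda>x. k x - l x)) = complex_of_real (l2_sqnorm M (\<lambda>x. k' x - l' x))"
    using assms by (simp add: l2_sqnorm_diff_expand span_sq span_isometric)
  then show ?thesis by (simp only: of_real_eq_iff)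
qed

lemma span_limit_exists:
  assumes f: "square_integrable M f"
  shows "\<exists>f'. span_limit f f'"
proof -
  define L where "L = fst ` pair_span g h"
  have "\<exists>l. (\<forall>n. l n \<in> L) \<and> (\<lambda>n::nat. l2_sqnorm M (\<lambda>x. f x - l n x)) \<longlonglongrightarrow> 0"
  proof (rule dense_if_trivial_orthocomplement[OF _ _ _ _ _ f])
    show "square_integrable M l" if "l \<in> L" for l
      using that span_sq(1) unfolding L_def by auto
    show "(\<lambda>x. 0) \<in> L"
      unfolding L_def using imageI[OF pair_span.zero, of fst] by simp
    show "(\<lambda>x. l x + k x) \<in> L" if lk: "l \<in> L" "k \<in> L" for l k
    proof -
      obtain l' k' where "(l, l') \<in> pair_span g h" "(k, k') \<in> pair_span g h"
        using lk unfolding L_def by auto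
      then show ?thesis
        unfolding L_def using imageI[OF pair_span.add, of l l' g h k k' fst] by simp
    qed
    show "(\<lambda>x. c * l x) \<in> L" if l: "l \<in> L" for l c
    proof -
      obtain l' where "(l, l') \<in> pair_span g h"
        using l unfolding L_def by auto
      then show ?thesis
        unfolding L_def using imageI[OF pair_span.cmult, of l l' g h fst c] by simp
    qed
    show "AE x in M. p x = 0" if "square_integrable M p" "\<And>l. l \<in> L \<Longrightarrow> l2_inner M l p = 0" for p
    proof (rule g_total[OF that(1)])
      show "l2_inner M (g i) p = 0" for i
        by (rule that(2)) (use imageI[OF pair_span.base, of fst g i h] in \<open>simp add: L_def\<close>)
    qed
  qed
  then obtain k where k: "\<And>n::nat. k n \<in> L" "(\<lambda>n. l2_sqnorm M (\<lambda>x. f x - k n x)) \<longlonglongrightarrow> 0"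
    by blast
  have "\<exists>k'. (k n, k') \<in> pair_span g h" for n
    using k(1)[of n] unfolding L_def by auto
  then obtain k' where k': "\<And>n. (k n, k' n) \<in> pair_span g h"
    by metis
  have "\<exists>f'. square_integrable M f' \<and> (\<lambda>n. l2_sqnorm M (\<lambda>x. k' n x - f' x)) \<longlonglongrightarrow> 0"
  proof (rule Riesz_Fischer)
    show "square_integrable M (k' n)" for n
      by (rule span_sq(2)[OF k'])
    fix e :: real assume "e > 0"
    then obtain K where K: "\<forall>n\<ge>K. l2_sqnorm M (\<lambda>x. f x - k n x) < e / 4"
      using order_tendstoD(2)[OF k(2), of "e / 4"] by (auto simp: eventually_sequentially)
    have "l2_sqnorm M (\<lambda>x. k' m x - k' n x) < e" if "m \<ge> K" "n \<ge> K" for m n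
    proof -
      have "l2_sqnorm M (\<lambda>x. k m x - k n x) \<le>
          2 * l2_sqnorm M (\<lambda>x. k m x - f x) + 2 * l2_sqnorm M (\<lambda>x. f x - k n x)"
        by (intro l2_sqnorm_diff_le f span_sq(1)[OF k'])
      then show ?thesis
        using K[rule_format, OF that(1)] K[rule_format, OF that(2)]
          span_diff_sqnorm[OF k'[of m] k'[of n]] l2_sqnorm_diff_commute[of M "k m" f] by linarith
    qed
    then show "\<exists>K. \<forall>m\<ge>K. \<forall>n\<ge>K. l2_sqnorm M (\<lambda>x. k' m x - k' n x) < e"
      by (intro exI[of _ K] allI impI)
  qed
  then obtain f' where "square_integrable M f'" "(\<lambda>n. l2_sqnorm M (\<lambda>x. k' n x - f' x)) \<longlonglongrightarrow> 0"
    by blast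
  moreover have "(\<lambda>n. l2_sqnorm M (\<lambda>x. k n x - f x)) \<longlonglongrightarrow> 0"
    using k(2) by (subst l2_sqnorm_diff_commute)
  ultimately show ?thesis
    using f k' unfolding span_limit_def by blast
qed

text \<open>
  Two total families with the same Gram matrix are related by a unitary, obtained by extending the
  isometry between their linear spans by continuity.
\<close>

theorem unitary_extension:
  "\<exists>\<Gamma>. (\<forall>f. square_integrable M f \<longrightarrow> square_integrable M (\<Gamma> f)) \<and>
       (\<forall>f p. square_integrable M f \<longrightarrow> square_integrable M p \<longrightarrow>
          l2_inner M (\<Gamma> f) (\<Gamma> p) = l2_inner M f p) \<and>
       (\<forall>f'. square_integrable M f' \<longrightarrow> (\<exists>f. square_integrable M f \<and> (AE x in M. \<Gamma> f x = f' x))) \<and>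
       (\<forall>i. AE x in M. \<Gamma> (g i) x = h i x)"
proof -
  interpret sw: gram_isometric_families M h g by (rule swap)
  define \<Gamma> where "\<Gamma> f = (SOME f'. span_limit f f')" for f
  have \<Gamma>: "span_limit f (\<Gamma> f)" if "square_integrable M f" for f
    unfolding \<Gamma>_def by (rule someI_ex[OF span_limit_exists[OF that]])
  have \<Gamma>_unique: "AE x in M. \<Gamma> f x = f' x" if lim: "span_limit f f'" for f f'
  proof -
    have sq: "square_integrable M f" "square_integrable M f'" "square_integrable M (\<Gamma> f)"
      using lim \<Gamma> unfolding span_limit_def by blast+
    have "complex_of_real (l2_sqnorm M (\<lambda>x. \<Gamma> f x - f' x)) = 0"
      using span_limit_isometric[OF \<Gamma>[OF sq(1)] \<Gamma>[OF sq(1)]] span_limit_isometric[OF \<Gamma>[OF sq(1)] lim]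
        span_limit_isometric[OF lim \<Gamma>[OF sq(1)]] span_limit_isometric[OF lim lim] sq
      by (simp add: l2_sqnorm_diff_expand)
    then show ?thesis
      using l2_sqnorm_eq_0[OF square_integrable_diff[OF sq(3,2)]] by simp
  qed
  have "\<exists>f. square_integrable M f \<and> (AE x in M. \<Gamma> f x = f' x)" if f': "square_integrable M f'" for f'
  proof -
    obtain f where "sw.span_limit f' f"
      using sw.span_limit_exists[OF f'] by blast
    then have "span_limit f f'"
      unfolding span_limit_def sw.span_limit_def by (meson pair_span_swap)
    then show ?thesis
      using \<Gamma>_unique unfolding span_limit_def by blast
  qed
  moreover have "square_integrable M (\<Gamma> f)" if "square_integrable M f" for f
    using \<Gamma>[OF that] unfolding span_limit_def by blast
  moreover have "l2_inner M (\<Gamma> f) (\<Gamma> p) = l2_inner M f p"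
    if "square_integrable M f" "square_integrable M p" for f p
    using span_limit_isometric[OF \<Gamma>[OF that(1)] \<Gamma>[OF that(2)]] by simp
  moreover have "AE x in M. \<Gamma> (g i) x = h i x" for i
    by (rule \<Gamma>_unique[OF span_limit_base])
  ultimately show ?thesis by blast
qed

end

section \<open>The Hilbert space of square integrable functions\<close>

definition l2_class :: "'a measure \<Rightarrow> ('a \<Rightarrow> complex) \<Rightarrow> ('a \<Rightarrow> complex) set" where
  "l2_class M f = {g. square_integrable M g \<and> (AE x in M. g x = f x)}"

definition l2_rep :: "('a \<Rightarrow> complex) set \<Rightarrow> 'a \<Rightarrow> complex" where
  "l2_rep X = (SOME f. f \<in> X)"

definition l2_space :: "'a measure \<Rightarrow> ('a \<Rightarrow> complex) set hilbert" where
  "l2_space M =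
     \<lparr>carrier = l2_class M ` {f. square_integrable M f},
      mult = (\<lambda>X Y. l2_class M (\<lambda>x. 0)), one = l2_class M (\<lambda>x. 0),
      zero = l2_class M (\<lambda>x. 0), add = (\<lambda>X Y. l2_class M (\<lambda>x. l2_rep X x + l2_rep Y x)),
      smult = (\<lambda>c X. l2_class M (\<lambda>x. c * l2_rep X x)),
      hinner = (\<lambda>X Y. l2_inner M (l2_rep X) (l2_rep Y))\<rparr>"

lemma l2_class_in_carrier: "square_integrable M f \<Longrightarrow> l2_class M f \<in> carrier (l2_space M)"
  by (simp add: l2_space_def)

lemma l2_rep_in:
  assumes "X \<in> carrier (l2_space M)" shows "l2_rep X \<in> X"
proof -
  obtain f where "X = l2_class M f" "square_integrable M f"
    using assms by (auto simp: l2_space_def)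
  then have "f \<in> X" by (simp add: l2_class_def)
  then show ?thesis unfolding l2_rep_def by (rule someI[of "\<lambda>f. f \<in> X"])
qed

lemma l2_rep_square_integrable: "X \<in> carrier (l2_space M) \<Longrightarrow> square_integrable M (l2_rep X)"
  using l2_rep_in[of X M] by (auto simp: l2_space_def l2_class_def)

lemma l2_rep_class: "square_integrable M f \<Longrightarrow> AE x in M. l2_rep (l2_class M f) x = f x"
  using l2_rep_in[OF l2_class_in_carrier[of M f]] by (auto simp: l2_class_def)

lemma l2_class_cong:
  assumes "AE x in M. f x = g x" shows "l2_class M f = l2_class M g"
proof -
  have "(AE x in M. k x = f x) \<longleftrightarrow> (AE x in M. k x = g x)" for k
  proof
    assume "AE x in M. k x = f x"
    then show "AE x in M. k x = g x" using assms by eventually_elim simp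
  next
    assume "AE x in M. k x = g x"
    then show "AE x in M. k x = f x" using assms by eventually_elim simp
  qed
  then show ?thesis unfolding l2_class_def by simp
qed

lemma l2_class_rep:
  assumes "X \<in> carrier (l2_space M)" shows "l2_class M (l2_rep X) = X"
proof -
  obtain f where f: "X = l2_class M f" "square_integrable M f"
    using assms by (auto simp: l2_space_def)
  then show ?thesis
    using l2_class_cong[OF l2_rep_class[OF f(2)]] by simp
qed

lemma l2_eqI:
  assumes "X \<in> carrier (l2_space M)" "Y \<in> carrier (l2_space M)" "AE x in M. l2_rep X x = l2_rep Y x"
  shows "X = Y"
  using l2_class_cong[OF assms(3)] assms(1,2) by (simp add: l2_class_rep)

lemma l2_add_closed:
  "\<lbrakk>X \<in> carrier (l2_space M); Y \<in> carrier (l2_space M)\<rbrakk> \<Longrightarrow> X \<oplus>\<^bsub>l2_space M\<^esub> Y \<in> carrier (l2_space M)"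
  using l2_class_in_carrier[OF square_integrable_add[OF l2_rep_square_integrable l2_rep_square_integrable]]
  by (simp add: l2_space_def)

lemma l2_smult_closed:
  "X \<in> carrier (l2_space M) \<Longrightarrow> c \<odot>\<^bsub>l2_space M\<^esub> X \<in> carrier (l2_space M)"
  using l2_class_in_carrier[OF square_integrable_cmult[OF l2_rep_square_integrable]]
  by (simp add: l2_space_def)

lemma l2_zero_closed: "\<zero>\<^bsub>l2_space M\<^esub> \<in> carrier (l2_space M)"
  using l2_class_in_carrier[OF square_integrable_zero] by (simp add: l2_space_def)

lemma l2_rep_add:
  "\<lbrakk>X \<in> carrier (l2_space M); Y \<in> carrier (l2_space M)\<rbrakk> \<Longrightarrow>
    AE x in M. l2_rep (X \<oplus>\<^bsub>l2_space M\<^esub> Y) x = l2_rep X x + l2_rep Y x"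
  using l2_rep_class[OF square_integrable_add[OF l2_rep_square_integrable l2_rep_square_integrable]]
  by (simp add: l2_space_def)

lemma l2_rep_smult:
  "X \<in> carrier (l2_space M) \<Longrightarrow> AE x in M. l2_rep (c \<odot>\<^bsub>l2_space M\<^esub> X) x = c * l2_rep X x"
  using l2_rep_class[OF square_integrable_cmult[OF l2_rep_square_integrable]]
  by (simp add: l2_space_def)

lemma l2_rep_zero: "AE x in M. l2_rep \<zero>\<^bsub>l2_space M\<^esub> x = 0"
  using l2_rep_class[OF square_integrable_zero] by (simp add: l2_space_def)

lemma hinner_l2_space: "hinner (l2_space M) X Y = l2_inner M (l2_rep X) (l2_rep Y)"
  by (simp add: l2_space_def)

lemma abelian_group_l2_space: "abelian_group (l2_space M)"
proof (rule abelian_groupI)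
  fix X Y Z
  assume X: "X \<in> carrier (l2_space M)"
  show "\<exists>Y\<in>carrier (l2_space M). Y \<oplus>\<^bsub>l2_space M\<^esub> X = \<zero>\<^bsub>l2_space M\<^esub>"
  proof (intro bexI l2_eqI)
    show "AE x in M. l2_rep ((-1) \<odot>\<^bsub>l2_space M\<^esub> X \<oplus>\<^bsub>l2_space M\<^esub> X) x = l2_rep \<zero>\<^bsub>l2_space M\<^esub> x"
      using l2_rep_add[OF l2_smult_closed[OF X] X, of "-1"] l2_rep_smult[OF X, of "-1"] l2_rep_zero
      by eventually_elim simp
  qed (simp_all add: X l2_smult_closed l2_add_closed l2_zero_closed)
  show "\<zero>\<^bsub>l2_space M\<^esub> \<oplus>\<^bsub>l2_space M\<^esub> X = X"
  proof (rule l2_eqI)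
    show "AE x in M. l2_rep (\<zero>\<^bsub>l2_space M\<^esub> \<oplus>\<^bsub>l2_space M\<^esub> X) x = l2_rep X x"
      using l2_rep_add[OF l2_zero_closed X] l2_rep_zero by eventually_elim simp
  qed (simp_all add: X l2_add_closed l2_zero_closed)
  assume Y: "Y \<in> carrier (l2_space M)"
  show "X \<oplus>\<^bsub>l2_space M\<^esub> Y = Y \<oplus>\<^bsub>l2_space M\<^esub> X"
    by (simp add: l2_space_def add.commute)
  assume Z: "Z \<in> carrier (l2_space M)"
  show "X \<oplus>\<^bsub>l2_space M\<^esub> Y \<oplus>\<^bsub>l2_space M\<^esub> Z = X \<oplus>\<^bsub>l2_space M\<^esub> (Y \<oplus>\<^bsub>l2_space M\<^esub> Z)"
  proof (rule l2_eqI)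
    show "AE x in M. l2_rep (X \<oplus>\<^bsub>l2_space M\<^esub> Y \<oplus>\<^bsub>l2_space M\<^esub> Z) x
        = l2_rep (X \<oplus>\<^bsub>l2_space M\<^esub> (Y \<oplus>\<^bsub>l2_space M\<^esub> Z)) x"
      using l2_rep_add[OF X Y] l2_rep_add[OF Y Z] l2_rep_add[OF l2_add_closed[OF X Y] Z]
        l2_rep_add[OF X l2_add_closed[OF Y Z]]
      by eventually_elim simp
  qed (simp_all add: X Y Z l2_add_closed)
qed (simp_all add: l2_add_closed l2_zero_closed)

lemma module_l2_space: "module (class_ring :: complex ring) (l2_space M)"
proof (rule moduleI)
  show "cring (class_ring :: complex ring)"
    by (rule class_cring.is_cring)
  show "abelian_group (l2_space M)" by (rule abelian_group_l2_space)
  fix a b :: complex and X Y assume X: "X \<in> carrier (l2_space M)"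
  show "a \<odot>\<^bsub>l2_space M\<^esub> X \<in> carrier (l2_space M)"
    by (rule l2_smult_closed[OF X])
  show "(a \<oplus>\<^bsub>class_ring\<^esub> b) \<odot>\<^bsub>l2_space M\<^esub> X = a \<odot>\<^bsub>l2_space M\<^esub> X \<oplus>\<^bsub>l2_space M\<^esub> b \<odot>\<^bsub>l2_space M\<^esub> X"
  proof (rule l2_eqI)
    show "AE x in M. l2_rep ((a \<oplus>\<^bsub>class_ring\<^esub> b) \<odot>\<^bsub>l2_space M\<^esub> X) x
        = l2_rep (a \<odot>\<^bsub>l2_space M\<^esub> X \<oplus>\<^bsub>l2_space M\<^esub> b \<odot>\<^bsub>l2_space M\<^esub> X) x"
      using l2_rep_smult[OF X, of "a + b"] l2_rep_smult[OF X, of a] l2_rep_smult[OF X, of b]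
        l2_rep_add[OF l2_smult_closed[OF X] l2_smult_closed[OF X], of a b]
      by eventually_elim (simp add: algebra_simps)
  qed (simp_all add: X l2_smult_closed l2_add_closed)
  show "(a \<otimes>\<^bsub>class_ring\<^esub> b) \<odot>\<^bsub>l2_space M\<^esub> X = a \<odot>\<^bsub>l2_space M\<^esub> (b \<odot>\<^bsub>l2_space M\<^esub> X)"
  proof (rule l2_eqI)
    show "AE x in M. l2_rep ((a \<otimes>\<^bsub>class_ring\<^esub> b) \<odot>\<^bsub>l2_space M\<^esub> X) x
        = l2_rep (a \<odot>\<^bsub>l2_space M\<^esub> (b \<odot>\<^bsub>l2_space M\<^esub> X)) x"
      using l2_rep_smult[OF X, of "a * b"] l2_rep_smult[OF X, of b]
        l2_rep_smult[OF l2_smult_closed[OF X], of a b]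
      by eventually_elim simp
  qed (simp_all add: X l2_smult_closed)
  show "\<one>\<^bsub>class_ring\<^esub> \<odot>\<^bsub>l2_space M\<^esub> X = X"
  proof (rule l2_eqI)
    show "AE x in M. l2_rep (\<one>\<^bsub>class_ring\<^esub> \<odot>\<^bsub>l2_space M\<^esub> X) x = l2_rep X x"
      using l2_rep_smult[OF X, of 1] by eventually_elim simp
  qed (simp_all add: X l2_smult_closed)
  assume Y: "Y \<in> carrier (l2_space M)"
  show "a \<odot>\<^bsub>l2_space M\<^esub> (X \<oplus>\<^bsub>l2_space M\<^esub> Y) = a \<odot>\<^bsub>l2_space M\<^esub> X \<oplus>\<^bsub>l2_space M\<^esub> a \<odot>\<^bsub>l2_space M\<^esub> Y"
  proof (rule l2_eqI)
    show "AE x in M. l2_rep (a \<odot>\<^bsub>l2_space M\<^esub> (X \<oplus>\<^bsub>l2_space M\<^esub> Y)) x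
        = l2_rep (a \<odot>\<^bsub>l2_space M\<^esub> X \<oplus>\<^bsub>l2_space M\<^esub> a \<odot>\<^bsub>l2_space M\<^esub> Y) x"
      using l2_rep_smult[OF l2_add_closed[OF X Y], of a] l2_rep_add[OF X Y]
        l2_rep_smult[OF X, of a] l2_rep_smult[OF Y, of a]
        l2_rep_add[OF l2_smult_closed[OF X] l2_smult_closed[OF Y], of a a]
      by eventually_elim (simp add: algebra_simps)
  qed (simp_all add: X Y l2_smult_closed l2_add_closed)
qed

lemma (in abelian_group) minus_add_cancel:
  "\<lbrakk>x \<in> carrier G; y \<in> carrier G\<rbrakk> \<Longrightarrow> (x \<ominus> y) \<oplus> y = x"
  by (simp add: a_minus_def a_assoc l_neg)

lemma l2_rep_minus:
  assumes X: "X \<in> carrier (l2_space M)" and Y: "Y \<in> carrier (l2_space M)"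
  shows "AE x in M. l2_rep (X \<ominus>\<^bsub>l2_space M\<^esub> Y) x = l2_rep X x - l2_rep Y x"
proof -
  interpret abelian_group "l2_space M" by (rule abelian_group_l2_space)
  have "AE x in M. l2_rep ((X \<ominus>\<^bsub>l2_space M\<^esub> Y) \<oplus>\<^bsub>l2_space M\<^esub> Y) x
      = l2_rep (X \<ominus>\<^bsub>l2_space M\<^esub> Y) x + l2_rep Y x"
    using X Y by (intro l2_rep_add) simp_all
  then show ?thesis
    unfolding minus_add_cancel[OF X Y] by eventually_elim simp
qed

lemma hnorm_l2_space: "hnorm (l2_space M) X = sqrt (l2_sqnorm M (l2_rep X))"
  by (simp add: hnorm_def hinner_l2_space l2_inner_self)

lemma l2_sqnorm_cong_AE:
  assumes "AE x in M. f x = g x" "square_integrable M f" "square_integrable M g"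
  shows "l2_sqnorm M f = l2_sqnorm M g"
  using l2_inner_cong_AE[OF assms(1,1,2,2,3,3)] by (simp only: l2_inner_self of_real_eq_iff)

lemma l2_sqnorm_rep_minus:
  assumes X: "X \<in> carrier (l2_space M)" and Y: "Y \<in> carrier (l2_space M)"
  shows "l2_sqnorm M (l2_rep (X \<ominus>\<^bsub>l2_space M\<^esub> Y)) = l2_sqnorm M (\<lambda>x. l2_rep X x - l2_rep Y x)"
proof (rule l2_sqnorm_cong_AE[OF l2_rep_minus[OF X Y]])
  interpret abelian_group "l2_space M" by (rule abelian_group_l2_space)
  show "square_integrable M (l2_rep (X \<ominus>\<^bsub>l2_space M\<^esub> Y))"
    using X Y by (intro l2_rep_square_integrable) simp
qed (intro square_integrable_diff l2_rep_square_integrable X Y)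

theorem (in prob_space) complex_hilbert_space_l2_space: "complex_hilbert_space (l2_space M)"
proof -
  interpret module "class_ring :: complex ring" "l2_space M" by (rule module_l2_space)
  note sq = l2_rep_square_integrable
  show ?thesis
  proof unfold_locales
    fix X Y Z assume X: "X \<in> carrier (l2_space M)" and Y: "Y \<in> carrier (l2_space M)"
    show "hinner (l2_space M) X (c \<odot>\<^bsub>l2_space M\<^esub> Y) = c * hinner (l2_space M) X Y" for c
      unfolding hinner_l2_space l2_inner_cmult_right[symmetric]
      using X Y l2_rep_smult[OF Y, of c] l2_smult_closed[OF Y, of c]
      by (intro l2_inner_cong_AE) (auto intro: sq square_integrable_cmult)
    show "hinner (l2_space M) Y X = cnj (hinner (l2_space M) X Y)"
      unfolding hinner_l2_space by (rule l2_inner_cnj)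
    assume Z: "Z \<in> carrier (l2_space M)"
    show "hinner (l2_space M) X (Y \<oplus>\<^bsub>l2_space M\<^esub> Z) = hinner (l2_space M) X Y + hinner (l2_space M) X Z"
      unfolding hinner_l2_space l2_inner_add_right[OF sq[OF X] sq[OF Y] sq[OF Z], symmetric]
      using X Y Z l2_rep_add[OF Y Z] l2_add_closed[OF Y Z]
      by (intro l2_inner_cong_AE) (auto intro: sq square_integrable_add)
  next
    fix X assume X: "X \<in> carrier (l2_space M)" and ne: "X \<noteq> \<zero>\<^bsub>l2_space M\<^esub>"
    have "l2_sqnorm M (l2_rep X) \<noteq> 0"
    proof
      assume "l2_sqnorm M (l2_rep X) = 0"
      have "AE x in M. l2_rep X x = l2_rep \<zero>\<^bsub>l2_space M\<^esub> x"
        using l2_sqnorm_eq_0[OF sq[OF X] \<open>l2_sqnorm M (l2_rep X) = 0\<close>] l2_rep_zero[of M]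
        by eventually_elim simp
      then show False using l2_eqI[OF X l2_zero_closed] ne by blast
    qed
    then show "0 < Re (hinner (l2_space M) X X)"
      unfolding hinner_l2_space l2_inner_self by (simp add: less_le)
  next
    fix \<sigma> :: "nat \<Rightarrow> _"
    assume \<sigma>: "\<And>n. \<sigma> n \<in> carrier (l2_space M)"
      and cauchy: "\<forall>e>0. \<exists>K. \<forall>m\<ge>K. \<forall>n\<ge>K. hnorm (l2_space M) (\<sigma> m \<ominus>\<^bsub>l2_space M\<^esub> \<sigma> n) < e"
    have "\<exists>g. square_integrable M g \<and> (\<lambda>n. l2_sqnorm M (\<lambda>x. l2_rep (\<sigma> n) x - g x)) \<longlonglongrightarrow> 0"
    proof (rule Riesz_Fischer[OF sq[OF \<sigma>]])
      fix e :: real assume "e > 0"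
      then have "sqrt e > 0" by simp
      then obtain K where "\<forall>m\<ge>K. \<forall>n\<ge>K. hnorm (l2_space M) (\<sigma> m \<ominus>\<^bsub>l2_space M\<^esub> \<sigma> n) < sqrt e"
        using cauchy by blast
      then show "\<exists>K. \<forall>m\<ge>K. \<forall>n\<ge>K. l2_sqnorm M (\<lambda>x. l2_rep (\<sigma> m) x - l2_rep (\<sigma> n) x) < e"
        unfolding hnorm_l2_space l2_sqnorm_rep_minus[OF \<sigma> \<sigma>] by auto
    qed
    then obtain g where g: "square_integrable M g"
      "(\<lambda>n. l2_sqnorm M (\<lambda>x. l2_rep (\<sigma> n) x - g x)) \<longlonglongrightarrow> 0" by blast
    have "hnorm (l2_space M) (\<sigma> n \<ominus>\<^bsub>l2_space M\<^esub> l2_class M g) = sqrt (l2_sqnorm M (\<lambda>x. l2_rep (\<sigma> n) x - g x))" for n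
    proof -
      have "AE x in M. l2_rep (\<sigma> n) x - l2_rep (l2_class M g) x = l2_rep (\<sigma> n) x - g x"
        using l2_rep_class[OF g(1)] by eventually_elim simp
      then show ?thesis
        unfolding hnorm_l2_space l2_sqnorm_rep_minus[OF \<sigma> l2_class_in_carrier[OF g(1)]]
        using sq[OF \<sigma>, of n] sq[OF l2_class_in_carrier[OF g(1)]] g(1)
        by (subst l2_sqnorm_cong_AE) (auto intro: square_integrable_diff)
    qed
    then have "(\<lambda>n. hnorm (l2_space M) (\<sigma> n \<ominus>\<^bsub>l2_space M\<^esub> l2_class M g)) \<longlonglongrightarrow> 0"
      using tendsto_real_sqrt[OF g(2)] by simp
    then show "\<exists>X\<in>carrier (l2_space M). (\<lambda>n. hnorm (l2_space M) (\<sigma> n \<ominus>\<^bsub>l2_space M\<^esub> X)) \<longlonglongrightarrow> 0"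
      using l2_class_in_carrier[OF g(1)] by blast
  qed
qed

lemma (in prob_space) l2_space_nontrivial: "carrier (l2_space M) \<noteq> {\<zero>\<^bsub>l2_space M\<^esub>}"
proof
  assume triv: "carrier (l2_space M) = {\<zero>\<^bsub>l2_space M\<^esub>}"
  have sq: "square_integrable M (\<lambda>x. 1)" by (simp add: square_integrable_def)
  have "l2_class M (\<lambda>x. 1) = \<zero>\<^bsub>l2_space M\<^esub>"
    using l2_class_in_carrier[OF sq] triv by blast
  then have "AE x in M. l2_rep \<zero>\<^bsub>l2_space M\<^esub> x = 1"
    using l2_rep_class[OF sq] by simp
  then have "AE x in M. (1::complex) = 0"
    using l2_rep_zero[of M] by eventually_elim simp
  then show False by simp
qed

section \<open>Multiplication operators and their functional calculus\<close>

lemma (in prob_space) bounded_square_integrable: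
  assumes [measurable]: "u \<in> borel_measurable M" and bd: "\<And>t. cmod (u t) \<le> C"
  shows "square_integrable M u"
  using square_integrable_bounded_mult[of M "\<lambda>t. 1" u C] assms by (simp add: square_integrable_def)

text \<open>
  The truncations of \<open>k\<close> to the sets where \<open>\<bar>g\<bar>\<close> and \<open>\<bar>k\<bar>\<close> are bounded by \<open>n\<close> exhaust \<open>k\<close>, so that
  they are sufficiently many test functions.
\<close>

lemma AE_zero_by_truncation:
  fixes k g :: "'a \<Rightarrow> complex"
  assumes [measurable]: "k \<in> borel_measurable M" "g \<in> borel_measurable M"
    and test: "\<And>u C. u \<in> borel_measurable M \<Longrightarrow> (\<And>t. cmod (u t) \<le> C) \<Longrightarrow>
      (\<And>t. cmod (g t * u t) \<le> C) \<Longrightarrow>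
      integrable M (\<lambda>t. cnj (u t) * k t) \<and> (\<integral>t. cnj (u t) * k t \<partial>M) = 0"
  shows "AE t in M. k t = 0"
proof -
  have "AE t in M. cmod (g t) \<le> real n \<and> cmod (k t) \<le> real n \<longrightarrow> k t = 0" for n :: nat
  proof -
    define u where "u t = (if cmod (g t) \<le> real n \<and> cmod (k t) \<le> real n then k t else 0)" for t
    have [measurable]: "u \<in> borel_measurable M" unfolding u_def by measurable
    have "integrable M (\<lambda>t. cnj (u t) * k t) \<and> (\<integral>t. cnj (u t) * k t \<partial>M) = 0"
    proof (rule test[of _ "real n + real n * real n"])
      show "cmod (u t) \<le> real n + real n * real n" for t
        unfolding u_def by (auto intro: add_increasing2)
      show "cmod (g t * u t) \<le> real n + real n * real n" for t
        unfolding u_def by (auto simp: norm_mult intro!: add_increasing mult_mono)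
    qed measurable
    moreover have "cnj (u t) * k t = complex_of_real ((cmod (u t))\<^sup>2)" for t
      unfolding u_def by (simp add: complex_norm_square mult.commute del: of_real_power)
    ultimately have "integrable M (\<lambda>t. complex_of_real ((cmod (u t))\<^sup>2))"
      "(\<integral>t. complex_of_real ((cmod (u t))\<^sup>2) \<partial>M) = 0" by simp_all
    then have "integrable M (\<lambda>t. (cmod (u t))\<^sup>2)" "(\<integral>t. (cmod (u t))\<^sup>2 \<partial>M) = 0"
      by (simp_all only: complex_of_real_integrable_eq integral_complex_of_real of_real_eq_0_iff)
    then have "AE t in M. (cmod (u t))\<^sup>2 = 0"
      by (subst (asm) integral_nonneg_eq_0_iff_AE) auto
    then show ?thesis by eventually_elim (auto simp: u_def split: if_splits)
  qed
  then have "AE t in M. \<forall>n::nat. cmod (g t) \<le> real n \<and> cmod (k t) \<le> real n \<longrightarrow> k t = 0"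
    unfolding AE_all_countable by blast
  then show ?thesis
  proof eventually_elim
    case (elim t)
    obtain n :: nat where "max (cmod (g t)) (cmod (k t)) \<le> real n" using real_arch_simple by blast
    then show ?case using elim by auto
  qed
qed

lemma (in complex_hilbert_space) smult_in_carrier: "x \<in> carrier H \<Longrightarrow> c \<odot>\<^bsub>H\<^esub> x \<in> carrier H"
  by (rule smult_closed) simp_all

text \<open>
  A unitary \<open>U\<close> onto \<open>L\<^sup>2\<close>, given by representatives of the values, turns functions into operators.
\<close>

locale L2_model = complex_hilbert_space H + prob_space M
  for H :: "('h, 'm) hilbert_scheme" (structure) and M :: "'a measure" +
  fixes U :: "'h \<Rightarrow> 'a \<Rightarrow> complex"
  assumes U_sq: "x \<in> carrier H \<Longrightarrow> square_integrable M (U x)"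
    and U_add: "\<lbrakk>x \<in> carrier H; y \<in> carrier H\<rbrakk> \<Longrightarrow> AE t in M. U (x \<oplus>\<^bsub>H\<^esub> y) t = U x t + U y t"
    and U_smult: "x \<in> carrier H \<Longrightarrow> AE t in M. U (c \<odot>\<^bsub>H\<^esub> x) t = c * U x t"
    and U_inner: "\<lbrakk>x \<in> carrier H; y \<in> carrier H\<rbrakk> \<Longrightarrow> hinner H x y = l2_inner M (U x) (U y)"
    and U_surj: "square_integrable M f \<Longrightarrow> \<exists>x\<in>carrier H. AE t in M. U x t = f t"
begin

lemma U_measurable [measurable (raw)]: "x \<in> carrier H \<Longrightarrow> U x \<in> borel_measurable M"
  by (rule square_integrable_measurable[OF U_sq])

lemma U_minus:
  assumes x: "x \<in> carrier H" and y: "y \<in> carrier H"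
  shows "AE t in M. U (x \<ominus>\<^bsub>H\<^esub> y) t = U x t - U y t"
proof -
  have "AE t in M. U ((x \<ominus>\<^bsub>H\<^esub> y) \<oplus>\<^bsub>H\<^esub> y) t = U (x \<ominus>\<^bsub>H\<^esub> y) t + U y t"
    using x y by (intro U_add) simp_all
  then show ?thesis
    unfolding minus_add_cancel[OF x y] by eventually_elim simp
qed

lemma hinner_self: "x \<in> carrier H \<Longrightarrow> hinner H x x = of_real (l2_sqnorm M (U x))"
  by (simp add: U_inner l2_inner_self)

lemma hnorm_eq: "x \<in> carrier H \<Longrightarrow> hnorm H x = sqrt (l2_sqnorm M (U x))"
  by (simp add: hnorm_def hinner_self)

lemma U_eqI:
  assumes x: "x \<in> carrier H" and y: "y \<in> carrier H" and eq: "AE t in M. U x t = U y t"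
  shows "x = y"
proof -
  have xy: "x \<ominus>\<^bsub>H\<^esub> y \<in> carrier H" using x y by simp
  have "AE t in M. U (x \<ominus>\<^bsub>H\<^esub> y) t = 0"
    using U_minus[OF x y] eq by eventually_elim simp
  then have "l2_sqnorm M (U (x \<ominus>\<^bsub>H\<^esub> y)) = l2_sqnorm M (\<lambda>t. 0)"
    by (intro l2_sqnorm_cong_AE U_sq xy) simp_all
  then have "Re (hinner H (x \<ominus>\<^bsub>H\<^esub> y) (x \<ominus>\<^bsub>H\<^esub> y)) = 0"
    by (simp add: hinner_self[OF xy]) (simp add: l2_sqnorm_def)
  then have "x \<ominus>\<^bsub>H\<^esub> y = \<zero>\<^bsub>H\<^esub>"
    using hinner_pos[OF xy] by force
  then show ?thesis using minus_add_cancel[OF x y] y by simp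
qed

definition vec_of :: "('a \<Rightarrow> complex) \<Rightarrow> 'h" where
  "vec_of f = (SOME x. x \<in> carrier H \<and> (AE t in M. U x t = f t))"

lemma
  assumes "square_integrable M f"
  shows vec_of_carrier: "vec_of f \<in> carrier H" and U_vec_of: "AE t in M. U (vec_of f) t = f t"
proof -
  have "\<exists>x. x \<in> carrier H \<and> (AE t in M. U x t = f t)"
    using U_surj[OF assms] by blast
  then have "vec_of f \<in> carrier H \<and> (AE t in M. U (vec_of f) t = f t)"
    unfolding vec_of_def by (rule someI_ex)
  then show "vec_of f \<in> carrier H" "AE t in M. U (vec_of f) t = f t" by simp_all
qed

lemma hinner_vec_of_left:
  assumes "square_integrable M f" "y \<in> carrier H"
  shows "hinner H (vec_of f) y = l2_inner M f (U y)"
  unfolding U_inner[OF vec_of_carrier[OF assms(1)] assms(2)]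
  using U_vec_of[OF assms(1)] U_sq[OF vec_of_carrier[OF assms(1)]] U_sq[OF assms(2)] assms(1)
  by (intro l2_inner_cong_AE) auto

lemma hinner_vec_of_right:
  assumes "square_integrable M f" "y \<in> carrier H"
  shows "hinner H y (vec_of f) = l2_inner M (U y) f"
  unfolding U_inner[OF assms(2) vec_of_carrier[OF assms(1)]]
  using U_vec_of[OF assms(1)] U_sq[OF vec_of_carrier[OF assms(1)]] U_sq[OF assms(2)] assms(1)
  by (intro l2_inner_cong_AE) auto

definition mult_op :: "('a \<Rightarrow> complex) \<Rightarrow> 'h rel" where
  "mult_op g = {(x, y). x \<in> carrier H \<and> y \<in> carrier H \<and> (AE t in M. U y t = g t * U x t)}"

lemma mult_op_vec_of:
  assumes "square_integrable M f" "square_integrable M (\<lambda>t. g t * f t)"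
  shows "(vec_of f, vec_of (\<lambda>t. g t * f t)) \<in> mult_op g"
  unfolding mult_op_def
proof (clarsimp simp: vec_of_carrier assms)
  show "AE t in M. U (vec_of (\<lambda>t. g t * f t)) t = g t * U (vec_of f) t"
    using U_vec_of[OF assms(1)] U_vec_of[OF assms(2)] by eventually_elim simp
qed

lemma mult_op_eqI: "(\<And>t. f t = g t) \<Longrightarrow> mult_op f = mult_op g"
  unfolding mult_op_def by simp

text \<open>
  The domain is dense because it contains the truncations of every vector to the sets where
  \<open>\<bar>g\<bar> \<le> n\<close>.
\<close>

lemma densely_defined_mult_op:
  assumes [measurable]: "g \<in> borel_measurable M"
  shows "densely_defined_operator H (mult_op g)"
  unfolding densely_defined_operator_def
proof (intro conjI ballI allI impI)
  show "mult_op g \<subseteq> carrier H \<times> carrier H"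
    by (auto simp: mult_op_def)
  show "single_valued (mult_op g)"
  proof (rule single_valuedI)
    fix x y z assume "(x, y) \<in> mult_op g" "(x, z) \<in> mult_op g"
    then have "y \<in> carrier H" "z \<in> carrier H" and
      eq: "AE t in M. U y t = g t * U x t" "AE t in M. U z t = g t * U x t"
      by (auto simp: mult_op_def)
    moreover have "AE t in M. U y t = U z t"
      using eq by eventually_elim simp
    ultimately show "y = z" by (intro U_eqI)
  qed
next
  fix p assume p: "p \<in> mult_op g"
  obtain x y where xy: "p = (x, y)" by fastforce
  have x: "x \<in> carrier H" "y \<in> carrier H" and eq: "AE t in M. U y t = g t * U x t"
    using p unfolding xy by (auto simp: mult_op_def)
  have "(c \<odot>\<^bsub>H\<^esub> x, c \<odot>\<^bsub>H\<^esub> y) \<in> mult_op g" for c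
  proof -
    have "AE t in M. U (c \<odot>\<^bsub>H\<^esub> y) t = g t * U (c \<odot>\<^bsub>H\<^esub> x) t"
      using eq U_smult[OF x(1), of c] U_smult[OF x(2), of c] by eventually_elim simp
    then show ?thesis using x by (simp add: mult_op_def smult_in_carrier)
  qed
  then show "case p of (x, y) \<Rightarrow> \<forall>c. (c \<odot>\<^bsub>H\<^esub> x, c \<odot>\<^bsub>H\<^esub> y) \<in> mult_op g"
    unfolding xy by simp
  have "(x \<oplus>\<^bsub>H\<^esub> x', y \<oplus>\<^bsub>H\<^esub> y') \<in> mult_op g" if "(x', y') \<in> mult_op g" for x' y'
  proof -
    have x': "x' \<in> carrier H" "y' \<in> carrier H" and eq': "AE t in M. U y' t = g t * U x' t"
      using that by (auto simp: mult_op_def)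
    have "AE t in M. U (y \<oplus>\<^bsub>H\<^esub> y') t = g t * U (x \<oplus>\<^bsub>H\<^esub> x') t"
      using eq eq' U_add[OF x(1) x'(1)] U_add[OF x(2) x'(2)] by eventually_elim (simp add: algebra_simps)
    then show ?thesis using x x' by (simp add: mult_op_def)
  qed
  then show "case p of (x, y) \<Rightarrow> \<forall>(x', y')\<in>mult_op g. (x \<oplus>\<^bsub>H\<^esub> x', y \<oplus>\<^bsub>H\<^esub> y') \<in> mult_op g"
    unfolding xy by auto
next
  fix x and e :: real assume x: "x \<in> carrier H" and e: "e > 0"
  define f where "f n t = (if cmod (g t) \<le> real n then U x t else 0)" for n :: nat and t
  have [measurable]: "U x \<in> borel_measurable M" by (rule U_measurable[OF x])
  have [measurable]: "f n \<in> borel_measurable M" for n unfolding f_def by measurable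
  have f_sq: "square_integrable M (f n)" for n
    by (rule square_integrable_dominated[OF U_sq[OF x], of _ 1]) (auto simp: f_def)
  have gf_sq: "square_integrable M (\<lambda>t. g t * f n t)" for n
    by (rule square_integrable_dominated[OF U_sq[OF x], of _ "real n"])
      (auto simp: f_def norm_mult intro!: mult_right_mono)
  have "(\<lambda>n. \<integral>t. (cmod (U x t - f n t))\<^sup>2 \<partial>M) \<longlonglongrightarrow> (\<integral>t. 0 \<partial>M)"
  proof (rule integral_dominated_convergence)
    show "integrable M (\<lambda>t. (cmod (U x t))\<^sup>2)"
      by (rule square_integrable_integrable[OF U_sq[OF x]])
    show "AE t in M. norm ((cmod (U x t - f n t))\<^sup>2) \<le> (cmod (U x t))\<^sup>2" for n
      by (simp add: f_def)
    have "(\<lambda>n. (cmod (U x t - f n t))\<^sup>2) \<longlonglongrightarrow> 0" for t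
    proof (rule tendsto_eventually)
      obtain m :: nat where "cmod (g t) \<le> real m" using real_arch_simple by blast
      then show "\<forall>\<^sub>F n in sequentially. (cmod (U x t - f n t))\<^sup>2 = 0"
        unfolding eventually_sequentially f_def by (intro exI[of _ m]) auto
    qed
    then show "AE t in M. (\<lambda>n. (cmod (U x t - f n t))\<^sup>2) \<longlonglongrightarrow> 0" by simp
  qed measurable
  then have "(\<lambda>n. l2_sqnorm M (\<lambda>t. U x t - f n t)) \<longlonglongrightarrow> 0"
    by (simp add: l2_sqnorm_def)
  then have lim: "(\<lambda>n. sqrt (l2_sqnorm M (\<lambda>t. U x t - f n t))) \<longlonglongrightarrow> 0"
    using tendsto_real_sqrt by fastforce
  obtain n where n: "sqrt (l2_sqnorm M (\<lambda>t. U x t - f n t)) < e"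
    using eventually_happens'[OF sequentially_bot order_tendstoD(2)[OF lim e]] by blast
  have "AE t in M. U (x \<ominus>\<^bsub>H\<^esub> vec_of (f n)) t = U x t - f n t"
    using U_minus[OF x vec_of_carrier[OF f_sq[of n]]] U_vec_of[OF f_sq[of n]] by eventually_elim simp
  then have "hnorm H (x \<ominus>\<^bsub>H\<^esub> vec_of (f n)) = sqrt (l2_sqnorm M (\<lambda>t. U x t - f n t))"
    using x vec_of_carrier[OF f_sq]
    by (subst hnorm_eq) (auto intro!: l2_sqnorm_cong_AE U_sq square_integrable_diff f_sq)
  then show "\<exists>y\<in>Domain (mult_op g). hnorm H (x \<ominus>\<^bsub>H\<^esub> y) < e"
    using n mult_op_vec_of[OF f_sq gf_sq] by (intro bexI[of _ "vec_of (f n)"]) auto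
qed

text \<open>
  If \<open>(y, z)\<close> is in the graph of the adjoint, then \<open>g \<cdot> U y - U z\<close> is orthogonal to all bounded
  functions that remain bounded when multiplied by \<open>g\<close>, and so it vanishes.
\<close>

lemma self_adjoint_mult_op:
  fixes g :: "'a \<Rightarrow> real"
  assumes [measurable]: "g \<in> borel_measurable M"
  shows "self_adjoint H (mult_op (\<lambda>t. of_real (g t)))"
  unfolding self_adjoint_def
proof (intro conjI equalityI subrelI)
  let ?A = "mult_op (\<lambda>t. complex_of_real (g t))"
  show "densely_defined_operator H ?A"
    by (rule densely_defined_mult_op) measurable
  fix y z
  show "(y, z) \<in> adjoint_op H ?A" if "(y, z) \<in> ?A"
  proof -
    have y: "y \<in> carrier H" "z \<in> carrier H" and eq: "AE t in M. U z t = of_real (g t) * U y t"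
      using that by (auto simp: mult_op_def)
    have "hinner H w y = hinner H x z" if "(x, w) \<in> ?A" for x w
    proof -
      have x: "x \<in> carrier H" "w \<in> carrier H" and eq': "AE t in M. U w t = of_real (g t) * U x t"
        using that by (auto simp: mult_op_def)
      note [measurable] = U_measurable[OF x(1)] U_measurable[OF x(2)] U_measurable[OF y(1)] U_measurable[OF y(2)]
      have "AE t in M. cnj (U w t) * U y t = cnj (U x t) * U z t"
        using eq eq' by eventually_elim simp
      then show ?thesis
        unfolding U_inner[OF x(2) y(1)] U_inner[OF x(1) y(2)] l2_inner_def
        by (intro integral_cong_AE) measurable
    qed
    then show ?thesis using y by (auto simp: adjoint_op_def)
  qed
  show "(y, z) \<in> ?A" if "(y, z) \<in> adjoint_op H ?A"
  proof -
    have y: "y \<in> carrier H" "z \<in> carrier H"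
      and adj: "\<And>x w. (x, w) \<in> ?A \<Longrightarrow> hinner H w y = hinner H x z"
      using that by (auto simp: adjoint_op_def)
    note [measurable] = U_measurable[OF y(1)] U_measurable[OF y(2)]
    have "AE t in M. of_real (g t) * U y t - U z t = 0"
    proof (rule AE_zero_by_truncation[where g = "\<lambda>t. complex_of_real (g t)"])
      fix u C assume u [measurable]: "u \<in> borel_measurable M"
        and bd: "\<And>t. cmod (u t) \<le> C" "\<And>t. cmod (complex_of_real (g t) * u t) \<le> C"
      have sq: "square_integrable M u" "square_integrable M (\<lambda>t. complex_of_real (g t) * u t)"
        by (rule bounded_square_integrable[OF _ bd(1)], measurable)
          (rule bounded_square_integrable[OF _ bd(2)], measurable)
      have "l2_inner M (\<lambda>t. complex_of_real (g t) * u t) (U y) = l2_inner M u (U z)"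
        using adj[OF mult_op_vec_of[OF sq]] y sq by (simp add: hinner_vec_of_left)
      moreover note l2_inner_integrable[OF sq(2) U_sq[OF y(1)]] l2_inner_integrable[OF sq(1) U_sq[OF y(2)]]
      moreover have "(\<lambda>t. cnj (u t) * (of_real (g t) * U y t - U z t)) =
          (\<lambda>t. cnj (complex_of_real (g t) * u t) * U y t - cnj (u t) * U z t)"
        by (simp add: algebra_simps)
      ultimately show "integrable M (\<lambda>t. cnj (u t) * (of_real (g t) * U y t - U z t)) \<and>
          (\<integral>t. cnj (u t) * (of_real (g t) * U y t - U z t) \<partial>M) = 0"
        unfolding l2_inner_def by simp
    qed measurable
    then have "AE t in M. U z t = of_real (g t) * U y t" by eventually_elim simp
    then show ?thesis using y by (simp add: mult_op_def)
  qed
qed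

lemma positive_self_adjoint_mult_op:
  fixes g :: "'a \<Rightarrow> real"
  assumes g [measurable]: "g \<in> borel_measurable M" and pos: "\<And>t. g t > 0"
  shows "positive_self_adjoint H (mult_op (\<lambda>t. of_real (g t)))"
  unfolding positive_self_adjoint_def
proof (intro conjI self_adjoint_mult_op[OF g] ballI)
  fix p assume p: "p \<in> mult_op (\<lambda>t. complex_of_real (g t))"
  obtain x y where xy: "p = (x, y)" by fastforce
  have x: "x \<in> carrier H" "y \<in> carrier H" and eq: "AE t in M. U y t = of_real (g t) * U x t"
    using p unfolding xy by (auto simp: mult_op_def)
  note [measurable] = U_measurable[OF x(1)] U_measurable[OF x(2)]
  have eq': "AE t in M. cnj (U x t) * U y t = complex_of_real (g t * (cmod (U x t))\<^sup>2)"
    using eq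
  proof eventually_elim
    case (elim t)
    have "cnj (U x t) * U x t = complex_of_real ((cmod (U x t))\<^sup>2)"
      by (metis complex_norm_square mult.commute)
    then show ?case
      unfolding elim by (metis mult.left_commute of_real_mult)
  qed
  have "integrable M (\<lambda>t. complex_of_real (g t * (cmod (U x t))\<^sup>2))"
    by (rule integrable_cong_AE_imp[OF l2_inner_integrable[OF U_sq[OF x(1)] U_sq[OF x(2)]] _ eq'])
      measurable
  then have int: "integrable M (\<lambda>t. g t * (cmod (U x t))\<^sup>2)"
    by (simp only: complex_of_real_integrable_eq)
  have inner: "hinner H x y = of_real (\<integral>t. g t * (cmod (U x t))\<^sup>2 \<partial>M)"
    unfolding U_inner[OF x] l2_inner_def integral_complex_of_real[symmetric]
    using eq' by (intro integral_cong_AE) measurable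
  have "(\<integral>t. g t * (cmod (U x t))\<^sup>2 \<partial>M) > 0" if "x \<noteq> \<zero>\<^bsub>H\<^esub>"
  proof (rule ccontr)
    assume "\<not> ?thesis"
    moreover have nonneg: "AE t in M. 0 \<le> g t * (cmod (U x t))\<^sup>2"
      using pos by (intro AE_I2 mult_nonneg_nonneg) (simp_all add: less_imp_le)
    then have "(\<integral>t. g t * (cmod (U x t))\<^sup>2 \<partial>M) \<ge> 0"
      by (rule integral_nonneg_AE)
    ultimately have "(\<integral>t. g t * (cmod (U x t))\<^sup>2 \<partial>M) = 0" by linarith
    then have "AE t in M. g t * (cmod (U x t))\<^sup>2 = 0"
      using integral_nonneg_eq_0_iff_AE[OF int nonneg] by blast
    then have "AE t in M. (cmod (U x t))\<^sup>2 = 0"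
    proof eventually_elim
      case (elim t)
      then show ?case using pos[of t] by simp
    qed
    then have "l2_sqnorm M (U x) = (\<integral>t. 0 \<partial>M)"
      unfolding l2_sqnorm_def by (intro integral_cong_AE) measurable
    then show False using hinner_pos[OF x(1) that] by (simp add: hinner_self[OF x(1)])
  qed
  then show "case p of (x, y) \<Rightarrow> x \<noteq> \<zero>\<^bsub>H\<^esub> \<longrightarrow> hinner H x y \<in> \<real> \<and> 0 < Re (hinner H x y)"
    unfolding xy by (simp add: inner)
qed

end

text \<open>
  With \<open>a, b, c, d\<close> the values of a sesquilinear form on \<open>(x, x)\<close>, \<open>(x, z)\<close>, \<open>(z, x)\<close> and \<open>(z, z)\<close> this is
  polarization, in the form in which it occurs in the spectral form.
\<close>

lemma sum_polarization:
  fixes a b c d :: complex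
  shows "(\<Sum>k<4. \<i> ^ k * (a + \<i> ^ k * b + cnj (\<i> ^ k) * (c + \<i> ^ k * d))) = 4 * c"
  by (simp add: eval_nat_numeral algebra_simps)

context L2_model
begin

definition spec_proj :: "('a \<Rightarrow> real) \<Rightarrow> real set \<Rightarrow> 'h \<Rightarrow> 'h" where
  "spec_proj \<phi> B x = vec_of (\<lambda>t. if \<phi> t \<in> B then U x t else 0)"

definition spec_measure :: "('a \<Rightarrow> real) \<Rightarrow> 'h \<Rightarrow> real measure" where
  "spec_measure \<phi> x = distr (density M (\<lambda>t. ennreal ((cmod (U x t))\<^sup>2))) borel \<phi>"

context
  fixes \<phi> :: "'a \<Rightarrow> real"
  assumes \<phi> [measurable]: "\<phi> \<in> borel_measurable M"
begin

lemma cut_sq: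
  assumes [measurable]: "B \<in> sets borel" and x: "x \<in> carrier H"
  shows "square_integrable M (\<lambda>t. if \<phi> t \<in> B then U x t else 0)"
proof (rule square_integrable_dominated[OF U_sq[OF x], of _ 1])
  note [measurable] = U_measurable[OF x]
  show "(\<lambda>t. if \<phi> t \<in> B then U x t else 0) \<in> borel_measurable M" by measurable
qed auto

lemma spec_proj_carrier: "\<lbrakk>B \<in> sets borel; x \<in> carrier H\<rbrakk> \<Longrightarrow> spec_proj \<phi> B x \<in> carrier H"
  unfolding spec_proj_def by (rule vec_of_carrier[OF cut_sq])

lemma U_spec_proj:
  "\<lbrakk>B \<in> sets borel; x \<in> carrier H\<rbrakk> \<Longrightarrow> AE t in M. U (spec_proj \<phi> B x) t = (if \<phi> t \<in> B then U x t else 0)"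
  unfolding spec_proj_def by (rule U_vec_of[OF cut_sq])

lemma emeasure_spec_measure:
  assumes [measurable]: "B \<in> sets borel" and x: "x \<in> carrier H"
  shows "emeasure (spec_measure \<phi> x) B = ennreal (l2_sqnorm M (\<lambda>t. if \<phi> t \<in> B then U x t else 0))"
proof -
  note [measurable] = U_measurable[OF x]
  have "emeasure (spec_measure \<phi> x) B = emeasure (density M (\<lambda>t. ennreal ((cmod (U x t))\<^sup>2))) (\<phi> -` B \<inter> space M)"
    unfolding spec_measure_def by (subst emeasure_distr) auto
  also have "\<dots> = (\<integral>\<^sup>+t. ennreal ((cmod (U x t))\<^sup>2) * indicator (\<phi> -` B \<inter> space M) t \<partial>M)"
    by (rule emeasure_density) measurable
  also have "\<dots> = (\<integral>\<^sup>+t. ennreal ((cmod (if \<phi> t \<in> B then U x t else 0))\<^sup>2) \<partial>M)"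
    by (intro nn_integral_cong) (auto simp: indicator_def)
  also have "\<dots> = ennreal (l2_sqnorm M (\<lambda>t. if \<phi> t \<in> B then U x t else 0))"
    unfolding l2_sqnorm_def
    by (intro nn_integral_eq_integral square_integrable_integrable cut_sq x) auto
  finally show ?thesis .
qed

lemma sets_spec_measure [simp]: "sets (spec_measure \<phi> x) = sets borel"
  and space_spec_measure [simp]: "space (spec_measure \<phi> x) = UNIV"
  by (simp_all add: spec_measure_def)

lemma finite_spec_measure: "x \<in> carrier H \<Longrightarrow> finite_measure (spec_measure \<phi> x)"
  by (rule finite_measureI) (simp add: emeasure_spec_measure)

lemma hinner_spec_proj:
  assumes B: "B \<in> sets borel" and x: "x \<in> carrier H"
  shows "hinner H x (spec_proj \<phi> B x) = of_real (measure (spec_measure \<phi> x) B)"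
proof -
  have "hinner H x (spec_proj \<phi> B x) = l2_inner M (U x) (\<lambda>t. if \<phi> t \<in> B then U x t else 0)"
    unfolding spec_proj_def by (rule hinner_vec_of_right[OF cut_sq[OF B x] x])
  also have "\<dots> = l2_inner M (\<lambda>t. if \<phi> t \<in> B then U x t else 0) (\<lambda>t. if \<phi> t \<in> B then U x t else 0)"
    unfolding l2_inner_def by (intro Bochner_Integration.integral_cong) auto
  also have "\<dots> = of_real (measure (spec_measure \<phi> x) B)"
    unfolding l2_inner_self by (simp add: measure_def emeasure_spec_measure[OF B x])
  finally show ?thesis .
qed

lemma spectral_distr_eq:
  assumes x: "x \<in> carrier H"
  shows "spectral_distr H (spec_proj \<phi>) x = spec_measure \<phi> x"
proof -
  interpret finite_measure "spec_measure \<phi> x" by (rule finite_spec_measure[OF x])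
  have "spectral_distr H (spec_proj \<phi>) x = measure_of UNIV (sets borel) (emeasure (spec_measure \<phi> x))"
    unfolding spectral_distr_def
  proof (rule measure_of_eq)
    fix B :: "real set" assume "B \<in> sigma_sets UNIV (sets borel)"
    then have "B \<in> sets borel" using sets.sigma_sets_eq[of "borel :: real measure"] by simp
    then show "ennreal (Re (hinner H x (spec_proj \<phi> B x))) = emeasure (spec_measure \<phi> x) B"
      by (simp add: hinner_spec_proj[OF _ x] emeasure_eq_measure)
  qed simp
  also have "\<dots> = spec_measure \<phi> x"
    using measure_of_of_measure[of "spec_measure \<phi> x"] by simp
  finally show ?thesis .
qed

lemma projection_valued_measure_spec_proj: "projection_valued_measure H (spec_proj \<phi>)"
  unfolding projection_valued_measure_def
proof (intro conjI ballI allI impI)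
  fix B :: "real set" and x assume B: "B \<in> sets borel" and x: "x \<in> carrier H"
  show Bx: "spec_proj \<phi> B x \<in> carrier H" by (rule spec_proj_carrier[OF B x])
  show "spec_proj \<phi> B (spec_proj \<phi> B x) = spec_proj \<phi> B x"
  proof (rule U_eqI[OF spec_proj_carrier[OF B Bx] Bx])
    show "AE t in M. U (spec_proj \<phi> B (spec_proj \<phi> B x)) t = U (spec_proj \<phi> B x) t"
      using U_spec_proj[OF B Bx] U_spec_proj[OF B x] by eventually_elim simp
  qed
  fix y assume y: "y \<in> carrier H"
  show "hinner H (spec_proj \<phi> B x) y = hinner H x (spec_proj \<phi> B y)"
    unfolding spec_proj_def hinner_vec_of_left[OF cut_sq[OF B x] y] hinner_vec_of_right[OF cut_sq[OF B y] x]
    unfolding l2_inner_def by (intro Bochner_Integration.integral_cong) auto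
next
  fix x assume x: "x \<in> carrier H"
  have U': "(UNIV :: real set) \<in> sets borel" by simp
  show "spec_proj \<phi> UNIV x = x"
    by (rule U_eqI[OF spec_proj_carrier[OF U' x] x]) (use U_spec_proj[OF U' x] in simp)
next
  fix B C :: "real set" and x assume B: "B \<in> sets borel" and C: "C \<in> sets borel" and x: "x \<in> carrier H"
  have BC: "B \<inter> C \<in> sets borel" using B C by simp
  have Cx: "spec_proj \<phi> C x \<in> carrier H" by (rule spec_proj_carrier[OF C x])
  show "spec_proj \<phi> (B \<inter> C) x = spec_proj \<phi> B (spec_proj \<phi> C x)"
  proof (rule U_eqI[OF spec_proj_carrier[OF BC x] spec_proj_carrier[OF B Cx]])
    show "AE t in M. U (spec_proj \<phi> (B \<inter> C) x) t = U (spec_proj \<phi> B (spec_proj \<phi> C x)) t"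
      using U_spec_proj[OF BC x] U_spec_proj[OF C x] U_spec_proj[OF B Cx] by eventually_elim simp
  qed
next
  fix F :: "nat \<Rightarrow> real set" and x
  assume F: "range F \<subseteq> sets borel" "disjoint_family F" and x: "x \<in> carrier H"
  interpret finite_measure "spec_measure \<phi> x" by (rule finite_spec_measure[OF x])
  have "(\<lambda>n. measure (spec_measure \<phi> x) (F n)) sums measure (spec_measure \<phi> x) (\<Union>n. F n)"
    using F by (intro finite_measure_UNION) simp_all
  then have "(\<lambda>n. complex_of_real (measure (spec_measure \<phi> x) (F n))) sums
      of_real (measure (spec_measure \<phi> x) (\<Union>n. F n))"
    by (rule sums_of_real)
  moreover have "F n \<in> sets borel" for n using F(1) by blast
  moreover have "(\<Union>n. F n) \<in> sets borel" using F(1) by (intro sets.countable_UN) auto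
  ultimately show "(\<lambda>n. hinner H x (spec_proj \<phi> (F n) x)) sums hinner H x (spec_proj \<phi> (\<Union>n. F n) x)"
    by (simp add: hinner_spec_proj[OF _ x])
qed

context
  fixes f :: "real \<Rightarrow> complex"
  assumes f [measurable]: "f \<in> borel_measurable borel"
begin

lemma spectral_dom_eq:
  "spectral_dom H (spec_proj \<phi>) f = {x \<in> carrier H. square_integrable M (\<lambda>t. f (\<phi> t) * U x t)}"
proof -
  have "integrable (spectral_distr H (spec_proj \<phi>) x) (\<lambda>l. (cmod (f l))\<^sup>2) \<longleftrightarrow>
      square_integrable M (\<lambda>t. f (\<phi> t) * U x t)" if x: "x \<in> carrier H" for x
  proof -
    note [measurable] = U_measurable[OF x]
    have "integrable (spectral_distr H (spec_proj \<phi>) x) (\<lambda>l. (cmod (f l))\<^sup>2) \<longleftrightarrow>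
        integrable (density M (\<lambda>t. ennreal ((cmod (U x t))\<^sup>2))) (\<lambda>t. (cmod (f (\<phi> t)))\<^sup>2)"
      unfolding spectral_distr_eq[OF x] spec_measure_def by (rule integrable_distr_eq) measurable
    also have "\<dots> \<longleftrightarrow> integrable M (\<lambda>t. (cmod (U x t))\<^sup>2 *\<^sub>R (cmod (f (\<phi> t)))\<^sup>2)"
      by (rule integrable_density[OF _ _ AE_I2[OF zero_le_power2]]) measurable
    also have "\<dots> \<longleftrightarrow> square_integrable M (\<lambda>t. f (\<phi> t) * U x t)"
      unfolding square_integrable_def by (simp add: norm_mult power_mult_distrib mult.commute)
    finally show ?thesis .
  qed
  then show ?thesis unfolding spectral_dom_def by blast
qed

lemma integral_spectral_distr:
  assumes x: "x \<in> carrier H"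
  shows "(\<integral>l. f l \<partial>spectral_distr H (spec_proj \<phi>) x) = l2_inner M (U x) (\<lambda>t. f (\<phi> t) * U x t)"
proof -
  note [measurable] = U_measurable[OF x]
  have "(\<integral>l. f l \<partial>spectral_distr H (spec_proj \<phi>) x) =
      (\<integral>t. f (\<phi> t) \<partial>density M (\<lambda>t. ennreal ((cmod (U x t))\<^sup>2)))"
    unfolding spectral_distr_eq[OF x] spec_measure_def by (rule integral_distr) measurable
  also have "\<dots> = (\<integral>t. (cmod (U x t))\<^sup>2 *\<^sub>R f (\<phi> t) \<partial>M)"
    by (rule integral_density[OF _ _ AE_I2[OF zero_le_power2]]) measurable
  also have "\<dots> = l2_inner M (U x) (\<lambda>t. f (\<phi> t) * U x t)"
    unfolding l2_inner_def
    by (intro Bochner_Integration.integral_cong)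
      (simp_all add: scaleR_conv_of_real complex_norm_square mult_ac del: of_real_power)
  finally show ?thesis .
qed

lemma spectral_form_eq:
  assumes x: "x \<in> carrier H" "square_integrable M (\<lambda>t. f (\<phi> t) * U x t)"
    and z: "z \<in> carrier H" "square_integrable M (\<lambda>t. f (\<phi> t) * U z t)"
  shows "spectral_form H (spec_proj \<phi>) f z x = l2_inner M (U z) (\<lambda>t. f (\<phi> t) * U x t)"
proof -
  let ?F = "\<lambda>x t. f (\<phi> t) * U x t"
  have *: "(\<integral>l. f l \<partial>spectral_distr H (spec_proj \<phi>) (x \<oplus>\<^bsub>H\<^esub> c \<odot>\<^bsub>H\<^esub> z)) =
      l2_inner M (U x) (?F x) + c * l2_inner M (U x) (?F z) +
      cnj c * (l2_inner M (U z) (?F x) + c * l2_inner M (U z) (?F z))" for c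
  proof -
    have y: "x \<oplus>\<^bsub>H\<^esub> c \<odot>\<^bsub>H\<^esub> z \<in> carrier H" using x z by (simp add: smult_in_carrier)
    note [measurable] = U_measurable[OF y] U_measurable[OF x(1)] U_measurable[OF z(1)]
    have U_y: "AE t in M. U (x \<oplus>\<^bsub>H\<^esub> c \<odot>\<^bsub>H\<^esub> z) t = U x t + c * U z t"
      using U_add[OF x(1) smult_in_carrier[OF z(1)], of c] U_smult[OF z(1), of c] by eventually_elim simp
    have F_y: "AE t in M. ?F (x \<oplus>\<^bsub>H\<^esub> c \<odot>\<^bsub>H\<^esub> z) t = ?F x t + c * ?F z t"
      using U_y by eventually_elim (simp add: algebra_simps)
    note sq = U_sq[OF x(1)] U_sq[OF z(1)] x(2) z(2)
    have F_sq: "square_integrable M (?F (x \<oplus>\<^bsub>H\<^esub> c \<odot>\<^bsub>H\<^esub> z))"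
      by (rule square_integrable_cong_AE[OF square_integrable_add[OF sq(3) square_integrable_cmult[OF sq(4)]] _ F_y])
        measurable
    have "l2_inner M (U (x \<oplus>\<^bsub>H\<^esub> c \<odot>\<^bsub>H\<^esub> z)) (?F (x \<oplus>\<^bsub>H\<^esub> c \<odot>\<^bsub>H\<^esub> z)) =
        l2_inner M (\<lambda>t. U x t + c * U z t) (\<lambda>t. ?F x t + c * ?F z t)"
      by (intro l2_inner_cong_AE U_y F_y F_sq U_sq y square_integrable_add square_integrable_cmult sq)
    also have "\<dots> = l2_inner M (U x) (?F x) + c * l2_inner M (U x) (?F z) +
      cnj c * (l2_inner M (U z) (?F x) + c * l2_inner M (U z) (?F z))"
      by (simp only: l2_inner_add_left l2_inner_add_right l2_inner_cmult_left l2_inner_cmult_right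
          square_integrable_add square_integrable_cmult sq)
    finally show ?thesis by (simp only: integral_spectral_distr[OF y])
  qed
  show ?thesis
    unfolding spectral_form_def * sum_polarization by simp
qed

text \<open>
  Polarization turns the weak definition of the operator \<open>\<integral> f dE\<close> into the condition that \<open>U y\<close> and
  \<open>f(\<phi>) \<cdot> U x\<close> have the same inner products with a dense set of functions.
\<close>

lemma spectral_integral_eq: "spectral_integral H (spec_proj \<phi>) f = mult_op (\<lambda>t. f (\<phi> t))"
proof (intro equalityI subrelI)
  fix x y assume "(x, y) \<in> spectral_integral H (spec_proj \<phi>) f"
  then have x: "x \<in> carrier H" "square_integrable M (\<lambda>t. f (\<phi> t) * U x t)" and y: "y \<in> carrier H"
    and form: "\<And>z. z \<in> carrier H \<Longrightarrow> square_integrable M (\<lambda>t. f (\<phi> t) * U z t) \<Longrightarrow>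
      hinner H z y = l2_inner M (U z) (\<lambda>t. f (\<phi> t) * U x t)"
    unfolding spectral_integral_def spectral_dom_eq by (auto simp: spectral_form_eq)
  note [measurable] = U_measurable[OF x(1)] U_measurable[OF y]
  have "AE t in M. U y t - f (\<phi> t) * U x t = 0"
  proof (rule AE_zero_by_truncation[where g = "\<lambda>t. f (\<phi> t)"])
    fix u C assume u [measurable]: "u \<in> borel_measurable M"
      and bd: "\<And>t. cmod (u t) \<le> C" "\<And>t. cmod (f (\<phi> t) * u t) \<le> C"
    have sq: "square_integrable M u" "square_integrable M (\<lambda>t. f (\<phi> t) * u t)"
      by (rule bounded_square_integrable[OF _ bd(1)], measurable)
        (rule bounded_square_integrable[OF _ bd(2)], measurable)
    note vu = vec_of_carrier[OF sq(1)]
    note [measurable] = U_measurable[OF vu]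
    have "square_integrable M (\<lambda>t. f (\<phi> t) * U (vec_of u) t)"
    proof (rule square_integrable_cong_AE[OF sq(2)])
      show "AE t in M. f (\<phi> t) * U (vec_of u) t = f (\<phi> t) * u t"
        using U_vec_of[OF sq(1)] by eventually_elim simp
    qed measurable
    then have "l2_inner M u (U y) = l2_inner M (U (vec_of u)) (\<lambda>t. f (\<phi> t) * U x t)"
      using form[OF vu] hinner_vec_of_left[OF sq(1) y] by simp
    also have "\<dots> = l2_inner M u (\<lambda>t. f (\<phi> t) * U x t)"
      by (rule l2_inner_cong_AE[OF U_vec_of[OF sq(1)] _ U_sq[OF vu] x(2) sq(1) x(2)]) simp
    finally have "l2_inner M u (\<lambda>t. U y t - f (\<phi> t) * U x t) = 0"
      by (simp add: l2_inner_diff_right sq U_sq[OF y] x)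
    then show "integrable M (\<lambda>t. cnj (u t) * (U y t - f (\<phi> t) * U x t)) \<and>
        (\<integral>t. cnj (u t) * (U y t - f (\<phi> t) * U x t) \<partial>M) = 0"
      using l2_inner_integrable[OF sq(1) square_integrable_diff[OF U_sq[OF y] x(2)]]
      unfolding l2_inner_def by simp
  qed measurable
  then have "AE t in M. U y t = f (\<phi> t) * U x t" by eventually_elim simp
  then show "(x, y) \<in> mult_op (\<lambda>t. f (\<phi> t))" using x y by (simp add: mult_op_def)
next
  fix x y assume "(x, y) \<in> mult_op (\<lambda>t. f (\<phi> t))"
  then have x: "x \<in> carrier H" and y: "y \<in> carrier H" and eq: "AE t in M. U y t = f (\<phi> t) * U x t"
    by (auto simp: mult_op_def)
  note [measurable] = U_measurable[OF x] U_measurable[OF y]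
  have eq': "AE t in M. f (\<phi> t) * U x t = U y t"
    using eq by eventually_elim simp
  have sq: "square_integrable M (\<lambda>t. f (\<phi> t) * U x t)"
    by (rule square_integrable_cong_AE[OF U_sq[OF y] _ eq']) measurable
  have "hinner H z y = l2_inner M (U z) (\<lambda>t. f (\<phi> t) * U x t)" if z: "z \<in> carrier H" for z
    unfolding U_inner[OF z y] by (rule l2_inner_cong_AE[OF _ eq U_sq[OF z] U_sq[OF y] U_sq[OF z] sq]) simp
  then show "(x, y) \<in> spectral_integral H (spec_proj \<phi>) f"
    unfolding spectral_integral_def spectral_dom_eq using x y sq by (auto simp: spectral_form_eq)
qed

end

lemma has_spectral_measure_mult_op:
  "has_spectral_measure H (mult_op (\<lambda>t. of_real (\<phi> t))) (spec_proj \<phi>)"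
  unfolding has_spectral_measure_def
  by (intro conjI projection_valued_measure_spec_proj) (subst spectral_integral_eq, simp_all)

end

text \<open>
  The imaginary powers in the Weyl relations and the real power \<open>1/b\<^sup>2\<close> are both instances of this rule.
\<close>

lemma has_power_mult_op_exp:
  fixes \<psi> :: "'a \<Rightarrow> real"
  assumes [measurable]: "\<psi> \<in> borel_measurable M"
  shows "has_power H (mult_op (\<lambda>t. of_real (exp (\<psi> t)))) z (mult_op (\<lambda>t. exp (z * of_real (\<psi> t))))"
proof -
  have powr: "(\<lambda>l. if 0 < l then complex_of_real l powr z else 0) =
      (\<lambda>l. if 0 < l then exp (z * complex_of_real (ln l)) else 0)"
    by (auto simp: powr_def Ln_of_real)
  have "(\<lambda>l. if 0 < l then exp (z * complex_of_real (ln l)) else 0) \<in> borel_measurable borel"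
    by measurable
  moreover have exp: "(\<lambda>t. exp (\<psi> t)) \<in> borel_measurable M"
    by measurable
  ultimately have "spectral_integral H (spec_proj (\<lambda>t. exp (\<psi> t)))
        (\<lambda>l. if 0 < l then exp (z * complex_of_real (ln l)) else 0) =
      mult_op (\<lambda>t. if 0 < exp (\<psi> t) then exp (z * of_real (ln (exp (\<psi> t)))) else 0)"
    by (intro spectral_integral_eq)
  then have "spectral_integral H (spec_proj (\<lambda>t. exp (\<psi> t)))
        (\<lambda>l. if 0 < l then exp (z * complex_of_real (ln l)) else 0) = mult_op (\<lambda>t. exp (z * of_real (\<psi> t)))"
    by simp
  then show ?thesis
    unfolding has_power_def powr using has_spectral_measure_mult_op[OF exp] by metis
qed

end

section \<open>Exponential vectors over Gaussian space\<close>

lemma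
  fixes z :: complex
  shows integrable_exp_std_normal: "integrable std_normal_distribution (\<lambda>x. exp (z * of_real x))"
    and integral_exp_std_normal: "(\<integral>x. exp (z * of_real x) \<partial>std_normal_distribution) = exp (z\<^sup>2 / 2)"
proof -
  define a where "a = Re z"
  define b where "b = Im z"
  have z: "z = of_real a + \<i> * of_real b"
    unfolding a_def b_def by (simp add: complex_eq)
  \<comment> \<open>the real part of \<open>z\<close> shifts the Gaussian, the imaginary part is a Fourier variable\<close>
  have shift: "std_normal_density x *\<^sub>R exp (z * of_real x) =
      of_real (exp (a\<^sup>2 / 2)) * (normal_density a 1 x *\<^sub>R iexp (b * x))" for x
  proof -
    have "std_normal_density x * exp (a * x) = exp (a\<^sup>2 / 2) * normal_density a 1 x"
      unfolding normal_density_def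
      by (simp add: exp_add[symmetric] power2_eq_square field_simps)
    moreover have "exp (z * of_real x) = of_real (exp (a * x)) * iexp (b * x)"
      unfolding z by (simp add: exp_of_real[symmetric] exp_add[symmetric] algebra_simps)
    ultimately show ?thesis
      unfolding scaleR_conv_of_real by (metis mult.assoc of_real_mult)
  qed
  have int: "integrable lborel (\<lambda>x. normal_density a 1 x *\<^sub>R iexp (b * x))"
    by (rule Bochner_Integration.integrable_bound[OF integrable_normal_density[of 1 a]]) simp_all
  show "integrable std_normal_distribution (\<lambda>x. exp (z * of_real x))"
  proof (subst integrable_density)
    show "integrable lborel (\<lambda>x. std_normal_density x *\<^sub>R exp (z * of_real x))"
      unfolding shift by (intro integrable_mult_right int)
  qed (simp_all add: normal_density_nonneg)
  have "(\<integral>x. exp (z * of_real x) \<partial>std_normal_distribution) =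
      (\<integral>x. std_normal_density x *\<^sub>R exp (z * of_real x) \<partial>lborel)"
    by (subst integral_density) (simp_all add: normal_density_nonneg)
  also have "\<dots> = of_real (exp (a\<^sup>2 / 2)) * (\<integral>x. normal_density a 1 x *\<^sub>R iexp (b * x) \<partial>lborel)"
    unfolding shift by (rule Bochner_Integration.integral_mult_right_zero)
  also have "(\<integral>x. normal_density a 1 x *\<^sub>R iexp (b * x) \<partial>lborel) =
      (\<integral>x. normal_density a 1 (a + 1 * x) *\<^sub>R iexp (b * (a + 1 * x)) \<partial>lborel)"
    using lborel_integral_real_affine[of 1 "\<lambda>x. normal_density a 1 x *\<^sub>R iexp (b * x)" a] by simp
  also have "\<dots> = (\<integral>x. iexp (b * a) * (std_normal_density x *\<^sub>R iexp (b * x)) \<partial>lborel)"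
    by (intro Bochner_Integration.integral_cong)
      (simp_all add: normal_density_def exp_add algebra_simps)
  also have "\<dots> = iexp (b * a) * (\<integral>x. std_normal_density x *\<^sub>R iexp (b * x) \<partial>lborel)"
    by (rule Bochner_Integration.integral_mult_right_zero)
  also have "(\<integral>x. std_normal_density x *\<^sub>R iexp (b * x) \<partial>lborel) = (\<integral>x. iexp (b * x) \<partial>std_normal_distribution)"
    by (subst integral_density) (simp_all add: normal_density_nonneg)
  also have "(\<integral>x. iexp (b * x) \<partial>std_normal_distribution) = of_real (exp (- b\<^sup>2 / 2))"
    using fun_cong[OF char_std_normal_distribution, of b] by (simp add: char_def)
  also have "of_real (exp (a\<^sup>2 / 2)) * (iexp (b * a) * of_real (exp (- b\<^sup>2 / 2))) = exp (z\<^sup>2 / 2)"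
    unfolding z exp_of_real[symmetric] exp_add[symmetric]
    by (simp add: power2_eq_square field_simps)
  finally show "(\<integral>x. exp (z * of_real x) \<partial>std_normal_distribution) = exp (z\<^sup>2 / 2)" .
qed

definition gaussian :: "nat set \<Rightarrow> (nat \<Rightarrow> real) measure" where
  "gaussian I = (\<Pi>\<^sub>M j\<in>I. std_normal_distribution)"

text \<open>
  The summands \<open>- z\<^sub>j\<^sup>2 / 2\<close> normalise the exponentials in such a way that their inner products become
  \<open>exp \<langle>z, w\<rangle>\<close>, which depends on \<open>z\<close> and \<open>w\<close> only through the hermitian product of \<open>\<complex>\<^sup>n\<close>.
\<close>

definition exp_vec :: "nat set \<Rightarrow> (nat \<Rightarrow> complex) \<Rightarrow> (nat \<Rightarrow> real) \<Rightarrow> complex" where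
  "exp_vec I z x = exp (\<Sum>j\<in>I. z j * of_real (x j) - (z j)\<^sup>2 / 2)"

lemma prob_space_gaussian: "prob_space (gaussian I)"
  unfolding gaussian_def
  by (rule prob_space_PiM) (rule real_distribution.axioms(1)[OF real_dist_normal_dist])

lemma product_sigma_finite_std_normal: "product_sigma_finite (\<lambda>j::nat. std_normal_distribution)"
  unfolding product_sigma_finite_def
  using prob_space_imp_sigma_finite[OF real_distribution.axioms(1)[OF real_dist_normal_dist]] by blast

lemma gaussian_component_measurable [measurable]:
  assumes "j \<in> I" shows "(\<lambda>x. x j) \<in> borel_measurable (gaussian I)"
proof -
  have "(\<lambda>x. x j) \<in> measurable (gaussian I) std_normal_distribution"
    unfolding gaussian_def by (rule measurable_component_singleton[OF assms])
  then show ?thesis by (simp cong: measurable_cong_sets)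
qed

lemma exp_vec_measurable [measurable]: "exp_vec I z \<in> borel_measurable (gaussian I)"
  unfolding exp_vec_def[abs_def] by measurable

lemma exp_vec_inner_integrand:
  assumes "finite I"
  shows "cnj (exp_vec I z x) * exp_vec I w x =
    (\<Prod>j\<in>I. exp (- ((cnj (z j))\<^sup>2 + (w j)\<^sup>2) / 2) * exp ((cnj (z j) + w j) * of_real (x j)))"
proof -
  have "cnj (exp_vec I z x) * exp_vec I w x =
      exp ((\<Sum>j\<in>I. cnj (z j) * of_real (x j) - (cnj (z j))\<^sup>2 / 2) + (\<Sum>j\<in>I. w j * of_real (x j) - (w j)\<^sup>2 / 2))"
    unfolding exp_vec_def exp_cnj exp_add[symmetric] by (simp add: cnj_sum)
  also have "\<dots> = exp (\<Sum>j\<in>I. - ((cnj (z j))\<^sup>2 + (w j)\<^sup>2) / 2 + (cnj (z j) + w j) * of_real (x j))"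
    unfolding sum.distrib[symmetric] by (intro arg_cong[of _ _ exp] sum.cong) (simp_all add: field_simps)
  also have "\<dots> = (\<Prod>j\<in>I. exp (- ((cnj (z j))\<^sup>2 + (w j)\<^sup>2) / 2) * exp ((cnj (z j) + w j) * of_real (x j)))"
    using assms by (simp only: exp_sum exp_add)
  finally show ?thesis .
qed

lemma exp_vec_inner_integrable:
  assumes "finite I"
  shows "integrable (gaussian I) (\<lambda>x. cnj (exp_vec I z x) * exp_vec I w x)"
proof -
  interpret product_sigma_finite "\<lambda>j::nat. std_normal_distribution"
    by (rule product_sigma_finite_std_normal)
  show ?thesis
    unfolding exp_vec_inner_integrand[OF assms] gaussian_def
    by (rule product_integrable_prod[OF assms])
      (intro integrable_mult_right integrable_exp_std_normal)
qed

lemma exp_vec_sq: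
  assumes "finite I" shows "square_integrable (gaussian I) (exp_vec I z)"
proof -
  have "cnj (exp_vec I z x) * exp_vec I z x = complex_of_real ((cmod (exp_vec I z x))\<^sup>2)" for x
    by (metis complex_norm_square mult.commute)
  then have "integrable (gaussian I) (\<lambda>x. complex_of_real ((cmod (exp_vec I z x))\<^sup>2))"
    using exp_vec_inner_integrable[OF assms, of z z] by simp
  then show ?thesis
    unfolding square_integrable_def by (simp only: complex_of_real_integrable_eq exp_vec_measurable)
qed

lemma exp_vec_inner:
  assumes "finite I"
  shows "l2_inner (gaussian I) (exp_vec I z) (exp_vec I w) = exp (\<Sum>j\<in>I. cnj (z j) * w j)"
proof -
  interpret product_sigma_finite "\<lambda>j::nat. std_normal_distribution"
    by (rule product_sigma_finite_std_normal)
  have "l2_inner (gaussian I) (exp_vec I z) (exp_vec I w) =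
      (\<Prod>j\<in>I. \<integral>x. exp (- ((cnj (z j))\<^sup>2 + (w j)\<^sup>2) / 2) * exp ((cnj (z j) + w j) * of_real x) \<partial>std_normal_distribution)"
    unfolding l2_inner_def exp_vec_inner_integrand[OF assms] gaussian_def
    by (rule product_integral_prod[OF assms]) (intro integrable_mult_right integrable_exp_std_normal)
  also have "\<dots> = (\<Prod>j\<in>I. exp (- ((cnj (z j))\<^sup>2 + (w j)\<^sup>2) / 2) * exp ((cnj (z j) + w j)\<^sup>2 / 2))"
    by (simp only: Bochner_Integration.integral_mult_right_zero integral_exp_std_normal)
  also have "\<dots> = (\<Prod>j\<in>I. exp (cnj (z j) * w j))"
    unfolding exp_add[symmetric]
    by (intro prod.cong refl arg_cong[of _ _ exp]) (simp add: power2_eq_square field_simps)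
  finally show ?thesis using assms by (simp add: exp_sum)
qed

text \<open>
  The positive and the negative part of \<open>h\<close> push forward under \<open>\<phi>\<close> to measures with the same Fourier
  transform, so these coincide by the uniqueness theorem of Levy.
\<close>

lemma fourier_zero_real:
  fixes h \<phi> :: "'a \<Rightarrow> real"
  assumes h: "integrable M h" and \<phi> [measurable]: "\<phi> \<in> borel_measurable M"
    and zero: "\<And>t. (\<integral>x. iexp (t * \<phi> x) * of_real (h x) \<partial>M) = 0"
    and B [measurable]: "B \<in> sets borel"
  shows "(\<integral>x. indicator B (\<phi> x) * h x \<partial>M) = 0"
proof -
  have [measurable]: "h \<in> borel_measurable M" using h by simp
  define p where "p x = max 0 (h x)" for x
  define n where "n x = max 0 (- h x)" for x
  have p: "integrable M p" and n: "integrable M n"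
    unfolding p_def n_def using h by auto
  have nonneg: "p x \<ge> 0" "n x \<ge> 0" for x by (simp_all add: p_def n_def)
  have h_eq: "h x = p x - n x" for x by (simp add: p_def n_def)
  have [measurable]: "p \<in> borel_measurable M" "n \<in> borel_measurable M" using p n by simp_all
  have int_p: "integrable M (\<lambda>x. iexp (t * \<phi> x) * of_real (p x))"
    and int_n: "integrable M (\<lambda>x. iexp (t * \<phi> x) * of_real (n x))" for t
    by (rule Bochner_Integration.integrable_bound[OF p], measurable, simp add: norm_mult)
      (rule Bochner_Integration.integrable_bound[OF n], measurable, simp add: norm_mult)
  have pn: "(\<integral>x. iexp (t * \<phi> x) * of_real (p x) \<partial>M) = (\<integral>x. iexp (t * \<phi> x) * of_real (n x) \<partial>M)" for t
    using zero[of t] int_p[of t] int_n[of t] by (simp add: h_eq algebra_simps)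
  define c where "c = (\<integral>x. p x \<partial>M)"
  have c_p: "(\<integral>x. p x \<partial>M) = c" and c_n: "(\<integral>x. n x \<partial>M) = c"
    using pn[of 0] by (simp_all add: c_def)
  have "c \<ge> 0" unfolding c_def using nonneg by simp
  have indB: "integrable M (\<lambda>x. indicator B (\<phi> x) * k x)" if k: "integrable M k" for k :: "'a \<Rightarrow> real"
  proof (rule Bochner_Integration.integrable_bound[OF k])
    have [measurable]: "k \<in> borel_measurable M" using k by simp
    show "(\<lambda>x. indicator B (\<phi> x) * k x) \<in> borel_measurable M" by measurable
  qed (simp add: indicator_def)
  have "(\<integral>x. indicator B (\<phi> x) * p x \<partial>M) = (\<integral>x. indicator B (\<phi> x) * n x \<partial>M)"
  proof (cases "c = 0")
    case True
    have "AE x in M. p x = 0" "AE x in M. n x = 0"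
      using integral_nonneg_eq_0_iff_AE[OF p] integral_nonneg_eq_0_iff_AE[OF n] c_p c_n nonneg True
      by simp_all
    then have "AE x in M. indicator B (\<phi> x) * p x = indicator B (\<phi> x) * n x"
      by eventually_elim simp
    then show ?thesis by (intro integral_cong_AE) measurable
  next
    case False
    with \<open>c \<ge> 0\<close> have c: "c > 0" by simp
    define D where "D k = distr (density M (\<lambda>x. ennreal (k x / c))) borel \<phi>" for k :: "'a \<Rightarrow> real"
    have D_emeasure: "emeasure (D k) A = ennreal ((\<integral>x. indicator A (\<phi> x) * k x \<partial>M) / c)"
      if [measurable]: "A \<in> sets borel" and k: "integrable M k" "\<And>x. k x \<ge> 0" for k A
    proof -
      have [measurable]: "k \<in> borel_measurable M" using k by simp
      have i: "integrable M (\<lambda>x. indicator A (\<phi> x) * k x / c)"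
      proof (rule Bochner_Integration.integrable_bound)
        show "integrable M (\<lambda>x. k x / c)" using k by simp
      qed (use c in \<open>auto simp: indicator_def\<close>)
      have "emeasure (D k) A = emeasure (density M (\<lambda>x. ennreal (k x / c))) (\<phi> -` A \<inter> space M)"
        unfolding D_def by (subst emeasure_distr) auto
      also have "\<dots> = (\<integral>\<^sup>+x. ennreal (k x / c) * indicator (\<phi> -` A \<inter> space M) x \<partial>M)"
        by (rule emeasure_density) measurable
      also have "\<dots> = (\<integral>\<^sup>+x. ennreal (indicator A (\<phi> x) * k x / c) \<partial>M)"
        by (intro nn_integral_cong) (auto simp: indicator_def)
      also have "\<dots> = ennreal (\<integral>x. indicator A (\<phi> x) * k x / c \<partial>M)"
        using c k(2) by (intro nn_integral_eq_integral i) (simp add: indicator_def)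
      finally show ?thesis by simp
    qed
    have dist: "real_distribution (D k)" if k: "integrable M k" "\<And>x. k x \<ge> 0" "(\<integral>x. k x \<partial>M) = c" for k
      unfolding real_distribution_def real_distribution_axioms_def
    proof
      show "prob_space (D k)"
        by (rule prob_spaceI) (use D_emeasure[of UNIV k] k c in \<open>simp add: D_def\<close>)
      show "sets (D k) = sets borel" by (simp add: D_def)
    qed
    have char_D: "char (D k) t = (\<integral>x. iexp (t * \<phi> x) * of_real (k x) \<partial>M) / of_real c"
      if k: "integrable M k" "\<And>x. k x \<ge> 0" for k t
    proof -
      have [measurable]: "k \<in> borel_measurable M" using k by simp
      have "char (D k) t = (\<integral>x. (k x / c) *\<^sub>R iexp (t * \<phi> x) \<partial>M)"
        unfolding char_def D_def using c k(2)
        by (simp add: integral_distr integral_density)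
      also have "\<dots> = (\<integral>x. iexp (t * \<phi> x) * of_real (k x) / of_real c \<partial>M)"
        by (intro Bochner_Integration.integral_cong) (simp_all add: scaleR_conv_of_real)
      finally show ?thesis by simp
    qed
    have "D p = D n"
    proof (rule Levy_uniqueness)
      show "real_distribution (D p)" "real_distribution (D n)"
        by (intro dist p n nonneg c_p c_n)+
      show "char (D p) = char (D n)"
        using pn by (simp add: fun_eq_iff char_D[OF p nonneg(1)] char_D[OF n nonneg(2)])
    qed
    then have "ennreal ((\<integral>x. indicator B (\<phi> x) * p x \<partial>M) / c) = ennreal ((\<integral>x. indicator B (\<phi> x) * n x \<partial>M) / c)"
      using D_emeasure[OF B p nonneg(1)] D_emeasure[OF B n nonneg(2)] by simp
    moreover have "(\<integral>x. indicator B (\<phi> x) * p x \<partial>M) / c \<ge> 0" "(\<integral>x. indicator B (\<phi> x) * n x \<partial>M) / c \<ge> 0"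
      using nonneg c by (auto intro!: divide_nonneg_nonneg integral_nonneg_AE AE_I2 mult_nonneg_nonneg)
    ultimately show ?thesis using c by (simp add: ennreal_inj)
  qed
  then show ?thesis
    using indB[OF p] indB[OF n] by (simp add: h_eq algebra_simps)
qed

lemma fourier_zero:
  fixes h :: "'a \<Rightarrow> complex" and \<phi> :: "'a \<Rightarrow> real"
  assumes h: "integrable M h" and \<phi> [measurable]: "\<phi> \<in> borel_measurable M"
    and zero: "\<And>t. (\<integral>x. iexp (t * \<phi> x) * h x \<partial>M) = 0"
    and B [measurable]: "B \<in> sets borel"
  shows "(\<integral>x. indicator B (\<phi> x) * h x \<partial>M) = 0"
proof -
  have [measurable]: "h \<in> borel_measurable M" using h by simp
  have int: "integrable M (\<lambda>x. iexp (t * \<phi> x) * h x)" for t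
    by (rule Bochner_Integration.integrable_bound[OF h]) (simp_all add: norm_mult)
  have cint: "integrable M (\<lambda>x. iexp (t * \<phi> x) * cnj (h x))" for t
    by (rule Bochner_Integration.integrable_bound[OF h]) (simp_all add: norm_mult)
  have zero': "(\<integral>x. iexp (t * \<phi> x) * cnj (h x) \<partial>M) = 0" for t
  proof -
    have "(\<integral>x. iexp (t * \<phi> x) * cnj (h x) \<partial>M) = (\<integral>x. cnj (iexp (- t * \<phi> x) * h x) \<partial>M)"
      by (intro Bochner_Integration.integral_cong) (simp_all add: exp_cnj)
    also have "\<dots> = 0" by (subst Bochner_Integration.integral_cnj) (simp only: zero[of "- t"] complex_cnj_zero)
    finally show ?thesis .
  qed
  have re: "(\<integral>x. indicator B (\<phi> x) * Re (h x) \<partial>M) = 0"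
  proof (rule fourier_zero_real[OF _ \<phi> _ B])
    fix t
    have "h x + cnj (h x) = of_real (Re (h x)) * 2" for x
      by (simp add: complex_add_cnj)
    then have eq: "iexp (t * \<phi> x) * of_real (Re (h x)) = (iexp (t * \<phi> x) * h x + iexp (t * \<phi> x) * cnj (h x)) / 2" for x
      by (simp add: distrib_left[symmetric])
    then show "(\<integral>x. iexp (t * \<phi> x) * of_real (Re (h x)) \<partial>M) = 0"
      unfolding eq using int[of t] cint[of t] zero[of t] zero'[of t] by simp
  qed (use h in simp)
  have im: "(\<integral>x. indicator B (\<phi> x) * Im (h x) \<partial>M) = 0"
  proof (rule fourier_zero_real[OF _ \<phi> _ B])
    fix t
    have im: "h x - cnj (h x) = of_real (Im (h x)) * (2 * \<i>)" for x
      by (simp add: complex_diff_cnj)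
    have eq: "iexp (t * \<phi> x) * of_real (Im (h x)) = (iexp (t * \<phi> x) * h x - iexp (t * \<phi> x) * cnj (h x)) / (2 * \<i>)" for x
      by (subst nonzero_eq_divide_eq) (simp, simp only: right_diff_distrib[symmetric] mult.assoc im)
    show "(\<integral>x. iexp (t * \<phi> x) * of_real (Im (h x)) \<partial>M) = 0"
      unfolding eq using int[of t] cint[of t] zero[of t] zero'[of t] by simp
  qed (use h in simp)
  have "integrable M (\<lambda>x. indicator B (\<phi> x) * h x)"
    by (rule Bochner_Integration.integrable_bound[OF h]) (auto simp: indicator_def)
  then have "Re (\<integral>x. indicator B (\<phi> x) * h x \<partial>M) = (\<integral>x. Re (indicator B (\<phi> x) * h x) \<partial>M)"
    "Im (\<integral>x. indicator B (\<phi> x) * h x \<partial>M) = (\<integral>x. Im (indicator B (\<phi> x) * h x) \<partial>M)"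
    by (simp_all only: integral_Re integral_Im)
  moreover have "Re (indicator B (\<phi> x) * h x) = indicator B (\<phi> x) * Re (h x)"
    "Im (indicator B (\<phi> x) * h x) = indicator B (\<phi> x) * Im (h x)" for x
    by (simp_all add: indicator_def)
  ultimately show ?thesis using re im by (simp add: complex_eq_iff)
qed

text \<open>
  Going from \<open>J\<close> to \<open>insert k J\<close> inverts the Fourier transform in the variable \<open>x\<^sub>k\<close> alone, all other
  factors being absorbed into the function.
\<close>

lemma gaussian_box_zero:
  fixes h :: "(nat \<Rightarrow> real) \<Rightarrow> complex"
  assumes I: "finite I" and h: "integrable (gaussian I) h"
    and zero: "\<And>t. (\<integral>x. (\<Prod>j\<in>I. iexp (t j * x j)) * h x \<partial>gaussian I) = 0"
    and J: "J \<subseteq> I" and B: "\<And>j. B j \<in> sets borel"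
  shows "(\<integral>x. (\<Prod>j\<in>J. indicator (B j) (x j)) * ((\<Prod>j\<in>I - J. iexp (t j * x j)) * h x) \<partial>gaussian I) = 0"
  using finite_subset[OF J I] J
proof (induction J arbitrary: t rule: finite_induct)
  case empty
  then show ?case using zero by simp
next
  case (insert k J)
  have k: "k \<in> I" "k \<notin> J" and JI: "J \<subseteq> I" using insert by auto
  note [measurable] = B
  have [measurable]: "h \<in> borel_measurable (gaussian I)" using h by simp
  define g where "g x = (\<Prod>j\<in>J. indicator (B j) (x j)) * ((\<Prod>j\<in>I - insert k J. iexp (t j * x j)) * h x)" for x
  have [measurable]: "g \<in> borel_measurable (gaussian I)"
    unfolding g_def by (measurable, use JI in auto)
  have g: "integrable (gaussian I) g"
  proof (rule Bochner_Integration.integrable_bound[OF h])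
    have "cmod (\<Prod>j\<in>J. indicator (B j) (x j)) \<le> 1" for x
      unfolding prod_norm[symmetric] by (intro prod_le_1) (simp add: indicator_def)
    moreover have "cmod (\<Prod>j\<in>I - insert k J. iexp (t j * x j)) = 1" for x
      unfolding prod_norm[symmetric] by simp
    ultimately show "AE x in gaussian I. cmod (g x) \<le> cmod (h x)"
      unfolding g_def norm_mult by (simp add: mult_left_le_one_le)
  qed measurable
  have split: "(\<Prod>j\<in>I - J. iexp ((t(k := s)) j * x j)) = iexp (s * x k) * (\<Prod>j\<in>I - insert k J. iexp (t j * x j))" for s x
  proof -
    have "I - J - {k} = I - insert k J" by auto
    moreover have "(\<Prod>j\<in>I - insert k J. iexp ((t(k := s)) j * x j)) = (\<Prod>j\<in>I - insert k J. iexp (t j * x j))"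
      by (intro prod.cong) auto
    ultimately show ?thesis
      using prod.remove[of "I - J" k "\<lambda>j. iexp ((t(k := s)) j * x j)"] I k by simp
  qed
  have "(\<integral>x. indicator (B k) (x k) * g x \<partial>gaussian I) = 0"
  proof (rule fourier_zero[OF g gaussian_component_measurable[OF k(1)] _ B])
    fix s
    have "iexp (s * x k) * g x = (\<Prod>j\<in>J. indicator (B j) (x j)) * ((\<Prod>j\<in>I - J. iexp ((t(k := s)) j * x j)) * h x)" for x
      unfolding g_def split by (simp add: mult_ac)
    then show "(\<integral>x. iexp (s * x k) * g x \<partial>gaussian I) = 0"
      using insert.IH[OF JI, of "t(k := s)"] by simp
  qed
  then show ?case
    unfolding g_def using insert.hyps by (simp add: mult_ac)
qed

text \<open>
  Once the integrals over all boxes vanish, the positive and the negative part of \<open>Re h\<close> (and of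
  \<open>Im h\<close>) are densities of the same measure, because boxes generate the product \<open>\<sigma>\<close>-algebra.
\<close>

lemma gaussian_fourier_injective:
  fixes h :: "(nat \<Rightarrow> real) \<Rightarrow> complex"
  assumes I: "finite I" and h: "integrable (gaussian I) h"
    and zero: "\<And>t. (\<integral>x. (\<Prod>j\<in>I. iexp (t j * x j)) * h x \<partial>gaussian I) = 0"
  shows "AE x in gaussian I. h x = 0"
proof -
  interpret prob_space "gaussian I" by (rule prob_space_gaussian)
  have sets_g: "sets (gaussian I) = sets (\<Pi>\<^sub>M j\<in>I. std_normal_distribution)"
    by (simp add: gaussian_def)
  have box: "(\<integral>x. indicator (Pi\<^sub>E I B) x * h x \<partial>gaussian I) = 0" if "\<And>j. B j \<in> sets borel" for B
  proof -
    have "(\<Prod>j\<in>I. indicator (B j) (x j)) = (indicator (Pi\<^sub>E I B) x :: complex)" if "x \<in> space (gaussian I)" for x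
      using that I
      by (cases "x \<in> Pi\<^sub>E I B") (auto simp: gaussian_def space_PiM indicator_def PiE_iff intro!: prod.neutral)
    then have "(\<integral>x. indicator (Pi\<^sub>E I B) x * h x \<partial>gaussian I) = (\<integral>x. (\<Prod>j\<in>I. indicator (B j) (x j)) * h x \<partial>gaussian I)"
      by (intro Bochner_Integration.integral_cong) simp_all
    then show ?thesis
      using gaussian_box_zero[OF I h zero order_refl that] by simp
  qed
  have real: "AE x in gaussian I. r x = 0"
    if r: "integrable (gaussian I) r" and rbox: "\<And>B. (\<And>j. B j \<in> sets borel) \<Longrightarrow> (\<integral>x. indicator (Pi\<^sub>E I B) x * r x \<partial>gaussian I) = 0"
    for r :: "(nat \<Rightarrow> real) \<Rightarrow> real"
  proof -
    have [measurable]: "r \<in> borel_measurable (gaussian I)" using r by simp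
    define p where "p x = max 0 (r x)" for x
    define n where "n x = max 0 (- r x)" for x
    have p: "integrable (gaussian I) p" and n: "integrable (gaussian I) n"
      unfolding p_def n_def using r by auto
    have [measurable]: "p \<in> borel_measurable (gaussian I)" "n \<in> borel_measurable (gaussian I)" using p n by simp_all
    have em: "emeasure (density (gaussian I) (\<lambda>x. ennreal (k x))) (Pi\<^sub>E I B) = ennreal (\<integral>x. indicator (Pi\<^sub>E I B) x * k x \<partial>gaussian I)"
      and im: "integrable (gaussian I) (\<lambda>x. indicator (Pi\<^sub>E I B) x * k x)"
      if k: "integrable (gaussian I) k" "\<And>x. k x \<ge> 0" and B: "\<And>j. B j \<in> sets borel" for k :: "(nat \<Rightarrow> real) \<Rightarrow> real" and B
    proof -
      have [measurable]: "k \<in> borel_measurable (gaussian I)" using k by simp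
      have [measurable]: "Pi\<^sub>E I B \<in> sets (gaussian I)"
        unfolding gaussian_def using I B by (intro sets_PiM_I_finite) simp_all
      show i: "integrable (gaussian I) (\<lambda>x. indicator (Pi\<^sub>E I B) x * k x)"
        by (rule Bochner_Integration.integrable_bound[OF k(1)]) (auto simp: indicator_def)
      have "emeasure (density (gaussian I) (\<lambda>x. ennreal (k x))) (Pi\<^sub>E I B) = (\<integral>\<^sup>+x. ennreal (indicator (Pi\<^sub>E I B) x * k x) \<partial>gaussian I)"
        by (subst emeasure_density) (auto intro!: nn_integral_cong simp: indicator_def)
      also have "\<dots> = ennreal (\<integral>x. indicator (Pi\<^sub>E I B) x * k x \<partial>gaussian I)"
        using k(2) by (intro nn_integral_eq_integral i) (simp add: indicator_def)
      finally show "emeasure (density (gaussian I) (\<lambda>x. ennreal (k x))) (Pi\<^sub>E I B) = ennreal (\<integral>x. indicator (Pi\<^sub>E I B) x * k x \<partial>gaussian I)" .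
    qed
    have nonneg: "p x \<ge> 0" "n x \<ge> 0" and r_eq: "r x = p x - n x" for x by (simp_all add: p_def n_def)
    have "density (gaussian I) (\<lambda>x. ennreal (p x)) = density (gaussian I) (\<lambda>x. ennreal (n x))"
    proof (rule measure_eqI_PiM_finite[OF I])
      show "sets (density (gaussian I) (\<lambda>x. ennreal (p x))) = sets (\<Pi>\<^sub>M j\<in>I. std_normal_distribution)"
        "sets (density (gaussian I) (\<lambda>x. ennreal (n x))) = sets (\<Pi>\<^sub>M j\<in>I. std_normal_distribution)"
        by (simp_all add: sets_g)
      show "range (\<lambda>i::nat. Pi\<^sub>E I (\<lambda>j. UNIV :: real set)) \<subseteq> prod_algebra I (\<lambda>j. std_normal_distribution)"
        using I by (auto intro!: prod_algebraI_finite)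
      show "(\<Union>i::nat. Pi\<^sub>E I (\<lambda>j. UNIV :: real set)) = space (\<Pi>\<^sub>M j\<in>I. std_normal_distribution)"
        by (simp add: space_PiM)
      show "emeasure (density (gaussian I) (\<lambda>x. ennreal (p x))) (Pi\<^sub>E I (\<lambda>j. UNIV :: real set)) \<noteq> \<infinity>" for i :: nat
        using em[OF p nonneg(1), of "\<lambda>j. UNIV"] by simp
      fix A :: "nat \<Rightarrow> real set" assume A: "\<And>i. i \<in> I \<Longrightarrow> A i \<in> sets std_normal_distribution"
      define B where "B i = (if i \<in> I then A i else {})" for i
      have B: "B i \<in> sets borel" for i using A[of i] by (simp add: B_def)
      have AB: "Pi\<^sub>E I A = Pi\<^sub>E I B" by (intro PiE_cong) (simp add: B_def)
      have "(\<integral>x. indicator (Pi\<^sub>E I B) x * p x \<partial>gaussian I) = (\<integral>x. indicator (Pi\<^sub>E I B) x * n x \<partial>gaussian I)"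
        using rbox[OF B] im[OF p nonneg(1) B] im[OF n nonneg(2) B] by (simp add: r_eq right_diff_distrib)
      then show "emeasure (density (gaussian I) (\<lambda>x. ennreal (p x))) (Pi\<^sub>E I A) = emeasure (density (gaussian I) (\<lambda>x. ennreal (n x))) (Pi\<^sub>E I A)"
        unfolding AB using em[OF p nonneg(1) B] em[OF n nonneg(2) B] by simp
    qed
    then have "AE x in gaussian I. ennreal (p x) = ennreal (n x)"
      by (intro density_unique) measurable
    then show ?thesis
      by eventually_elim (use nonneg r_eq in \<open>simp add: ennreal_inj\<close>)
  qed
  have part: "(\<integral>x. indicator (Pi\<^sub>E I B) x * Re (h x) \<partial>gaussian I) = 0 \<and> (\<integral>x. indicator (Pi\<^sub>E I B) x * Im (h x) \<partial>gaussian I) = 0"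
    if B: "\<And>j. B j \<in> sets borel" for B
  proof -
    have [measurable]: "Pi\<^sub>E I B \<in> sets (gaussian I)"
      unfolding gaussian_def using I B by (intro sets_PiM_I_finite) simp_all
    have [measurable]: "h \<in> borel_measurable (gaussian I)" using h by simp
    have "integrable (gaussian I) (\<lambda>x. indicator (Pi\<^sub>E I B) x * h x)"
      by (rule Bochner_Integration.integrable_bound[OF h]) (auto simp: indicator_def)
    then have "Re (\<integral>x. indicator (Pi\<^sub>E I B) x * h x \<partial>gaussian I) = (\<integral>x. Re (indicator (Pi\<^sub>E I B) x * h x) \<partial>gaussian I)"
      "Im (\<integral>x. indicator (Pi\<^sub>E I B) x * h x \<partial>gaussian I) = (\<integral>x. Im (indicator (Pi\<^sub>E I B) x * h x) \<partial>gaussian I)"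
      by (simp_all only: integral_Re integral_Im)
    moreover have "Re (indicator (Pi\<^sub>E I B) x * h x) = indicator (Pi\<^sub>E I B) x * Re (h x)"
      "Im (indicator (Pi\<^sub>E I B) x * h x) = indicator (Pi\<^sub>E I B) x * Im (h x)" for x
      by (simp_all add: indicator_def)
    ultimately show ?thesis by (simp add: box[OF B])
  qed
  have "AE x in gaussian I. Re (h x) = 0" "AE x in gaussian I. Im (h x) = 0"
    by (rule real; use h part in simp)+
  then show ?thesis by eventually_elim (simp add: complex_eq_iff)
qed

text \<open>
  The exponential vectors with imaginary parameters are, up to constants, the characters, so that
  orthogonality to them means that the Fourier transform vanishes.
\<close>

theorem exp_vec_total:
  assumes I: "finite I" and f: "square_integrable (gaussian I) f"
    and orth: "\<And>z. l2_inner (gaussian I) (exp_vec I z) f = 0"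
  shows "AE x in gaussian I. f x = 0"
proof (rule gaussian_fourier_injective[OF I])
  interpret prob_space "gaussian I" by (rule prob_space_gaussian)
  show "integrable (gaussian I) f"
    using l2_inner_integrable[OF _ f, of "\<lambda>x. 1"] by (simp add: square_integrable_def)
  fix t :: "nat \<Rightarrow> real"
  define c where "c = exp (- (\<Sum>j\<in>I. (\<i> * of_real (t j))\<^sup>2 / 2))"
  have "cnj (exp_vec I (\<lambda>j. - \<i> * of_real (t j)) x) = c * (\<Prod>j\<in>I. iexp (t j * x j))" for x
    unfolding exp_vec_def exp_cnj c_def exp_sum[OF I, symmetric] exp_add[symmetric]
    by (simp add: cnj_sum sum_subtractf mult.assoc)
  then have "l2_inner (gaussian I) (exp_vec I (\<lambda>j. - \<i> * of_real (t j))) f =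
      c * (\<integral>x. (\<Prod>j\<in>I. iexp (t j * x j)) * f x \<partial>gaussian I)"
    unfolding l2_inner_def by (simp add: mult.assoc)
  then show "(\<integral>x. (\<Prod>j\<in>I. iexp (t j * x j)) * f x \<partial>gaussian I) = 0"
    using orth by (simp add: c_def)
qed

section \<open>Weyl operators\<close>

context complex_hilbert_space
begin

lemma smult_smult: "x \<in> carrier H \<Longrightarrow> c \<odot>\<^bsub>H\<^esub> (d \<odot>\<^bsub>H\<^esub> x) = (c * d) \<odot>\<^bsub>H\<^esub> x"
  using smult_assoc1[of c d x] by simp

lemma hinner_minus_right:
  assumes "x \<in> carrier H" "y \<in> carrier H" "z \<in> carrier H"
  shows "hinner H x (y \<ominus>\<^bsub>H\<^esub> z) = hinner H x y - hinner H x z"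
  using hinner_add_right[of x "y \<ominus>\<^bsub>H\<^esub> z" z] assms by (simp add: minus_add_cancel)

lemma hinner_zero_right: "x \<in> carrier H \<Longrightarrow> hinner H x \<zero>\<^bsub>H\<^esub> = 0"
  using hinner_minus_right[of x x x] by (simp add: r_neg a_minus_def)

lemma hinner_smult_left:
  "\<lbrakk>x \<in> carrier H; y \<in> carrier H\<rbrakk> \<Longrightarrow> hinner H (c \<odot>\<^bsub>H\<^esub> x) y = cnj c * hinner H x y"
  by (subst (1 2) hinner_cnj) (simp_all add: smult_in_carrier hinner_smult_right)

lemma eq_zero_if_self_inner_zero: "\<lbrakk>x \<in> carrier H; hinner H x x = 0\<rbrakk> \<Longrightarrow> x = \<zero>\<^bsub>H\<^esub>"
  using hinner_pos[of x] by force

definition unitary_on :: "('h \<Rightarrow> 'h) \<Rightarrow> bool" where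
  "unitary_on p \<longleftrightarrow> (\<forall>x\<in>carrier H. p x \<in> carrier H) \<and>
     (\<forall>x\<in>carrier H. \<forall>y\<in>carrier H. hinner H (p x) (p y) = hinner H x y) \<and>
     (\<forall>y\<in>carrier H. \<exists>x\<in>carrier H. p x = y)"

lemma unitary_on_comp: "unitary_on p \<Longrightarrow> unitary_on q \<Longrightarrow> unitary_on (\<lambda>x. p (q x))"
  unfolding unitary_on_def
proof (intro conjI ballI)
  fix y assume p: "(\<forall>x\<in>carrier H. p x \<in> carrier H) \<and>
      (\<forall>x\<in>carrier H. \<forall>y\<in>carrier H. hinner H (p x) (p y) = hinner H x y) \<and> (\<forall>y\<in>carrier H. \<exists>x\<in>carrier H. p x = y)"
    and q: "(\<forall>x\<in>carrier H. q x \<in> carrier H) \<and>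
      (\<forall>x\<in>carrier H. \<forall>y\<in>carrier H. hinner H (q x) (q y) = hinner H x y) \<and> (\<forall>y\<in>carrier H. \<exists>x\<in>carrier H. q x = y)"
    and y: "y \<in> carrier H"
  obtain z where z: "z \<in> carrier H" "p z = y" using p y by blast
  then obtain x where "x \<in> carrier H" "q x = z" using q by blast
  then show "\<exists>x\<in>carrier H. p (q x) = y" using z by blast
qed simp_all

lemma unitary_on_smult:
  assumes p: "unitary_on p" and c: "cmod c = 1"
  shows "unitary_on (\<lambda>x. c \<odot>\<^bsub>H\<^esub> p x)"
  unfolding unitary_on_def
proof (intro conjI ballI)
  have cc: "cnj c * c = 1"
    using c by (metis complex_norm_square mult.commute of_real_1 one_power2)
  show "c \<odot>\<^bsub>H\<^esub> p x \<in> carrier H" if "x \<in> carrier H" for x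
    using p that unfolding unitary_on_def by (simp add: smult_in_carrier)
  show "hinner H (c \<odot>\<^bsub>H\<^esub> p x) (c \<odot>\<^bsub>H\<^esub> p y) = hinner H x y" if "x \<in> carrier H" "y \<in> carrier H" for x y
  proof -
    have "hinner H (c \<odot>\<^bsub>H\<^esub> p x) (c \<odot>\<^bsub>H\<^esub> p y) = (cnj c * c) * hinner H (p x) (p y)"
      using p that unfolding unitary_on_def by (simp add: hinner_smult_left hinner_smult_right smult_in_carrier)
    then show ?thesis using p that unfolding cc unitary_on_def by simp
  qed
  show "\<exists>x\<in>carrier H. c \<odot>\<^bsub>H\<^esub> p x = y" if y: "y \<in> carrier H" for y
  proof -
    obtain x where "x \<in> carrier H" "p x = cnj c \<odot>\<^bsub>H\<^esub> y"
      using p smult_in_carrier[OF y] unfolding unitary_on_def by metis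
    then show ?thesis
      using smult_smult[OF y, of c "cnj c"] cc smult_one[OF y] by (intro bexI[of _ x]) (simp_all add: mult.commute)
  qed
qed

text \<open>
  For unitary \<open>f\<close> and \<open>g\<close> that agree on a total family, \<open>f x - g x\<close> is orthogonal to the image of
  that family, which is again total.
\<close>

lemma unitaries_agree:
  assumes f: "unitary_on f" and g: "unitary_on g"
    and e: "\<And>i. e i \<in> carrier H"
    and total: "\<And>x. x \<in> carrier H \<Longrightarrow> (\<And>i. hinner H (e i) x = 0) \<Longrightarrow> x = \<zero>\<^bsub>H\<^esub>"
    and agree: "\<And>i. f (e i) = g (e i)" and x: "x \<in> carrier H"
  shows "f x = g x"
proof -
  have c: "f x \<in> carrier H" "g x \<in> carrier H" "f (e i) \<in> carrier H" for i
    using f g e x unfolding unitary_on_def by blast+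
  have d: "f x \<ominus>\<^bsub>H\<^esub> g x \<in> carrier H" using c by simp
  then obtain y where y: "y \<in> carrier H" "f y = f x \<ominus>\<^bsub>H\<^esub> g x"
    using f unfolding unitary_on_def by metis
  have "hinner H (e i) y = 0" for i
  proof -
    have "hinner H (e i) y = hinner H (f (e i)) (f x \<ominus>\<^bsub>H\<^esub> g x)"
      using f e y unfolding unitary_on_def by metis
    also have "\<dots> = hinner H (f (e i)) (f x) - hinner H (g (e i)) (g x)"
      using hinner_minus_right[OF c(3) c(1,2)] agree by simp
    also have "\<dots> = 0"
      using f g e x unfolding unitary_on_def by simp
    finally show ?thesis .
  qed
  then have "y = \<zero>\<^bsub>H\<^esub>" by (rule total[OF y(1)])
  then have "hinner H (f y) (f y) = 0"
    using f y(1) hinner_zero_right[OF y(1)] unfolding unitary_on_def by metis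
  then have "f x \<ominus>\<^bsub>H\<^esub> g x = \<zero>\<^bsub>H\<^esub>"
    using eq_zero_if_self_inner_zero[OF d] y(2) by simp
  then show ?thesis
    using minus_add_cancel[OF c(1,2)] c(2) by simp
qed

end

lemma (in L2_model) unimodular_mult_op:
  assumes [measurable]: "g \<in> borel_measurable M" and g: "\<And>t. cmod (g t) = 1"
  shows "\<exists>p. unitary_on p \<and> mult_op g = {(x, p x) | x. x \<in> carrier H} \<and>
    (\<forall>x\<in>carrier H. AE t in M. U (p x) t = g t * U x t)"
proof (intro exI conjI)
  define p where "p x = vec_of (\<lambda>t. g t * U x t)" for x
  have sq: "square_integrable M (\<lambda>t. k t * U x t)"
    if [measurable]: "k \<in> borel_measurable M" and "\<And>t. cmod (k t) = 1" "x \<in> carrier H" for x k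
    using that by (intro square_integrable_bounded_mult[where C = 1] U_sq) simp_all
  have sq_g: "square_integrable M (\<lambda>t. g t * U x t)" if "x \<in> carrier H" for x
    using that g by (intro sq) simp_all
  have p: "p x \<in> carrier H" and U_p: "AE t in M. U (p x) t = g t * U x t" if "x \<in> carrier H" for x
    unfolding p_def by (rule vec_of_carrier[OF sq_g[OF that]], rule U_vec_of[OF sq_g[OF that]])
  show "\<forall>x\<in>carrier H. AE t in M. U (p x) t = g t * U x t"
    using U_p by blast
  have gg: "cnj (g t) * g t = 1" for t
    using g[of t] by (metis complex_norm_square mult.commute of_real_1 one_power2)
  show "unitary_on p"
    unfolding unitary_on_def
  proof (intro conjI ballI)
    show "p x \<in> carrier H" if "x \<in> carrier H" for x by (rule p[OF that])
    show "hinner H (p x) (p y) = hinner H x y" if x: "x \<in> carrier H" and y: "y \<in> carrier H" for x y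
    proof -
      have "hinner H (p x) (p y) = l2_inner M (\<lambda>t. g t * U x t) (\<lambda>t. g t * U y t)"
        unfolding U_inner[OF p[OF x] p[OF y]]
        by (rule l2_inner_cong_AE[OF U_p[OF x] U_p[OF y] U_sq[OF p[OF x]] U_sq[OF p[OF y]] sq_g[OF x] sq_g[OF y]])
      also have "\<dots> = l2_inner M (U x) (U y)"
      proof -
        have "cnj (g t * U x t) * (g t * U y t) = (cnj (g t) * g t) * (cnj (U x t) * U y t)" for t
          by simp
        then show ?thesis by (simp only: l2_inner_def gg mult_1_left)
      qed
      finally show ?thesis unfolding U_inner[OF x y] .
    qed
    show "\<exists>x\<in>carrier H. p x = y" if y: "y \<in> carrier H" for y
    proof -
      have sq': "square_integrable M (\<lambda>t. cnj (g t) * U y t)"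
        using y g by (intro sq) simp_all
      let ?x = "vec_of (\<lambda>t. cnj (g t) * U y t)"
      have x: "?x \<in> carrier H" by (rule vec_of_carrier[OF sq'])
      have "AE t in M. U (p ?x) t = U y t"
        using U_p[OF x] U_vec_of[OF sq']
      proof eventually_elim
        case (elim t)
        then have "U (p ?x) t = (cnj (g t) * g t) * U y t" by simp
        then show ?case unfolding gg by simp
      qed
      then show ?thesis
        using U_eqI[OF p[OF x] y] x by blast
    qed
  qed
  show "mult_op g = {(x, p x) | x. x \<in> carrier H}"
  proof (intro equalityI subrelI)
    fix x y assume "(x, y) \<in> mult_op g"
    then have x: "x \<in> carrier H" "y \<in> carrier H" and eq: "AE t in M. U y t = g t * U x t"
      by (auto simp: mult_op_def)
    have "AE t in M. U y t = U (p x) t"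
      using eq U_p[OF x(1)] by eventually_elim simp
    then have "y = p x" by (rule U_eqI[OF x(2) p[OF x(1)]])
    then show "(x, y) \<in> {(x, p x) | x. x \<in> carrier H}" using x by blast
  next
    fix x y assume "(x, y) \<in> {(x, p x) | x. x \<in> carrier H}"
    then show "(x, y) \<in> mult_op g" using p U_p by (auto simp: mult_op_def)
  qed
qed

text \<open>
  The norm of \<open>\<Gamma> k - (a \<Gamma> f + c \<Gamma> p)\<close> is determined by inner products, and \<open>\<Gamma>\<close> preserves these.
\<close>

lemma isometry_linear_AE:
  assumes iso: "\<And>f p. square_integrable M f \<Longrightarrow> square_integrable M p \<Longrightarrow> l2_inner M (\<Gamma> f) (\<Gamma> p) = l2_inner M f p"
    and \<Gamma>: "\<And>f. square_integrable M f \<Longrightarrow> square_integrable M (\<Gamma> f)"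
    and k: "square_integrable M k" and f: "square_integrable M f" and p: "square_integrable M p"
    and eq: "AE x in M. k x = a * f x + c * p x"
  shows "AE x in M. \<Gamma> k x = a * \<Gamma> f x + c * \<Gamma> p x"
proof -
  note sq = k f p \<Gamma>[OF k] \<Gamma>[OF f] \<Gamma>[OF p]
  note sqi = square_integrable_add square_integrable_cmult square_integrable_diff
  have "complex_of_real (l2_sqnorm M (\<lambda>x. \<Gamma> k x - (a * \<Gamma> f x + c * \<Gamma> p x))) =
      complex_of_real (l2_sqnorm M (\<lambda>x. k x - (a * f x + c * p x)))"
    by (simp only: l2_sqnorm_diff_expand l2_inner_add_left l2_inner_add_right l2_inner_cmult_left
        l2_inner_cmult_right sqi sq iso)
  moreover have "l2_sqnorm M (\<lambda>x. k x - (a * f x + c * p x)) = l2_sqnorm M (\<lambda>x. 0)"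
    using eq by (intro l2_sqnorm_cong_AE sqi sq) (auto elim: eventually_mono)
  ultimately have "l2_sqnorm M (\<lambda>x. \<Gamma> k x - (a * \<Gamma> f x + c * \<Gamma> p x)) = 0"
    by (simp add: l2_sqnorm_def)
  then have "AE x in M. \<Gamma> k x - (a * \<Gamma> f x + c * \<Gamma> p x) = 0"
    by (intro l2_sqnorm_eq_0 sqi sq)
  then show ?thesis by eventually_elim simp
qed

text \<open>
  Multiplication by \<open>exp (i s \<Sum>\<^sub>j r\<^sub>j x\<^sub>j)\<close> moves \<open>exp_vec z\<close> to a multiple of \<open>exp_vec (z + i s r)\<close>.
  Rotating the coordinates by phases turns \<open>i r\<close> into an arbitrary complex vector \<open>w\<close>; the rotation
  preserves the Gram matrix of the exponential vectors.
\<close>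

definition polar_phase :: "complex \<Rightarrow> complex" where
  "polar_phase c = (if c = 0 then 1 else c / (\<i> * of_real (cmod c)))"

lemma cmod_polar_phase: "cmod (polar_phase c) = 1"
  by (simp add: polar_phase_def norm_divide norm_mult)

lemma cnj_polar_phase_mult: "cnj (polar_phase c) * polar_phase c = 1"
  using cmod_polar_phase[of c] by (metis complex_norm_square mult.commute of_real_1 one_power2)

lemma polar_phase_cmod: "\<i> * of_real (cmod c) * polar_phase c = c"
  by (simp add: polar_phase_def)

lemma cnj_polar_phase: "cnj (polar_phase c) * c = \<i> * of_real (cmod c)"
proof -
  have "cnj (polar_phase c) * c = cnj (polar_phase c) * polar_phase c * (\<i> * of_real (cmod c))"
    using polar_phase_cmod[of c] by (metis mult.assoc mult.commute)
  then show ?thesis by (simp add: cnj_polar_phase_mult)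
qed

lemma cnj_polar_phase': "\<i> * of_real (cmod c) * cnj (polar_phase c) = - cnj c"
proof -
  have "cnj (\<i> * of_real (cmod c) * polar_phase c) = cnj c"
    by (simp only: polar_phase_cmod)
  then have "- (\<i> * of_real (cmod c) * cnj (polar_phase c)) = cnj c"
    by (simp add: mult.assoc)
  then show ?thesis by (metis minus_minus)
qed

locale gaussian_space =
  fixes I :: "nat set"
  assumes finite_I: "finite I"
begin

abbreviation "G \<equiv> gaussian I"
abbreviation "L2 \<equiv> l2_space G"

sublocale prob_space G by (rule prob_space_gaussian)
sublocale L2: complex_hilbert_space L2 by (rule complex_hilbert_space_l2_space)

definition coherent :: "(nat \<Rightarrow> complex) \<Rightarrow> ((nat \<Rightarrow> real) \<Rightarrow> complex) set" where
  "coherent z = l2_class G (exp_vec I z)"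

lemma coherent_carrier: "coherent z \<in> carrier L2"
  unfolding coherent_def by (rule l2_class_in_carrier[OF exp_vec_sq[OF finite_I]])

lemma rep_coherent: "AE x in G. l2_rep (coherent z) x = exp_vec I z x"
  unfolding coherent_def by (rule l2_rep_class[OF exp_vec_sq[OF finite_I]])

lemma coherent_total:
  assumes X: "X \<in> carrier L2" and orth: "\<And>z. hinner L2 (coherent z) X = 0"
  shows "X = \<zero>\<^bsub>L2\<^esub>"
proof (rule l2_eqI[OF X l2_zero_closed])
  note sq = l2_rep_square_integrable
  have "l2_inner G (exp_vec I z) (l2_rep X) = 0" for z
  proof -
    have "hinner L2 (coherent z) X = l2_inner G (exp_vec I z) (l2_rep X)"
      unfolding hinner_l2_space
      by (rule l2_inner_cong_AE[OF rep_coherent _ sq[OF coherent_carrier] sq[OF X] exp_vec_sq[OF finite_I] sq[OF X]]) simp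
    then show ?thesis using orth by simp
  qed
  then have "AE x in G. l2_rep X x = 0"
    by (rule exp_vec_total[OF finite_I sq[OF X]])
  then show "AE x in G. l2_rep X x = l2_rep \<zero>\<^bsub>L2\<^esub> x"
    using l2_rep_zero[of G] by eventually_elim simp
qed

abbreviation rotate_back :: "(nat \<Rightarrow> complex) \<Rightarrow> (nat \<Rightarrow> complex) \<Rightarrow> nat \<Rightarrow> complex" where
  "rotate_back w z \<equiv> \<lambda>j. cnj (polar_phase (w j)) * z j"

lemma rotated_model_exists:
  "\<exists>U. L2_model L2 G U \<and> (\<forall>z. AE x in G. U (coherent z) x = exp_vec I (rotate_back w z) x)"
proof -
  have rot: "cnj (cnj (polar_phase c) * a) * (cnj (polar_phase c) * b) = cnj a * b" for a b c
    using cnj_polar_phase_mult[of c] by (simp add: mult_ac)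
  interpret gram_isometric_families G "exp_vec I" "\<lambda>z. exp_vec I (rotate_back w z)"
  proof
    show "square_integrable G (exp_vec I z)" "square_integrable G (exp_vec I (rotate_back w z))" for z
      by (rule exp_vec_sq[OF finite_I])+
    show "l2_inner G (exp_vec I z) (exp_vec I z') =
        l2_inner G (exp_vec I (rotate_back w z)) (exp_vec I (rotate_back w z'))" for z z'
      unfolding exp_vec_inner[OF finite_I] rot ..
    show "AE x in G. f x = 0" if "square_integrable G f" "\<And>z. l2_inner G (exp_vec I z) f = 0" for f
      by (rule exp_vec_total[OF finite_I that])
    show "AE x in G. f x = 0" if "square_integrable G f"
      "\<And>z. l2_inner G (exp_vec I (rotate_back w z)) f = 0" for f
    proof (rule exp_vec_total[OF finite_I that(1)])
      fix z
      have "rotate_back w (\<lambda>j. polar_phase (w j) * z j) = z"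
        by (simp add: fun_eq_iff mult.assoc[symmetric] cnj_polar_phase_mult)
      then show "l2_inner G (exp_vec I z) f = 0"
        using that(2)[of "\<lambda>j. polar_phase (w j) * z j"] by simp
    qed
  qed
  obtain \<Gamma> where \<Gamma>: "\<And>f. square_integrable G f \<Longrightarrow> square_integrable G (\<Gamma> f)"
    and iso: "\<And>f p. square_integrable G f \<Longrightarrow> square_integrable G p \<Longrightarrow> l2_inner G (\<Gamma> f) (\<Gamma> p) = l2_inner G f p"
    and surj: "\<And>f'. square_integrable G f' \<Longrightarrow> \<exists>f. square_integrable G f \<and> (AE x in G. \<Gamma> f x = f' x)"
    and rotates: "\<And>z. AE x in G. \<Gamma> (exp_vec I z) x = exp_vec I (rotate_back w z) x"
    using unitary_extension by blast
  have lin: "AE x in G. \<Gamma> k x = a * \<Gamma> f x + c * \<Gamma> p x"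
    if "square_integrable G k" "square_integrable G f" "square_integrable G p"
      "AE x in G. k x = a * f x + c * p x" for k f p a c
    by (rule isometry_linear_AE[of G \<Gamma>]) (use iso \<Gamma> that in auto)
  note sq = l2_rep_square_integrable
  have cong: "AE x in G. \<Gamma> k x = \<Gamma> f x" if "square_integrable G k" "square_integrable G f" "AE x in G. k x = f x" for k f
    using lin[OF that(1,2,2), of 1 0] that(3) by simp
  have "L2_model L2 G (\<lambda>X. \<Gamma> (l2_rep X))"
  proof
    fix X Y c assume X: "X \<in> carrier L2"
    show "square_integrable G (\<Gamma> (l2_rep X))" by (rule \<Gamma>[OF sq[OF X]])
    show "AE x in G. \<Gamma> (l2_rep (c \<odot>\<^bsub>L2\<^esub> X)) x = c * \<Gamma> (l2_rep X) x"
      using lin[OF sq[OF L2.smult_in_carrier[OF X]] sq[OF X] sq[OF X], of c c 0] l2_rep_smult[OF X, of c] by simp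
    assume Y: "Y \<in> carrier L2"
    show "AE x in G. \<Gamma> (l2_rep (X \<oplus>\<^bsub>L2\<^esub> Y)) x = \<Gamma> (l2_rep X) x + \<Gamma> (l2_rep Y) x"
      using lin[OF sq[OF l2_add_closed[OF X Y]] sq[OF X] sq[OF Y], of 1 1] l2_rep_add[OF X Y] by simp
    show "hinner L2 X Y = l2_inner G (\<Gamma> (l2_rep X)) (\<Gamma> (l2_rep Y))"
      unfolding iso[OF sq[OF X] sq[OF Y]] by (rule hinner_l2_space)
  next
    fix f' assume "square_integrable G f'"
    then obtain f where f: "square_integrable G f" "AE x in G. \<Gamma> f x = f' x"
      using surj by blast
    have "AE x in G. \<Gamma> (l2_rep (l2_class G f)) x = \<Gamma> f x"
      by (rule cong[OF sq[OF l2_class_in_carrier[OF f(1)]] f(1) l2_rep_class[OF f(1)]])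
    then have "AE x in G. \<Gamma> (l2_rep (l2_class G f)) x = f' x"
      using f(2) by eventually_elim simp
    then show "\<exists>X\<in>carrier L2. AE x in G. \<Gamma> (l2_rep X) x = f' x"
      using l2_class_in_carrier[OF f(1)] by blast
  qed
  moreover have "AE x in G. \<Gamma> (l2_rep (coherent z)) x = exp_vec I (rotate_back w z) x" for z
    using cong[OF sq[OF coherent_carrier] exp_vec_sq[OF finite_I] rep_coherent, of z] rotates[of z]
    by eventually_elim simp
  ultimately show ?thesis by blast
qed

definition rotated_rep :: "(nat \<Rightarrow> complex) \<Rightarrow> ((nat \<Rightarrow> real) \<Rightarrow> complex) set \<Rightarrow> (nat \<Rightarrow> real) \<Rightarrow> complex" where
  "rotated_rep w = (SOME U. L2_model L2 G U \<and> (\<forall>z. AE x in G. U (coherent z) x = exp_vec I (rotate_back w z) x))"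

lemma L2_model_rotated_rep: "L2_model L2 G (rotated_rep w)"
  and rotated_rep_coherent: "AE x in G. rotated_rep w (coherent z) x = exp_vec I (rotate_back w z) x"
  using someI_ex[OF rotated_model_exists[of w]] unfolding rotated_rep_def by blast+

definition linear_form :: "(nat \<Rightarrow> complex) \<Rightarrow> (nat \<Rightarrow> real) \<Rightarrow> real" where
  "linear_form w x = (\<Sum>j\<in>I. cmod (w j) * x j)"

lemma linear_form_measurable [measurable]: "linear_form w \<in> borel_measurable G"
  unfolding linear_form_def[abs_def] by measurable

text \<open>The operator \<open>exp (c \<Phi>(w))\<close> for the field operator \<open>\<Phi>(w)\<close>, the generator of the Weyl operators
  that translate the exponential vectors by \<open>s w\<close>.\<close>

definition exp_field :: "(nat \<Rightarrow> complex) \<Rightarrow> real \<Rightarrow> ((nat \<Rightarrow> real) \<Rightarrow> complex) set rel" where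
  "exp_field w c = L2_model.mult_op L2 G (rotated_rep w) (\<lambda>x. of_real (exp (c * linear_form w x)))"

definition weyl_op :: "(nat \<Rightarrow> complex) \<Rightarrow> real \<Rightarrow> ((nat \<Rightarrow> real) \<Rightarrow> complex) set rel" where
  "weyl_op w s = L2_model.mult_op L2 G (rotated_rep w) (\<lambda>x. exp (\<i> * of_real (s * linear_form w x)))"

lemma positive_exp_field: "positive_self_adjoint L2 (exp_field w c)"
proof -
  interpret W: L2_model L2 G "rotated_rep w" by (rule L2_model_rotated_rep)
  show ?thesis
    unfolding exp_field_def by (rule W.positive_self_adjoint_mult_op) simp_all
qed

lemma has_power_exp_field_real: "has_power L2 (exp_field w c) (of_real r) (exp_field w (r * c))"
proof -
  interpret W: L2_model L2 G "rotated_rep w" by (rule L2_model_rotated_rep)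
  have "W.mult_op (\<lambda>x. exp (of_real r * of_real (c * linear_form w x))) = exp_field w (r * c)"
    unfolding exp_field_def by (rule W.mult_op_eqI) (simp add: exp_of_real[symmetric] mult.assoc)
  then show ?thesis
    using W.has_power_mult_op_exp[of "\<lambda>x. c * linear_form w x" "of_real r"] unfolding exp_field_def by simp
qed

lemma has_power_exp_field_imaginary: "has_power L2 (exp_field w c) (\<i> * of_real s) (weyl_op w (s * c))"
proof -
  interpret W: L2_model L2 G "rotated_rep w" by (rule L2_model_rotated_rep)
  have "W.mult_op (\<lambda>x. exp (\<i> * of_real s * of_real (c * linear_form w x))) = weyl_op w (s * c)"
    unfolding weyl_op_def by (rule W.mult_op_eqI) (simp add: mult.assoc)
  then show ?thesis
    using W.has_power_mult_op_exp[of "\<lambda>x. c * linear_form w x" "\<i> * of_real s"] unfolding exp_field_def by simp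
qed

lemma weyl_exponent:
  fixes u z s r x :: complex
  shows "\<i> * s * (r * x) + (u * z * x - (u * z)\<^sup>2 / 2) =
    (- (s * - (\<i> * r * u) * z) - s\<^sup>2 * (r * r) / 2) +
    ((u * z + s * (\<i> * r)) * x - (u * z + s * (\<i> * r))\<^sup>2 / 2)"
proof -
  have "(u * z + s * (\<i> * r))\<^sup>2 = (u * z)\<^sup>2 + 2 * (s * (\<i> * r * u) * z) - s\<^sup>2 * (r * r)"
    by (simp add: power2_eq_square algebra_simps)
  then show ?thesis by (simp add: add_divide_distrib diff_divide_distrib distrib_right)
qed

text \<open>
  Completing the square, with \<open>i \<bar>w\<^sub>j\<bar> = u w\<^sub>j\<close> for the conjugate phase \<open>u\<close>.
\<close>

lemma exp_vec_translate:
  "exp (\<i> * of_real (s * linear_form w x)) * exp_vec I (rotate_back w z) x =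
   exp (\<Sum>j\<in>I. - (of_real s * cnj (w j) * z j) - of_real (s\<^sup>2) * (cnj (w j) * w j) / 2) *
   exp_vec I (rotate_back w (\<lambda>j. z j + of_real s * w j)) x"
proof -
  have *: "\<i> * of_real s * of_real (cmod (w j) * x j) +
      (rotate_back w z j * of_real (x j) - (rotate_back w z j)\<^sup>2 / 2) =
    (- (of_real s * cnj (w j) * z j) - of_real (s\<^sup>2) * (cnj (w j) * w j) / 2) +
      (rotate_back w (\<lambda>j. z j + of_real s * w j) j * of_real (x j)
        - (rotate_back w (\<lambda>j. z j + of_real s * w j) j)\<^sup>2 / 2)" for j
  proof -
    define u where "u = cnj (polar_phase (w j))"
    define r where "r = complex_of_real (cmod (w j))"
    have 1: "u * w j = \<i> * r" unfolding u_def r_def by (rule cnj_polar_phase)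
    have 2: "cnj (w j) = - (\<i> * r * u)" unfolding u_def r_def by (simp add: cnj_polar_phase')
    have 3: "u * (z j + of_real s * w j) = u * z j + of_real s * (\<i> * r)"
      unfolding 1[symmetric] by (simp add: algebra_simps)
    have 4: "cnj (w j) * w j = r * r"
      unfolding r_def by (metis complex_norm_square mult.commute of_real_power power2_eq_square)
    show ?thesis
      unfolding u_def[symmetric] 3 4 unfolding 2 of_real_mult of_real_power r_def[symmetric]
      by (rule weyl_exponent)
  qed
  have "\<i> * of_real (s * (\<Sum>j\<in>I. cmod (w j) * x j)) = (\<Sum>j\<in>I. \<i> * of_real s * of_real (cmod (w j) * x j))"
    by (simp add: sum_distrib_left mult.assoc)
  then show ?thesis
    unfolding exp_vec_def linear_form_def exp_add[symmetric]
    by (simp only: sum.distrib[symmetric] *)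
qed

lemma weyl_op_unitary:
  obtains p where "L2.unitary_on p" "weyl_op w s = {(x, p x) | x. x \<in> carrier L2}"
    "\<And>a z. p (a \<odot>\<^bsub>L2\<^esub> coherent z) =
      (a * exp (\<Sum>j\<in>I. - (of_real s * cnj (w j) * z j) - of_real (s\<^sup>2) * (cnj (w j) * w j) / 2))
        \<odot>\<^bsub>L2\<^esub> coherent (\<lambda>j. z j + of_real s * w j)"
proof -
  interpret W: L2_model L2 G "rotated_rep w" by (rule L2_model_rotated_rep)
  let ?g = "\<lambda>x. exp (\<i> * complex_of_real (s * linear_form w x))"
  obtain p where p: "L2.unitary_on p" "W.mult_op ?g = {(x, p x) | x. x \<in> carrier L2}"
    "\<And>X. X \<in> carrier L2 \<Longrightarrow> AE x in G. rotated_rep w (p X) x = ?g x * rotated_rep w X x"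
    using W.unimodular_mult_op[of ?g] by auto
  have "p (a \<odot>\<^bsub>L2\<^esub> coherent z) =
      (a * exp (\<Sum>j\<in>I. - (of_real s * cnj (w j) * z j) - of_real (s\<^sup>2) * (cnj (w j) * w j) / 2))
        \<odot>\<^bsub>L2\<^esub> coherent (\<lambda>j. z j + of_real s * w j)" (is "_ = (a * ?c) \<odot>\<^bsub>L2\<^esub> coherent ?z") for a z
  proof (rule W.U_eqI)
    have az: "a \<odot>\<^bsub>L2\<^esub> coherent z \<in> carrier L2" by (rule L2.smult_in_carrier[OF coherent_carrier])
    then show "p (a \<odot>\<^bsub>L2\<^esub> coherent z) \<in> carrier L2"
      using p(1) unfolding L2.unitary_on_def by blast
    show "(a * ?c) \<odot>\<^bsub>L2\<^esub> coherent ?z \<in> carrier L2"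
      by (rule L2.smult_in_carrier[OF coherent_carrier])
    show "AE x in G. rotated_rep w (p (a \<odot>\<^bsub>L2\<^esub> coherent z)) x = rotated_rep w ((a * ?c) \<odot>\<^bsub>L2\<^esub> coherent ?z) x"
      using p(3)[OF az] W.U_smult[OF coherent_carrier, of a z] W.U_smult[OF coherent_carrier, of "a * ?c" ?z]
        rotated_rep_coherent[of w z] rotated_rep_coherent[of w ?z]
    proof eventually_elim
      case (elim x)
      have "rotated_rep w (p (a \<odot>\<^bsub>L2\<^esub> coherent z)) x = a * (?g x * exp_vec I (rotate_back w z) x)"
        unfolding elim(1,2,4) by simp
      then show ?case
        unfolding exp_vec_translate elim(3,5) by (simp only: mult.assoc)
    qed
  qed
  then show ?thesis using that p(1,2) unfolding weyl_op_def by blast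
qed

definition symplectic :: "(nat \<Rightarrow> complex) \<Rightarrow> (nat \<Rightarrow> complex) \<Rightarrow> real" where
  "symplectic v w = Im (\<Sum>j\<in>I. cnj (v j) * w j)"

text \<open>
  On exponential vectors both products translate by \<open>s v + t w\<close>.  The factors that they produce differ
  by \<open>exp (s t (\<langle>w, v\<rangle> - \<langle>v, w\<rangle>))\<close>.
\<close>

lemma weyl_op_commutation:
  "op_comp (weyl_op v s) (weyl_op w t) =
   op_scale L2 (exp (- 2 * \<i> * of_real (s * t * symplectic v w))) (op_comp (weyl_op w t) (weyl_op v s))"
proof -
  define \<omega> where "\<omega> = exp (- 2 * \<i> * of_real (s * t * symplectic v w))"
  obtain p where p: "L2.unitary_on p" "weyl_op v s = {(x, p x) | x. x \<in> carrier L2}"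
    "\<And>a z. p (a \<odot>\<^bsub>L2\<^esub> coherent z) =
      (a * exp (\<Sum>j\<in>I. - (of_real s * cnj (v j) * z j) - of_real (s\<^sup>2) * (cnj (v j) * v j) / 2))
        \<odot>\<^bsub>L2\<^esub> coherent (\<lambda>j. z j + of_real s * v j)"
    by (rule weyl_op_unitary[of v s]) blast
  obtain q where q: "L2.unitary_on q" "weyl_op w t = {(x, q x) | x. x \<in> carrier L2}"
    "\<And>a z. q (a \<odot>\<^bsub>L2\<^esub> coherent z) =
      (a * exp (\<Sum>j\<in>I. - (of_real t * cnj (w j) * z j) - of_real (t\<^sup>2) * (cnj (w j) * w j) / 2))
        \<odot>\<^bsub>L2\<^esub> coherent (\<lambda>j. z j + of_real t * w j)"
    by (rule weyl_op_unitary[of w t]) blast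
  have sympl: "- 2 * \<i> * of_real (s * t * symplectic v w) =
      (\<Sum>j\<in>I. of_real (s * t) * (cnj (w j) * v j - cnj (v j) * w j))"
  proof -
    define S where "S = (\<Sum>j\<in>I. cnj (v j) * w j)"
    have "(\<Sum>j\<in>I. of_real (s * t) * (cnj (w j) * v j - cnj (v j) * w j)) = of_real (s * t) * (cnj S - S)"
      unfolding S_def by (simp add: sum_distrib_left[symmetric] sum_subtractf cnj_sum mult.commute)
    also have "cnj S - S = - 2 * \<i> * of_real (Im S)"
      by (simp add: complex_eq_iff)
    finally show ?thesis unfolding symplectic_def S_def[symmetric] by simp
  qed
  have pq: "p (q x) = \<omega> \<odot>\<^bsub>L2\<^esub> q (p x)" if x: "x \<in> carrier L2" for x
  proof (rule L2.unitaries_agree[of "\<lambda>x. p (q x)" "\<lambda>x. \<omega> \<odot>\<^bsub>L2\<^esub> q (p x)" coherent, OF _ _ coherent_carrier coherent_total _ x])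
    show "L2.unitary_on (\<lambda>x. p (q x))" by (rule L2.unitary_on_comp[OF p(1) q(1)])
    show "L2.unitary_on (\<lambda>x. \<omega> \<odot>\<^bsub>L2\<^esub> q (p x))"
    proof (rule L2.unitary_on_smult[OF L2.unitary_on_comp[OF q(1) p(1)]])
      show "cmod \<omega> = 1"
        unfolding \<omega>_def by simp
    qed
    fix z
    have one: "1 \<odot>\<^bsub>L2\<^esub> coherent z = coherent z" for z
      using L2.smult_one[OF coherent_carrier, of z] by simp
    note p1 = p(3)[of 1, unfolded one mult_1_left] and q1 = q(3)[of 1, unfolded one mult_1_left]
    have shift: "(\<lambda>j. z j + of_real t * w j + of_real s * v j) = (\<lambda>j. z j + of_real s * v j + of_real t * w j)"
      by (simp add: add_ac)
    show "p (q (coherent z)) = \<omega> \<odot>\<^bsub>L2\<^esub> q (p (coherent z))"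
      unfolding p1 q1 p(3) q(3) shift L2.smult_smult[OF coherent_carrier] \<omega>_def sympl
      unfolding exp_add[symmetric] sum.distrib[symmetric]
      by (intro arg_cong2[of _ _ _ _ "smult L2"] arg_cong[of _ _ exp] sum.cong refl) (simp add: algebra_simps)
  qed
  have "op_comp (weyl_op v s) (weyl_op w t) = {(x, p (q x)) | x. x \<in> carrier L2}"
    using q(1) unfolding op_comp_def p(2) q(2) L2.unitary_on_def by auto
  moreover have "op_comp (weyl_op w t) (weyl_op v s) = {(x, q (p x)) | x. x \<in> carrier L2}"
    using p(1) unfolding op_comp_def p(2) q(2) L2.unitary_on_def by auto
  ultimately show ?thesis
    unfolding op_scale_def \<omega>_def[symmetric] using pq by auto
qed

theorem weyl_relation_exp_field:
  "weyl_relation L2 (\<lambda>s t. exp (- 2 * \<i> * of_real (s * t * (c * d * symplectic v w))))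
     (exp_field v c) (exp_field w d)"
  unfolding weyl_relation_def
proof (intro exI conjI allI)
  show "has_power L2 (exp_field v c) (\<i> * of_real s) (weyl_op v (s * c))" for s
    by (rule has_power_exp_field_imaginary)
  show "has_power L2 (exp_field w d) (\<i> * of_real t) (weyl_op w (t * d))" for t
    by (rule has_power_exp_field_imaginary)
  show "op_comp (weyl_op v (s * c)) (weyl_op w (t * d)) =
      op_scale L2 (exp (- 2 * \<i> * of_real (s * t * (c * d * symplectic v w))))
        (op_comp (weyl_op w (t * d)) (weyl_op v (s * c)))" for s t
  proof -
    have "s * c * (t * d) * symplectic v w = s * t * (c * d * symplectic v w)" by simp
    then show ?thesis using weyl_op_commutation[of v "s * c" w "t * d"] by (simp only:)
  qed
qed

end

section \<open>Elementary column and row operations\<close>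

definition col_op :: "nat \<Rightarrow> 'r::ring_1 \<Rightarrow> (nat \<Rightarrow> nat \<Rightarrow> 'r) \<Rightarrow> nat \<Rightarrow> nat \<Rightarrow> 'r" where
  "col_op c a Z = (\<lambda>i j. if j = Suc c then Z i (Suc c) + Z i c * a else Z i j)"

definition row_op :: "nat \<Rightarrow> 'r::ring_1 \<Rightarrow> (nat \<Rightarrow> nat \<Rightarrow> 'r) \<Rightarrow> nat \<Rightarrow> nat \<Rightarrow> 'r" where
  "row_op r b Z = (\<lambda>i j. if i = Suc r then Z (Suc r) j + b * Z r j else Z i j)"

abbreviation fold_cols :: "(nat \<times> 'r::ring_1) list \<Rightarrow> (nat \<Rightarrow> nat \<Rightarrow> 'r) \<Rightarrow> nat \<Rightarrow> nat \<Rightarrow> 'r" where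
  "fold_cols cs Z \<equiv> foldl (\<lambda>Z (c, a). col_op c a Z) Z cs"

abbreviation fold_rows :: "(nat \<times> 'r::ring_1) list \<Rightarrow> (nat \<Rightarrow> nat \<Rightarrow> 'r) \<Rightarrow> nat \<Rightarrow> nat \<Rightarrow> 'r" where
  "fold_rows rs Z \<equiv> foldl (\<lambda>Z (r, b). row_op r b Z) Z rs"

lemma fold_cols_closed:
  assumes "\<And>x y. x \<in> S \<Longrightarrow> y \<in> S \<Longrightarrow> x + y \<in> S" "\<And>x y. x \<in> S \<Longrightarrow> y \<in> S \<Longrightarrow> x * y \<in> S"
    and "\<And>c a. (c, a) \<in> set cs \<Longrightarrow> Suc c < N \<and> a \<in> S"
    and "\<And>i j. i < N \<Longrightarrow> j < N \<Longrightarrow> Z i j \<in> S" and "i < N" "j < N"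
  shows "fold_cols cs Z i j \<in> S"
  using assms(3-)
proof (induction cs arbitrary: Z)
  case (Cons p cs)
  obtain c a where p: "p = (c, a)" by fastforce
  have c: "Suc c < N" "a \<in> S" using Cons.prems(1)[of c a] by (simp_all add: p)
  have "fold_cols cs (col_op c a Z) i j \<in> S"
  proof (rule Cons.IH[OF _ _ Cons.prems(3,4)])
    show "Suc c' < N \<and> a' \<in> S" if "(c', a') \<in> set cs" for c' a'
      using Cons.prems(1)[of c' a'] that by simp
    show "col_op c a Z k l \<in> S" if "k < N" "l < N" for k l
      using Cons.prems(2) assms(1,2) c that by (simp add: col_op_def)
  qed
  then show ?case by (simp add: p)
qed simp

lemma fold_rows_closed:
  assumes "\<And>x y. x \<in> S \<Longrightarrow> y \<in> S \<Longrightarrow> x + y \<in> S" "\<And>x y. x \<in> S \<Longrightarrow> y \<in> S \<Longrightarrow> x * y \<in> S"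
    and "\<And>r b. (r, b) \<in> set rs \<Longrightarrow> Suc r < N \<and> b \<in> S"
    and "\<And>i j. i < N \<Longrightarrow> j < N \<Longrightarrow> Z i j \<in> S" and "i < N" "j < N"
  shows "fold_rows rs Z i j \<in> S"
  using assms(3-)
proof (induction rs arbitrary: Z)
  case (Cons p rs)
  obtain r b where p: "p = (r, b)" by fastforce
  have r: "Suc r < N" "b \<in> S" using Cons.prems(1)[of r b] by (simp_all add: p)
  have "fold_rows rs (row_op r b Z) i j \<in> S"
  proof (rule Cons.IH[OF _ _ Cons.prems(3,4)])
    show "Suc r' < N \<and> b' \<in> S" if "(r', b') \<in> set rs" for r' b'
      using Cons.prems(1)[of r' b'] that by simp
    show "row_op r b Z k l \<in> S" if "k < N" "l < N" for k l
      using Cons.prems(2) assms(1,2) r that by (simp add: row_op_def)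
  qed
  then show ?case by (simp add: p)
qed simp

lemma fold_cols_upper: "(\<And>i j. j < i \<Longrightarrow> Z i j = 0) \<Longrightarrow> j < i \<Longrightarrow> fold_cols cs Z i j = 0"
proof (induction cs arbitrary: Z)
  case (Cons p cs)
  obtain c a where p: "p = (c, a)" by fastforce
  have "col_op c a Z i j = 0" if "j < i" for i j
    using Cons.prems(1) that by (simp add: col_op_def)
  then show ?case using Cons.IH[of "col_op c a Z"] Cons.prems(2) by (simp add: p)
qed simp

lemma fold_rows_lower: "(\<And>i j. i < j \<Longrightarrow> Z i j = 0) \<Longrightarrow> i < j \<Longrightarrow> fold_rows rs Z i j = 0"
proof (induction rs arbitrary: Z)
  case (Cons p rs)
  obtain r b where p: "p = (r, b)" by fastforce
  have "row_op r b Z i j = 0" if "i < j" for i j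
    using Cons.prems(1) that by (simp add: row_op_def)
  then show ?case using Cons.IH[of "row_op r b Z"] Cons.prems(2) by (simp add: p)
qed simp

section \<open>\<open>GL\<^sub>q(N)\<close> matrices modulo an ideal\<close>

locale scalar_ideal =
  fixes J :: "'r::ring_1 set" and sc :: "complex \<Rightarrow> 'r" and Q :: complex
  assumes J_zero: "0 \<in> J"
    and J_add: "x \<in> J \<Longrightarrow> y \<in> J \<Longrightarrow> x + y \<in> J"
    and J_left: "x \<in> J \<Longrightarrow> y * x \<in> J"
    and J_right: "x \<in> J \<Longrightarrow> x * y \<in> J"
    and sc_one: "sc 1 = 1"
    and sc_mult: "sc (c * d) = sc c * sc d"
    and sc_central: "x * sc c = sc c * x"
    and Q_nonzero: "Q \<noteq> 0"
begin

lemma J_uminus: "x \<in> J \<Longrightarrow> - x \<in> J"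
  using J_left[of x "-1"] by simp

lemma J_diff: "x \<in> J \<Longrightarrow> y \<in> J \<Longrightarrow> x - y \<in> J"
  using J_add[of x "- y"] J_uminus[of y] by simp

lemma sc_central_left: "x * (sc c * y) = sc c * (x * y)"
  by (metis mult.assoc sc_central)

definition qcomm :: "complex \<Rightarrow> 'r \<Rightarrow> 'r \<Rightarrow> bool" where
  "qcomm c x y \<longleftrightarrow> x * y - sc c * (y * x) \<in> J"

lemma qcomm_D: "qcomm c x y \<Longrightarrow> x * y - sc c * (y * x) \<in> J"
  by (simp add: qcomm_def)

lemma qcomm_one: "qcomm 1 x y \<longleftrightarrow> x * y - y * x \<in> J"
  by (simp add: qcomm_def sc_one)

lemma qcomm_refl: "qcomm 1 x x"
  by (simp add: qcomm_one J_zero)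

lemma qcomm_zero_left: "qcomm c 0 y" and qcomm_zero_right: "qcomm c x 0"
  by (simp_all add: qcomm_def J_zero)

lemma qcomm_swap:
  assumes "qcomm c x y" "c \<noteq> 0" shows "qcomm (1 / c) y x"
proof -
  have "sc (1 / c) * sc c = 1"
    using assms(2) by (simp add: sc_mult[symmetric] sc_one)
  then have "y * x - sc (1 / c) * (x * y) = - (sc (1 / c) * (x * y - sc c * (y * x)))"
    by (simp add: right_diff_distrib mult.assoc[symmetric])
  then show ?thesis
    unfolding qcomm_def using J_uminus[OF J_left[OF qcomm_D[OF assms(1)]]] by simp
qed

lemma qcomm_one_swap: "qcomm 1 x y \<Longrightarrow> qcomm 1 y x"
  using qcomm_swap[of 1 x y] by simp

lemma qcomm_add_right: "qcomm c x y \<Longrightarrow> qcomm c x z \<Longrightarrow> qcomm c x (y + z)"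
  unfolding qcomm_def using J_add[of "x * y - sc c * (y * x)" "x * z - sc c * (z * x)"]
  by (simp add: algebra_simps)

lemma qcomm_add_left: "qcomm c x z \<Longrightarrow> qcomm c y z \<Longrightarrow> qcomm c (x + y) z"
  unfolding qcomm_def using J_add[of "x * z - sc c * (z * x)" "y * z - sc c * (z * y)"]
  by (simp add: algebra_simps)

lemma qcomm_mult_right:
  assumes "qcomm c x y" "qcomm d x z" "e = c * d" shows "qcomm e x (y * z)"
proof -
  have "x * (y * z) - sc e * (y * z * x) =
      (x * y - sc c * (y * x)) * z + sc c * (y * (x * z - sc d * (z * x)))"
    unfolding assms(3) sc_mult
    by (simp add: left_diff_distrib right_diff_distrib mult.assoc sc_central_left[of y])
  then show ?thesis
    unfolding qcomm_def
    using J_add[OF J_right[OF qcomm_D[OF assms(1)]] J_left[OF J_left[OF qcomm_D[OF assms(2)]]]] by simp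
qed

lemma qcomm_mult_left:
  assumes "qcomm c x z" "qcomm d y z" "e = c * d" shows "qcomm e (x * y) z"
proof -
  have "x * y * z - sc e * (z * (x * y)) =
      x * (y * z - sc d * (z * y)) + sc d * ((x * z - sc c * (z * x)) * y)"
    unfolding assms(3) mult.commute[of c d] sc_mult
    by (simp add: left_diff_distrib right_diff_distrib mult.assoc sc_central_left[of x])
  then show ?thesis
    unfolding qcomm_def
    using J_add[OF J_left[OF qcomm_D[OF assms(2)]] J_left[OF J_right[OF qcomm_D[OF assms(1)]]]] by simp
qed

text \<open>
  The relations within a row or a column are required for every pair of entries there, whereas in
  the definition for matrices they occur only as sides of a \<open>2 \<times> 2\<close> submatrix.
\<close>

definition glq :: "nat \<Rightarrow> (nat \<Rightarrow> nat \<Rightarrow> 'r) \<Rightarrow> bool" where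
  "glq N Z \<longleftrightarrow>
     (\<forall>i<N. \<forall>j'<N. \<forall>j<j'. qcomm 1 (Z i j) (Z i j')) \<and>
     (\<forall>i'<N. \<forall>i<i'. \<forall>j<N. qcomm Q (Z i j) (Z i' j)) \<and>
     (\<forall>i'<N. \<forall>i<i'. \<forall>j'<N. \<forall>j<j'. qcomm Q (Z i j') (Z i' j)) \<and>
     (\<forall>i'<N. \<forall>i<i'. \<forall>j'<N. \<forall>j<j'.
        (Z i j * Z i' j' - Z i j' * Z i' j) - (Z i' j' * Z i j - Z i' j * Z i j') \<in> J)"

context
  fixes N :: nat and Z :: "nat \<Rightarrow> nat \<Rightarrow> 'r"
  assumes Z: "glq N Z"
begin

lemma glq_row: "\<lbrakk>i < N; j < N; j' < N\<rbrakk> \<Longrightarrow> qcomm 1 (Z i j) (Z i j')"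
proof (cases j j' rule: linorder_cases)
  case less
  assume "i < N" "j' < N"
  then show ?thesis using Z[unfolded glq_def, THEN conjunct1, rule_format, of i j' j] less by simp
next
  case equal
  then show ?thesis by (simp add: qcomm_refl)
next
  case greater
  assume "i < N" "j < N"
  then have "qcomm 1 (Z i j') (Z i j)"
    using Z[unfolded glq_def, THEN conjunct1, rule_format, of i j j'] greater by simp
  then show ?thesis by (rule qcomm_one_swap)
qed

lemma glq_col: "\<lbrakk>i < i'; i' < N; j < N\<rbrakk> \<Longrightarrow> qcomm Q (Z i j) (Z i' j)"
  by (rule Z[unfolded glq_def, THEN conjunct2, THEN conjunct1, rule_format])

lemma glq_anti: "\<lbrakk>i < i'; i' < N; j < j'; j' < N\<rbrakk> \<Longrightarrow> qcomm Q (Z i j') (Z i' j)"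
  by (rule Z[unfolded glq_def, THEN conjunct2, THEN conjunct2, THEN conjunct1, rule_format])

lemma glq_diag: "\<lbrakk>i < i'; i' < N; j < j'; j' < N\<rbrakk> \<Longrightarrow>
    (Z i j * Z i' j' - Z i j' * Z i' j) - (Z i' j' * Z i j - Z i' j * Z i j') \<in> J"
  by (rule Z[unfolded glq_def, THEN conjunct2, THEN conjunct2, THEN conjunct2, rule_format])

end

text \<open>
  Among the relations after a column operation only the one within the modified column contains
  products of two modified entries.  Its part linear in \<open>a\<close> is
  \<open>\<beta>\<gamma> + q\<^sup>2\<alpha>\<delta> - q\<^sup>2\<delta>\<alpha> - q\<^sup>4\<gamma>\<beta>\<close>, which vanishes because of \<open>\<alpha>\<delta> - \<delta>\<alpha> = \<beta>\<gamma> - \<gamma>\<beta>\<close> and \<open>\<beta>\<gamma> = q\<^sup>2\<gamma>\<beta>\<close>.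
\<close>

lemma qcomm_modified_column:
  assumes D: "(\<alpha> * \<delta> - \<beta> * \<gamma>) - (\<delta> * \<alpha> - \<gamma> * \<beta>) \<in> J"
    and "qcomm Q \<alpha> \<gamma>" "qcomm Q \<beta> \<delta>" "qcomm Q \<beta> \<gamma>"
    and "qcomm Q a \<beta>" "qcomm Q a \<delta>" "qcomm 1 a \<alpha>" "qcomm 1 a \<gamma>"
  shows "qcomm Q (\<beta> + \<alpha> * a) (\<delta> + \<gamma> * a)"
proof -
  define k where "k = sc Q"
  have central: "x * (k * y) = k * (x * y)" for x y
    unfolding k_def by (rule sc_central_left)
  note m = assms(2-6)[unfolded qcomm_def, folded k_def]
  have "(\<beta> * (\<gamma> * a) - k * (\<gamma> * a * \<beta>)) + (\<alpha> * a * \<delta> - k * (\<delta> * (\<alpha> * a))) =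
      \<alpha> * (a * \<delta> - k * (\<delta> * a)) - k * (\<gamma> * (a * \<beta> - k * (\<beta> * a)))
      + k * (((\<alpha> * \<delta> - \<beta> * \<gamma>) - (\<delta> * \<alpha> - \<gamma> * \<beta>)) * a)
      + (\<beta> * \<gamma> - k * (\<gamma> * \<beta>)) * a + k * ((\<beta> * \<gamma> - k * (\<gamma> * \<beta>)) * a)"
    by (simp add: algebra_simps central[of \<alpha>] central[of \<gamma>])
  also have "\<dots> \<in> J"
    by (intro J_add[OF J_add[OF J_add[OF J_diff]]] J_left[OF J_right[OF D]] J_left[OF J_right] J_left J_right m)
  finally have linear: "(\<beta> * (\<gamma> * a) - k * (\<gamma> * a * \<beta>)) + (\<alpha> * a * \<delta> - k * (\<delta> * (\<alpha> * a))) \<in> J" .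
  have "qcomm Q (\<alpha> * a) (\<gamma> * a)"
    by (intro qcomm_mult_right[where c = Q and d = 1] qcomm_mult_left[where c = Q and d = 1]
        qcomm_mult_left[where c = 1 and d = 1] assms qcomm_refl qcomm_one_swap[OF assms(7)]) simp_all
  then have quadratic: "\<alpha> * a * (\<gamma> * a) - k * (\<gamma> * a * (\<alpha> * a)) \<in> J"
    unfolding qcomm_def k_def .
  have "(\<beta> + \<alpha> * a) * (\<delta> + \<gamma> * a) - k * ((\<delta> + \<gamma> * a) * (\<beta> + \<alpha> * a)) =
      (\<beta> * \<delta> - k * (\<delta> * \<beta>))
      + ((\<beta> * (\<gamma> * a) - k * (\<gamma> * a * \<beta>)) + (\<alpha> * a * \<delta> - k * (\<delta> * (\<alpha> * a))))
      + (\<alpha> * a * (\<gamma> * a) - k * (\<gamma> * a * (\<alpha> * a)))"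
    by (simp add: algebra_simps)
  then show ?thesis
    using J_add[OF J_add[OF m(2) linear] quadratic] unfolding qcomm_def k_def by simp
qed

text \<open>
  The operation is multiplication from the right by \<open>I + a E\<close> with a matrix unit \<open>E\<close>.  A relation with
  a single modified entry acquires the same relation with the entry \<open>Z i c\<close>, times \<open>a\<close>.
\<close>

theorem glq_col_op:
  assumes Z: "glq N Z" and c: "Suc c < N"
    and a: "\<And>i j. i < N \<Longrightarrow> j < N \<Longrightarrow> qcomm (if j = Suc c then Q else 1) a (Z i j)"
  shows "glq N (col_op c a Z)"
proof -
  note row = glq_row[OF Z] and col = glq_col[OF Z] and anti = glq_anti[OF Z] and diag = glq_diag[OF Z]
  have a1: "qcomm 1 a (Z i j)" if "i < N" "j < N" "j \<noteq> Suc c" for i j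
    using a[OF that(1,2)] that(3) by simp
  have a1': "a * Z i j - Z i j * a \<in> J" if "i < N" "j < N" "j \<noteq> Suc c" for i j
    using a1[OF that] by (simp add: qcomm_one)
  have aQ: "qcomm Q a (Z i (Suc c))" if "i < N" for i
    using a[OF that c] by simp
  have row': "qcomm 1 (col_op c a Z i j) (col_op c a Z i j')" if i: "i < N" and j: "j < j'" "j' < N" for i j j'
  proof -
    have new: "qcomm 1 (Z i k) (Z i (Suc c) + Z i c * a)" if "k < N" "k \<noteq> Suc c" for k
      using i c that
      by (intro qcomm_add_right qcomm_mult_right[where c = 1 and d = 1] row qcomm_one_swap[OF a1]) simp_all
    show ?thesis
      using j new[of j] qcomm_one_swap[OF new[of j']] row[OF i, of j j'] unfolding col_op_def by auto
  qed
  have col': "qcomm Q (col_op c a Z i j) (col_op c a Z i' j)" if i: "i < i'" "i' < N" and j: "j < N" for i i' j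
  proof (cases "j = Suc c")
    case True
    have "qcomm Q (Z i (Suc c) + Z i c * a) (Z i' (Suc c) + Z i' c * a)"
      using i c by (intro qcomm_modified_column diag col anti aQ a1) simp_all
    then show ?thesis using True by (simp add: col_op_def)
  next
    case False
    then show ?thesis using col[OF i j] by (simp add: col_op_def)
  qed
  have anti': "qcomm Q (col_op c a Z i j') (col_op c a Z i' j)"
    if i: "i < i'" "i' < N" and j: "j < j'" "j' < N" for i i' j j'
  proof -
    consider "j' = Suc c" | "j = Suc c" | "j \<noteq> Suc c" "j' \<noteq> Suc c" by blast
    then show ?thesis
    proof cases
      case 1
      have "qcomm Q (Z i c) (Z i' j)"
        using 1 i j col[OF i, of c] anti[OF i, of j c] by (cases "j = c") simp_all
      then have "qcomm Q (Z i (Suc c) + Z i c * a) (Z i' j)"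
        using 1 i j anti[OF i j]
        by (intro qcomm_add_left qcomm_mult_left[where c = Q and d = 1] a1) simp_all
      then show ?thesis using 1 j by (simp add: col_op_def)
    next
      case 2
      have "qcomm Q (Z i j') (Z i' (Suc c) + Z i' c * a)"
        using 2 i j
        by (intro qcomm_add_right qcomm_mult_right[where c = Q and d = 1] qcomm_one_swap[OF a1] anti) simp_all
      then show ?thesis using 2 j by (simp add: col_op_def)
    next
      case 3
      then show ?thesis using anti[OF i j] by (simp add: col_op_def)
    qed
  qed
  have diag': "(col_op c a Z i j * col_op c a Z i' j' - col_op c a Z i j' * col_op c a Z i' j) -
      (col_op c a Z i' j' * col_op c a Z i j - col_op c a Z i' j * col_op c a Z i j') \<in> J"
    if i: "i < i'" "i' < N" and j: "j < j'" "j' < N" for i i' j j'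
  proof -
    have iN: "i < N" using i by simp
    consider "j' = Suc c" | "j = Suc c" | "j \<noteq> Suc c" "j' \<noteq> Suc c" by blast
    then show ?thesis
    proof cases
      case 1
      have jc: "j \<le> c" "j < N" "j \<noteq> Suc c" using 1 j by simp_all
      have D': "(Z i j * Z i' c - Z i c * Z i' j) - (Z i' c * Z i j - Z i' j * Z i c) \<in> J"
        using diag[OF i, of j c] 1 j by (cases "j = c") (simp_all add: J_zero)
      have "(Z i j * (Z i' (Suc c) + Z i' c * a) - (Z i (Suc c) + Z i c * a) * Z i' j) -
          ((Z i' (Suc c) + Z i' c * a) * Z i j - Z i' j * (Z i (Suc c) + Z i c * a)) =
        ((Z i j * Z i' (Suc c) - Z i (Suc c) * Z i' j) - (Z i' (Suc c) * Z i j - Z i' j * Z i (Suc c)))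
        + ((Z i j * Z i' c - Z i c * Z i' j) - (Z i' c * Z i j - Z i' j * Z i c)) * a
        - Z i c * (a * Z i' j - Z i' j * a) - Z i' c * (a * Z i j - Z i j * a)"
        by (simp add: algebra_simps)
      also have "\<dots> \<in> J"
        using diag[OF i j] 1 by (intro J_add J_diff[OF J_diff[OF J_add]] J_left J_right D' a1' i iN jc) simp
      finally show ?thesis using 1 jc by (simp add: col_op_def)
    next
      case 2
      have jc: "j' \<noteq> Suc c" "c < j'" "c < N" using 2 j by simp_all
      have "((Z i (Suc c) + Z i c * a) * Z i' j' - Z i j' * (Z i' (Suc c) + Z i' c * a)) -
          (Z i' j' * (Z i (Suc c) + Z i c * a) - (Z i' (Suc c) + Z i' c * a) * Z i j') =
        ((Z i (Suc c) * Z i' j' - Z i j' * Z i' (Suc c)) - (Z i' j' * Z i (Suc c) - Z i' (Suc c) * Z i j'))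
        + ((Z i c * Z i' j' - Z i j' * Z i' c) - (Z i' j' * Z i c - Z i' c * Z i j')) * a
        + Z i c * (a * Z i' j' - Z i' j' * a) + Z i' c * (a * Z i j' - Z i j' * a)"
        by (simp add: algebra_simps)
      also have "\<dots> \<in> J"
        using diag[OF i j] diag[OF i jc(2) j(2)] 2
        by (intro J_add J_left J_right a1' i iN jc j) simp_all
      finally show ?thesis using 2 jc by (simp add: col_op_def)
    next
      case 3
      then show ?thesis using diag[OF i j] by (simp add: col_op_def)
    qed
  qed
  show ?thesis
    unfolding glq_def by (intro conjI allI impI row' col' anti' diag')
qed

text \<open>
  After a row operation it is the relation within the modified row that contains products of two
  modified entries.  Its part linear in \<open>b\<close> is \<open>b\<close> times the difference of the two sides of
  \<open>\<alpha>\<delta> - \<beta>\<gamma> = \<delta>\<alpha> - \<gamma>\<beta>\<close>.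
\<close>

lemma qcomm_modified_row:
  assumes D: "(y * x' - y' * x) - (x' * y - x * y') \<in> J"
    and "qcomm Q y b" "qcomm Q y' b" "qcomm 1 x b" "qcomm 1 x' b" "qcomm 1 x x'" "qcomm 1 y y'"
  shows "qcomm 1 (x + b * y) (x' + b * y')"
proof -
  define k where "k = sc Q"
  have central: "u * (k * v) = k * (u * v)" for u v
    unfolding k_def by (rule sc_central_left)
  note m = assms(4-)[unfolded qcomm_one] assms(2,3)[unfolded qcomm_def, folded k_def]
  have "(x + b * y) * (x' + b * y') - (x' + b * y') * (x + b * y) =
      (x * x' - x' * x) + (x * b - b * x) * y' - (x' * b - b * x') * y
      + b * ((y * b - k * (b * y)) * y') - b * ((y' * b - k * (b * y')) * y)
      + k * (b * (b * (y * y' - y' * y))) + b * ((y * x' - y' * x) - (x' * y - x * y'))"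
    by (simp add: left_diff_distrib right_diff_distrib distrib_left distrib_right mult.assoc central[of b])
  also have "\<dots> \<in> J"
    by (intro J_add[OF J_add[OF J_diff[OF J_add[OF J_diff[OF J_add]]]]] J_left[OF J_left] J_left J_right m D)
  finally show ?thesis unfolding qcomm_one .
qed

text \<open>
  The operation is multiplication from the left by \<open>I + b E\<close> with a matrix unit \<open>E\<close>.
\<close>

theorem glq_row_op:
  assumes Z: "glq N Z" and r: "Suc r < N"
    and b: "\<And>i j. i < N \<Longrightarrow> j < N \<Longrightarrow> qcomm (if i = r then Q else 1) (Z i j) b"
  shows "glq N (row_op r b Z)"
proof -
  note row = glq_row[OF Z] and col = glq_col[OF Z] and anti = glq_anti[OF Z] and diag = glq_diag[OF Z]
  have b1: "qcomm 1 (Z i j) b" if "i < N" "j < N" "i \<noteq> r" for i j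
    using b[OF that(1,2)] that(3) by simp
  have b1': "Z i j * b - b * Z i j \<in> J" if "i < N" "j < N" "i \<noteq> r" for i j
    using b1[OF that] by (simp add: qcomm_one)
  have bQ: "qcomm Q (Z r j) b" if "j < N" for j
    using b[of r j] that r by simp
  have row': "qcomm 1 (row_op r b Z i j) (row_op r b Z i j')" if i: "i < N" and j: "j < j'" "j' < N" for i j j'
  proof (cases "i = Suc r")
    case True
    have "qcomm 1 (Z (Suc r) j + b * Z r j) (Z (Suc r) j' + b * Z r j')"
      using r j by (intro qcomm_modified_row diag bQ b1 row) simp_all
    then show ?thesis using True by (simp add: row_op_def)
  next
    case False
    then show ?thesis using row[OF i, of j j'] j by (simp add: row_op_def)
  qed
  \<comment> \<open>both remaining \<open>q\<^sup>2\<close>-relations: \<open>j = j'\<close> is the column relation\<close>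
  have cross: "qcomm Q (row_op r b Z i j') (row_op r b Z i' j)"
    if i: "i < i'" "i' < N" and j: "j \<le> j'" "j' < N" for i i' j j'
  proof -
    have jN: "j < N" using j by simp
    have old: "qcomm Q (Z k j') (Z k' j)" if "k < k'" "k' < N" for k k'
      using col[OF that, of j] anti[OF that, of j j'] j by (cases "j = j'") simp_all
    consider "i' = Suc r" "i = r" | "i' = Suc r" "i < r" | "i = Suc r" | "i \<noteq> Suc r" "i' \<noteq> Suc r"
      using i by linarith
    then show ?thesis
    proof cases
      case 1
      have "qcomm Q (Z r j') (Z (Suc r) j + b * Z r j)"
        using r j jN by (intro qcomm_add_right qcomm_mult_right[where c = Q and d = 1] old bQ row) simp_all
      then show ?thesis using 1 by (simp add: row_op_def)
    next
      case 2
      have "qcomm Q (Z i j') (Z (Suc r) j + b * Z r j)"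
        using 2 r j jN by (intro qcomm_add_right qcomm_mult_right[where c = 1 and d = Q] old b1) simp_all
      then show ?thesis using 2 by (simp add: row_op_def)
    next
      case 3
      have "qcomm Q (Z (Suc r) j' + b * Z r j') (Z i' j)"
        using 3 r i j jN
        by (intro qcomm_add_left qcomm_mult_left[where c = 1 and d = Q] old qcomm_one_swap[OF b1]) simp_all
      then show ?thesis using 3 i by (simp add: row_op_def)
    next
      case 4
      then show ?thesis using old[OF i] by (simp add: row_op_def)
    qed
  qed
  have diag': "(row_op r b Z i j * row_op r b Z i' j' - row_op r b Z i j' * row_op r b Z i' j) -
      (row_op r b Z i' j' * row_op r b Z i j - row_op r b Z i' j * row_op r b Z i j') \<in> J"
    if i: "i < i'" "i' < N" and j: "j < j'" "j' < N" for i i' j j'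
  proof -
    have iN: "i < N" and jN: "j < N" using i j by simp_all
    consider "i' = Suc r" "i = r" | "i' = Suc r" "i < r" | "i = Suc r" | "i \<noteq> Suc r" "i' \<noteq> Suc r"
      using i by linarith
    then show ?thesis
    proof cases
      case 1
      define k where "k = sc Q"
      have bQ': "Z r l * b - k * (b * Z r l) \<in> J" if "l < N" for l
        using bQ[OF that] by (simp add: qcomm_def k_def)
      have rr: "Z r j * Z r j' - Z r j' * Z r j \<in> J"
        using row[of r j j'] r j by (simp add: qcomm_one)
      have "(Z r j * (Z (Suc r) j' + b * Z r j') - Z r j' * (Z (Suc r) j + b * Z r j)) -
          ((Z (Suc r) j' + b * Z r j') * Z r j - (Z (Suc r) j + b * Z r j) * Z r j') =
        ((Z r j * Z (Suc r) j' - Z r j' * Z (Suc r) j) - (Z (Suc r) j' * Z r j - Z (Suc r) j * Z r j'))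
        + (Z r j * b - k * (b * Z r j)) * Z r j' - (Z r j' * b - k * (b * Z r j')) * Z r j
        + k * (b * (Z r j * Z r j' - Z r j' * Z r j)) + b * (Z r j * Z r j' - Z r j' * Z r j)"
        by (simp add: algebra_simps)
      also have "\<dots> \<in> J"
        using diag[OF i j] 1 by (intro J_add J_diff[OF J_add] J_left J_right bQ' rr j jN) simp
      finally show ?thesis using 1 by (simp add: row_op_def)
    next
      case 2
      have ir: "i \<noteq> r" "r < N" "i \<noteq> Suc r" using 2 r by simp_all
      have "(Z i j * (Z (Suc r) j' + b * Z r j') - Z i j' * (Z (Suc r) j + b * Z r j)) -
          ((Z (Suc r) j' + b * Z r j') * Z i j - (Z (Suc r) j + b * Z r j) * Z i j') =
        ((Z i j * Z (Suc r) j' - Z i j' * Z (Suc r) j) - (Z (Suc r) j' * Z i j - Z (Suc r) j * Z i j'))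
        + (Z i j * b - b * Z i j) * Z r j' - (Z i j' * b - b * Z i j') * Z r j
        + b * ((Z i j * Z r j' - Z i j' * Z r j) - (Z r j' * Z i j - Z r j * Z i j'))"
        by (simp add: algebra_simps)
      also have "\<dots> \<in> J"
        using diag[OF i j] diag[OF 2(2) ir(2) j] 2
        by (intro J_add J_diff[OF J_add] J_left J_right b1' iN j jN ir) simp_all
      finally show ?thesis using 2 ir by (simp add: row_op_def)
    next
      case 3
      have ir: "i' \<noteq> r" "r < i'" "i' \<noteq> Suc r" using 3 i by simp_all
      have "((Z (Suc r) j + b * Z r j) * Z i' j' - (Z (Suc r) j' + b * Z r j') * Z i' j) -
          (Z i' j' * (Z (Suc r) j + b * Z r j) - Z i' j * (Z (Suc r) j' + b * Z r j')) =
        ((Z (Suc r) j * Z i' j' - Z (Suc r) j' * Z i' j) - (Z i' j' * Z (Suc r) j - Z i' j * Z (Suc r) j'))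
        - (Z i' j' * b - b * Z i' j') * Z r j + (Z i' j * b - b * Z i' j) * Z r j'
        + b * ((Z r j * Z i' j' - Z r j' * Z i' j) - (Z i' j' * Z r j - Z i' j * Z r j'))"
        by (simp add: algebra_simps)
      also have "\<dots> \<in> J"
        using diag[OF i j] diag[OF ir(2) i(2) j] 3
        by (intro J_add[OF J_add[OF J_diff]] J_left J_right b1' i j jN ir) simp_all
      finally show ?thesis using 3 ir by (simp add: row_op_def)
    next
      case 4
      then show ?thesis using diag[OF i j] by (simp add: row_op_def)
    qed
  qed
  show ?thesis
    unfolding glq_def by (intro conjI allI impI row' cross diag' order_refl less_imp_le)
qed

text \<open>
  The conditions between two steps say that the multiplier \<open>a'\<close> of the later step still has the
  required relations with the column that the earlier step has modified.
\<close>

theorem glq_fold_cols: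
  assumes "glq N Z"
    and "\<forall>(c, a)\<in>set cs. Suc c < N \<and> (\<forall>i<N. \<forall>j<N. qcomm (if j = Suc c then Q else 1) a (Z i j))"
    and "sorted_wrt (\<lambda>(c, a) (c', a'). qcomm (if c = c' then Q else if c = Suc c' then 1 / Q else 1) a' a) cs"
  shows "glq N (fold_cols cs Z)"
  using assms
proof (induction cs arbitrary: Z)
  case Nil
  then show ?case by simp
next
  case (Cons p cs)
  obtain c a where p: "p = (c, a)" by fastforce
  have c: "Suc c < N" and a: "\<And>i j. i < N \<Longrightarrow> j < N \<Longrightarrow> qcomm (if j = Suc c then Q else 1) a (Z i j)"
    using Cons.prems(2) unfolding p by auto
  have "glq N (fold_cols cs (col_op c a Z))"
  proof (rule Cons.IH)
    show "glq N (col_op c a Z)" by (rule glq_col_op[OF Cons.prems(1) c a])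
    show "sorted_wrt (\<lambda>(c, a) (c', a'). qcomm (if c = c' then Q else if c = Suc c' then 1 / Q else 1) a' a) cs"
      using Cons.prems(3) by simp
    have new: "qcomm (if j = Suc c' then Q else 1) a' (col_op c a Z i j)"
      if mem: "(c', a') \<in> set cs" and ij: "i < N" "j < N" for c' a' i j
    proof -
      have old: "qcomm (if l = Suc c' then Q else 1) a' (Z i l)" if "l < N" for l
        using bspec[OF Cons.prems(2), of "(c', a')"] mem ij that by simp
      have aa: "qcomm (if c = c' then Q else if c = Suc c' then 1 / Q else 1) a' a"
      proof -
        have "\<forall>y\<in>set cs. (\<lambda>(c, a) (c', a'). qcomm (if c = c' then Q else if c = Suc c' then 1 / Q else 1) a' a) p y"
          using Cons.prems(3) by simp
        from bspec[OF this mem] show ?thesis by (simp only: p prod.case)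
      qed
      have "qcomm (if c = c' then Q else 1) a' (Z i (Suc c) + Z i c * a)"
        using old[OF c] Q_nonzero
        by (intro qcomm_add_right qcomm_mult_right[OF old[of c] aa]) (use c in auto)
      then show ?thesis using old[OF ij(2)] by (simp add: col_op_def)
    qed
    show "\<forall>(c', a')\<in>set cs. Suc c' < N \<and>
        (\<forall>i<N. \<forall>j<N. qcomm (if j = Suc c' then Q else 1) a' (col_op c a Z i j))"
    proof (intro ballI)
      fix y assume y: "y \<in> set cs"
      obtain c' a' where ca: "y = (c', a')" by fastforce
      show "case y of (c', a') \<Rightarrow> Suc c' < N \<and> (\<forall>i<N. \<forall>j<N. qcomm (if j = Suc c' then Q else 1) a' (col_op c a Z i j))"
        using bspec[OF Cons.prems(2), of y] y new[of c' a'] unfolding ca by simp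
    qed
  qed
  then show ?case by (simp add: p)
qed

theorem glq_fold_rows:
  assumes "glq N Z"
    and "\<forall>(r, b)\<in>set rs. Suc r < N \<and> (\<forall>i<N. \<forall>j<N. qcomm (if i = r then Q else 1) (Z i j) b)"
    and "sorted_wrt (\<lambda>(r, b) (r', b'). qcomm (if r' = Suc r then Q else if r' = r then 1 / Q else 1) b b') rs"
  shows "glq N (fold_rows rs Z)"
  using assms
proof (induction rs arbitrary: Z)
  case Nil
  then show ?case by simp
next
  case (Cons p rs)
  obtain r b where p: "p = (r, b)" by fastforce
  have r: "Suc r < N" and b: "\<And>i j. i < N \<Longrightarrow> j < N \<Longrightarrow> qcomm (if i = r then Q else 1) (Z i j) b"
    using Cons.prems(2) unfolding p by auto
  have "glq N (fold_rows rs (row_op r b Z))"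
  proof (rule Cons.IH)
    show "glq N (row_op r b Z)" by (rule glq_row_op[OF Cons.prems(1) r b])
    show "sorted_wrt (\<lambda>(r, b) (r', b'). qcomm (if r' = Suc r then Q else if r' = r then 1 / Q else 1) b b') rs"
      using Cons.prems(3) by simp
    have new: "qcomm (if i = r' then Q else 1) (row_op r b Z i j) b'"
      if mem: "(r', b') \<in> set rs" and ij: "i < N" "j < N" for r' b' i j
    proof -
      have old: "qcomm (if l = r' then Q else 1) (Z l j) b'" if "l < N" for l
        using bspec[OF Cons.prems(2), of "(r', b')"] mem ij that by simp
      have bb: "qcomm (if r' = Suc r then Q else if r' = r then 1 / Q else 1) b b'"
      proof -
        have "\<forall>y\<in>set rs. (\<lambda>(r, b) (r', b'). qcomm (if r' = Suc r then Q else if r' = r then 1 / Q else 1) b b') p y"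
          using Cons.prems(3) by simp
        from bspec[OF this mem] show ?thesis by (simp only: p prod.case)
      qed
      have "qcomm (if Suc r = r' then Q else 1) (Z (Suc r) j + b * Z r j) b'"
        using old[OF r] Q_nonzero
        by (intro qcomm_add_left qcomm_mult_left[OF bb old[of r]]) (use r in auto)
      then show ?thesis using old[OF ij(1)] by (simp add: row_op_def)
    qed
    show "\<forall>(r', b')\<in>set rs. Suc r' < N \<and>
        (\<forall>i<N. \<forall>j<N. qcomm (if i = r' then Q else 1) (row_op r b Z i j) b')"
    proof (intro ballI)
      fix y assume y: "y \<in> set rs"
      obtain r' b' where ca: "y = (r', b')" by fastforce
      show "case y of (r', b') \<Rightarrow> Suc r' < N \<and> (\<forall>i<N. \<forall>j<N. qcomm (if i = r' then Q else 1) (row_op r b Z i j) b')"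
        using bspec[OF Cons.prems(2), of y] y new[of r' b'] unfolding ca by simp
    qed
  qed
  then show ?case by (simp add: p)
qed

lemma qcomm_fold_cols:
  assumes "\<forall>i j. i < N \<longrightarrow> j < N \<longrightarrow> qcomm (f i) (Z i j) b" "\<forall>(c, a)\<in>set cs. Suc c < N \<and> qcomm 1 a b"
    and "i < N" "j < N"
  shows "qcomm (f i) (fold_cols cs Z i j) b"
  using assms
proof (induction cs arbitrary: Z)
  case Nil
  then show ?case by simp
next
  case (Cons p cs)
  obtain c a where p: "p = (c, a)" by fastforce
  have c: "Suc c < N" and a: "qcomm 1 a b" using Cons.prems(2) unfolding p by auto
  have "qcomm (f i) (col_op c a Z i j) b" if "i < N" "j < N" for i j
  proof -
    have "qcomm (f i) (Z i (Suc c) + Z i c * a) b"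
      using Cons.prems(1) c that a by (intro qcomm_add_left qcomm_mult_left[where c = "f i" and d = 1]) auto
    then show ?thesis using Cons.prems(1) that by (simp add: col_op_def)
  qed
  then show ?case
    using Cons.IH[of "col_op c a Z"] Cons.prems(2-) by (simp add: p)
qed

end

section \<open>The Gauss--Lusztig factors as sequences of operations\<close>

abbreviation mat_fun :: "nat \<Rightarrow> (nat \<Rightarrow> nat \<Rightarrow> 'r) \<Rightarrow> 'r mat" where
  "mat_fun N Z \<equiv> mat N N (\<lambda>(i, j). Z i j)"

text \<open>
  In descending order every operation adds a multiple of a column that has not yet been changed, so
  that the effect is that of one bidiagonal matrix.
\<close>

lemma fold_cols_descending:
  assumes "1 \<le> k"
  shows "fold_cols (map (\<lambda>m. (m - 1, a m)) (rev [k..<N])) Z i j =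
    (if k \<le> j \<and> j < N then Z i j + Z i (j - 1) * a j else Z i j)"
  using assms
proof (induction "N - k" arbitrary: k i j)
  case 0
  then show ?case by auto
next
  case (Suc n)
  then have k: "k < N" "n = N - Suc k" "1 \<le> Suc k" by simp_all
  have IH: "fold_cols (map (\<lambda>m. (m - 1, a m)) (rev [Suc k..<N])) Z i j =
      (if Suc k \<le> j \<and> j < N then Z i j + Z i (j - 1) * a j else Z i j)" for i j
    by (rule Suc.hyps(1)[OF k(2,3)])
  define F where "F = fold_cols (map (\<lambda>m. (m - 1, a m)) (rev [Suc k..<N])) Z"
  have step: "fold_cols (map (\<lambda>m. (m - 1, a m)) (rev [k..<N])) Z = col_op (k - 1) (a k) F"
    using k(1) by (simp add: upt_conv_Cons F_def)
  show ?case
    unfolding step using Suc.prems k(1) by (auto simp: col_op_def IH[folded F_def])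
qed

lemma fold_rows_descending:
  assumes "1 \<le> k"
  shows "fold_rows (map (\<lambda>m. (m - 1, b m)) (rev [k..<N])) Z i j =
    (if k \<le> i \<and> i < N then Z i j + b i * Z (i - 1) j else Z i j)"
  using assms
proof (induction "N - k" arbitrary: k i j)
  case 0
  then show ?case by auto
next
  case (Suc n)
  then have k: "k < N" "n = N - Suc k" "1 \<le> Suc k" by simp_all
  have IH: "fold_rows (map (\<lambda>m. (m - 1, b m)) (rev [Suc k..<N])) Z i j =
      (if Suc k \<le> i \<and> i < N then Z i j + b i * Z (i - 1) j else Z i j)" for i j
    by (rule Suc.hyps(1)[OF k(2,3)])
  define F where "F = fold_rows (map (\<lambda>m. (m - 1, b m)) (rev [Suc k..<N])) Z"
  have step: "fold_rows (map (\<lambda>m. (m - 1, b m)) (rev [k..<N])) Z = row_op (k - 1) (b k) F"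
    using k(1) by (simp add: upt_conv_Cons F_def)
  show ?case
    unfolding step using Suc.prems k(1) by (auto simp: row_op_def IH[folded F_def])
qed

definition a_step :: "nat \<times> nat \<Rightarrow> nat \<times> ncpoly" where
  "a_step = (\<lambda>(m, s). (m - 1, nc_var (A_var m s)))"

text \<open>
  A step of \<open>U\<^sup>-\<close>, too, is labelled by the index \<open>s\<close> of the factor \<open>B\<^sub>s\<close> to which it belongs, and not by
  the second index of the variable \<open>b\<^bsub>m,n\<^esub>\<close>, which is \<open>n = m + s - (N - 1)\<close>.
\<close>

definition b_step :: "nat \<Rightarrow> nat \<times> nat \<Rightarrow> nat \<times> ncpoly" where
  "b_step N = (\<lambda>(m, s). (m - 1, nc_var (B_var m (m + s - (N - 1)))))"

definition a_factor_steps :: "nat \<Rightarrow> nat \<Rightarrow> (nat \<times> nat) list" where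
  "a_factor_steps N s = map (\<lambda>m. (m, s)) (rev [s..<N])"

definition b_factor_steps :: "nat \<Rightarrow> nat \<Rightarrow> (nat \<times> nat) list" where
  "b_factor_steps N s = map (\<lambda>m. (m, s)) (rev [N - s..<N])"

lemma mult_A_factor:
  assumes "1 \<le> s"
  shows "mat_fun N Z * A_factor N s = mat_fun N (fold_cols (map a_step (a_factor_steps N s)) Z)"
proof (rule eq_matI)
  fix i j assume "i < dim_row (mat_fun N (fold_cols (map a_step (a_factor_steps N s)) Z))"
    "j < dim_col (mat_fun N (fold_cols (map a_step (a_factor_steps N s)) Z))"
  then have ij: "i < N" "j < N" by simp_all
  have "(mat_fun N Z * A_factor N s) $$ (i, j) = (\<Sum>k\<in>{0..<N}. Z i k * A_factor N s $$ (k, j))"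
    using ij by (simp add: A_factor_def scalar_prod_def)
  also have "\<dots> = (\<Sum>k\<in>{0..<N}. (if k = j then Z i k else 0) +
      (if k = j - 1 then (if s \<le> j then Z i k * nc_var (A_var j s) else 0) else 0))"
  proof (intro sum.cong refl)
    fix k assume "k \<in> {0..<N}"
    then show "Z i k * A_factor N s $$ (k, j) = (if k = j then Z i k else 0) +
      (if k = j - 1 then (if s \<le> j then Z i k * nc_var (A_var j s) else 0) else 0)"
      using ij assms by (auto simp: A_factor_def)
  qed
  also have "\<dots> = Z i j + (if s \<le> j then Z i (j - 1) * nc_var (A_var j s) else 0)"
    using ij less_imp_diff_less[OF ij(2), of 1] by (simp add: sum.distrib)
  also have "\<dots> = fold_cols (map a_step (a_factor_steps N s)) Z i j"
    using fold_cols_descending[OF assms, where a = "\<lambda>m. nc_var (A_var m s)"] ij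
    by (simp add: a_factor_steps_def a_step_def comp_def)
  finally show "(mat_fun N Z * A_factor N s) $$ (i, j) = mat_fun N (fold_cols (map a_step (a_factor_steps N s)) Z) $$ (i, j)"
    using ij by simp
qed (simp_all add: A_factor_def)

lemma mult_B_factor:
  assumes "1 \<le> s" "s < N"
  shows "B_factor N s * mat_fun N Z = mat_fun N (fold_rows (map (b_step N) (b_factor_steps N s)) Z)"
proof (rule eq_matI)
  let ?b = "\<lambda>i. nc_var (B_var i (i + s - (N - 1)))"
  fix i j assume "i < dim_row (mat_fun N (fold_rows (map (b_step N) (b_factor_steps N s)) Z))"
    "j < dim_col (mat_fun N (fold_rows (map (b_step N) (b_factor_steps N s)) Z))"
  then have ij: "i < N" "j < N" by simp_all
  have s: "1 \<le> N - s" using assms by simp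
  have "(B_factor N s * mat_fun N Z) $$ (i, j) = (\<Sum>k\<in>{0..<N}. B_factor N s $$ (i, k) * Z k j)"
    using ij by (simp add: B_factor_def scalar_prod_def)
  also have "\<dots> = (\<Sum>k\<in>{0..<N}. (if k = i then Z k j else 0) +
      (if k = i - 1 then (if N - s \<le> i then ?b i * Z k j else 0) else 0))"
  proof (intro sum.cong refl)
    fix k assume "k \<in> {0..<N}"
    then show "B_factor N s $$ (i, k) * Z k j = (if k = i then Z k j else 0) +
      (if k = i - 1 then (if N - s \<le> i then ?b i * Z k j else 0) else 0)"
      using ij s by (auto simp: B_factor_def)
  qed
  also have "\<dots> = Z i j + (if N - s \<le> i then ?b i * Z (i - 1) j else 0)"
    using ij less_imp_diff_less[OF ij(1), of 1] by (simp add: sum.distrib)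
  also have "\<dots> = fold_rows (map (b_step N) (b_factor_steps N s)) Z i j"
    using fold_rows_descending[OF s, where b = ?b] ij
    by (simp add: b_factor_steps_def b_step_def comp_def)
  finally show "(B_factor N s * mat_fun N Z) $$ (i, j) = mat_fun N (fold_rows (map (b_step N) (b_factor_steps N s)) Z) $$ (i, j)"
    using ij by simp
qed (simp_all add: B_factor_def)

lemma factor_carrier:
  "A_factor N s \<in> carrier_mat N N" "B_factor N s \<in> carrier_mat N N"
  by (simp_all add: A_factor_def B_factor_def)

lemma foldr_mult_carrier:
  "(\<And>s. F s \<in> carrier_mat N N) \<Longrightarrow> foldr (*) (map F ss) (1\<^sub>m N) \<in> carrier_mat N N"
  by (induction ss) (simp_all add: mult_carrier_mat[of _ N N _ N])

definition a_steps :: "nat \<Rightarrow> (nat \<times> nat) list" where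
  "a_steps N = concat (map (a_factor_steps N) [1..<N])"

text \<open>
  Multiplication from the left by \<open>B\<^sub>1 \<cdots> B\<^bsub>N-1\<^esub>\<close> begins with \<open>B\<^bsub>N-1\<^esub>\<close>.
\<close>

definition b_steps :: "nat \<Rightarrow> (nat \<times> nat) list" where
  "b_steps N = concat (map (b_factor_steps N) (rev [1..<N]))"

lemma mult_U_plus: "mat_fun N Z * U_plus N = mat_fun N (fold_cols (map a_step (a_steps N)) Z)"
proof -
  have "mat_fun N Z * foldr (*) (map (A_factor N) ss) (1\<^sub>m N) =
      mat_fun N (fold_cols (map a_step (concat (map (a_factor_steps N) ss))) Z)"
    if "\<forall>s\<in>set ss. 1 \<le> s" for ss
    using that
  proof (induction ss arbitrary: Z)
    case Nil
    then show ?case by (simp add: right_mult_one_mat[of _ N N])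
  next
    case (Cons s ss)
    have "mat_fun N Z * (A_factor N s * foldr (*) (map (A_factor N) ss) (1\<^sub>m N)) =
        mat_fun N Z * A_factor N s * foldr (*) (map (A_factor N) ss) (1\<^sub>m N)"
      by (rule assoc_mult_mat[symmetric, OF mat_carrier factor_carrier(1) foldr_mult_carrier[OF factor_carrier(1)]])
    then show ?case
      using Cons by (simp add: mult_A_factor)
  qed
  then show ?thesis by (simp add: U_plus_def a_steps_def)
qed

lemma mult_U_minus: "U_minus N * mat_fun N Z = mat_fun N (fold_rows (map (b_step N) (b_steps N)) Z)"
proof -
  have "foldr (*) (map (B_factor N) ss) (1\<^sub>m N) * mat_fun N Z =
      mat_fun N (fold_rows (map (b_step N) (concat (map (b_factor_steps N) (rev ss)))) Z)"
    if "\<forall>s\<in>set ss. 1 \<le> s \<and> s < N" for ss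
    using that
  proof (induction ss)
    case Nil
    then show ?case by (simp add: left_mult_one_mat[of _ N N])
  next
    case (Cons s ss)
    have "B_factor N s * foldr (*) (map (B_factor N) ss) (1\<^sub>m N) * mat_fun N Z =
        B_factor N s * (foldr (*) (map (B_factor N) ss) (1\<^sub>m N) * mat_fun N Z)"
      by (rule assoc_mult_mat[OF factor_carrier(2) foldr_mult_carrier[OF factor_carrier(2)] mat_carrier])
    then show ?case
      using Cons by (simp add: mult_B_factor)
  qed
  then show ?thesis by (simp add: U_minus_def b_steps_def)
qed

definition T_fun :: "nat \<Rightarrow> nat \<Rightarrow> ncpoly" where
  "T_fun i j = (if i = j then nc_var (U_var (i + 1)) else 0)"

lemma T_diag_eq: "T_diag N = mat_fun N T_fun"
  by (simp add: T_diag_def T_fun_def)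

lemma TU_eq: "T_diag N * U_plus N = mat_fun N (fold_cols (map a_step (a_steps N)) T_fun)"
  unfolding T_diag_eq by (rule mult_U_plus)

lemma UT_eq: "U_minus N * T_diag N = mat_fun N (fold_rows (map (b_step N) (b_steps N)) T_fun)"
  unfolding T_diag_eq by (rule mult_U_minus)

lemma Z_matrix_eq: "Z_matrix N =
    mat_fun N (fold_rows (map (b_step N) (b_steps N)) (fold_cols (map a_step (a_steps N)) T_fun))"
proof -
  have "U_minus N \<in> carrier_mat N N" "U_plus N \<in> carrier_mat N N"
    unfolding U_minus_def U_plus_def by (intro foldr_mult_carrier factor_carrier)+
  then have "Z_matrix N = U_minus N * (T_diag N * U_plus N)"
    unfolding Z_matrix_def T_diag_eq by (rule assoc_mult_mat[OF _ mat_carrier])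
  then show ?thesis by (simp add: TU_eq mult_U_minus)
qed

lemma set_a_steps: "(m, s) \<in> set (a_steps N) \<Longrightarrow> 1 \<le> s \<and> s \<le> m \<and> m < N"
  by (auto simp: a_steps_def a_factor_steps_def)

lemma set_b_steps: "(m, s) \<in> set (b_steps N) \<Longrightarrow> 1 \<le> s \<and> s < N \<and> N \<le> m + s \<and> m < N"
  by (auto simp: b_steps_def b_factor_steps_def)

lemma sorted_wrt_concat_map:
  assumes "sorted_wrt lt xs" "\<And>x. sorted_wrt R (g x)"
    and "\<And>x y p q. lt x y \<Longrightarrow> p \<in> set (g x) \<Longrightarrow> q \<in> set (g y) \<Longrightarrow> R p q"
  shows "sorted_wrt R (concat (map g xs))"
  using assms(1) by (induction xs) (auto simp: sorted_wrt_append assms(2) intro: assms(3))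

lemma sorted_wrt_rev_upt: "sorted_wrt (>) (rev [k..<n::nat])"
  by (simp add: sorted_wrt_rev)

lemma sorted_a_steps:
  "sorted_wrt (\<lambda>(m, s) (m', s'). s < s' \<or> s = s' \<and> m' < m) (a_steps N)"
  unfolding a_steps_def
proof (rule sorted_wrt_concat_map[OF sorted_wrt_upt])
  show "sorted_wrt (\<lambda>(m, s) (m', s'). s < s' \<or> s = s' \<and> m' < m) (a_factor_steps N s)" for s
    unfolding a_factor_steps_def sorted_wrt_map using sorted_wrt_rev_upt by simp
qed (auto simp: a_factor_steps_def)

lemma sorted_b_steps:
  "sorted_wrt (\<lambda>(m, s) (m', s'). s' < s \<or> s = s' \<and> m' < m) (b_steps N)"
  unfolding b_steps_def
proof (rule sorted_wrt_concat_map[OF sorted_wrt_rev_upt])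
  show "sorted_wrt (\<lambda>(m, s) (m', s'). s' < s \<or> s = s' \<and> m' < m) (b_factor_steps N s)" for s
    unfolding b_factor_steps_def sorted_wrt_map using sorted_wrt_rev_upt by simp
qed (auto simp: b_factor_steps_def)


section \<open>The commutation relations of the variables\<close>

text \<open>
  The relation between \<open>v\<close> and \<open>w\<close> is \<open>v w = q\<^bsup>2 e\<^esup> w v\<close> with \<open>e = comm_exp v w\<close>.  It is read off from the
  conditions under which column and row operations preserve \<open>GL\<^sub>q(N)\<close> matrices.  The test in the first
  equation is that \<open>a\<^bsub>m',s'\<^esub>\<close> belongs to a later column operation than \<open>a\<^bsub>m,s\<^esub>\<close>, the test in the fourth one
  that \<open>b\<^bsub>m,n\<^esub>\<close> belongs to an earlier row operation than \<open>b\<^bsub>m',n'\<^esub>\<close>.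
\<close>

fun half_exp :: "var \<Rightarrow> var \<Rightarrow> int" where
  "half_exp (A_var m' s') (A_var m s) =
     (if s < s' \<or> s = s' \<and> m' < m then of_bool (m = m') - of_bool (m = m' + 1) else 0)"
| "half_exp (A_var m n) (U_var k) = of_bool (k = m + 1)"
| "half_exp (U_var k) (B_var m n) = of_bool (k = m)"
| "half_exp (B_var m n) (B_var m' n') =
     (if n' + m < n + m' \<or> n' + m = n + m' \<and> m' < m then of_bool (m' = m + 1) - of_bool (m = m') else 0)"
| "half_exp _ _ = 0"

definition comm_exp :: "var \<Rightarrow> var \<Rightarrow> int" where
  "comm_exp v w = half_exp v w - half_exp w v"

lemma comm_exp_range: "comm_exp v w \<in> {-1, 0, 1}"
  by (cases v; cases w) (auto simp: comm_exp_def of_bool_def)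

lemma comm_exp_a_b: "v \<in> a_vars N \<Longrightarrow> w \<in> b_vars N \<Longrightarrow> comm_exp v w = 0"
  by (auto simp: comm_exp_def a_vars_def b_vars_def)

locale torus_ideal = scalar_ideal J nc_scalar Q for J :: "ncpoly set" and Q :: complex +
  fixes V :: "var set"
  assumes relation: "v \<in> V \<Longrightarrow> w \<in> V \<Longrightarrow> qcomm (Q powi comm_exp v w) (nc_var v) (nc_var w)"
begin

lemma glq_T:
  assumes "U_vars N \<subseteq> V" shows "glq N T_fun"
proof -
  have U: "nc_var (U_var (i + 1)) * nc_var (U_var (j + 1)) - nc_var (U_var (j + 1)) * nc_var (U_var (i + 1)) \<in> J"
    if "i < N" "j < N" for i j
  proof -
    have "U_var (i + 1) \<in> V" "U_var (j + 1) \<in> V"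
      using assms that unfolding U_vars_def by auto
    then show ?thesis
      using relation[of "U_var (i + 1)" "U_var (j + 1)"] by (simp add: comm_exp_def qcomm_one)
  qed
  show ?thesis
    unfolding glq_def T_fun_def
  proof (intro conjI allI impI)
    fix i i' j j' assume "i' < N" "i < i'" "j' < N" "j < j'"
    then show "(if i = j then nc_var (U_var (i + 1)) else 0) * (if i' = j' then nc_var (U_var (i' + 1)) else 0) -
        (if i = j' then nc_var (U_var (i + 1)) else 0) * (if i' = j then nc_var (U_var (i' + 1)) else 0) -
        ((if i' = j' then nc_var (U_var (i' + 1)) else 0) * (if i = j then nc_var (U_var (i + 1)) else 0) -
         (if i' = j then nc_var (U_var (i' + 1)) else 0) * (if i = j' then nc_var (U_var (i + 1)) else 0)) \<in> J"
      using U[of i i'] by (auto simp: J_zero)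
  qed (auto simp: qcomm_zero_left qcomm_zero_right)
qed

lemma glq_upper:
  assumes V: "U_vars N \<subseteq> V" "a_vars N \<subseteq> V"
  shows "glq N (fold_cols (map a_step (a_steps N)) T_fun)"
proof (rule glq_fold_cols[OF glq_T[OF V(1)]])
  have aV: "A_var m s \<in> V" if "(m, s) \<in> set (a_steps N)" for m s
    using set_a_steps[OF that] V(2) unfolding a_vars_def by force
  show "\<forall>(c, a)\<in>set (map a_step (a_steps N)). Suc c < N \<and>
      (\<forall>i<N. \<forall>j<N. qcomm (if j = Suc c then Q else 1) a (T_fun i j))"
  proof (intro ballI)
    fix p assume "p \<in> set (map a_step (a_steps N))"
    then obtain m s where mem: "(m, s) \<in> set (a_steps N)" and p: "p = a_step (m, s)" by auto
    obtain c a where step: "(c, a) = a_step (m, s)" by (metis surj_pair)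
    have ca: "c = m - 1" "a = nc_var (A_var m s)" using step by (simp_all add: a_step_def)
    have m: "1 \<le> m" "m < N" using set_a_steps[OF mem] by simp_all
    have "qcomm (if j = Suc c then Q else 1) a (T_fun i j)" if "i < N" "j < N" for i j
    proof (cases "i = j")
      case True
      have "U_var (j + 1) \<in> V" using V(1) that unfolding U_vars_def by auto
      then have "qcomm (Q powi comm_exp (A_var m s) (U_var (j + 1))) a (T_fun i j)"
        using relation[OF aV[OF mem]] True by (simp add: T_fun_def ca)
      moreover have "Q powi comm_exp (A_var m s) (U_var (j + 1)) = (if j = Suc c then Q else 1)"
        using m by (auto simp: comm_exp_def ca)
      ultimately show ?thesis by simp
    qed (simp add: T_fun_def qcomm_zero_right)
    then have "Suc c < N \<and> (\<forall>i<N. \<forall>j<N. qcomm (if j = Suc c then Q else 1) a (T_fun i j))"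
      using m ca(1) by simp
    then show "case p of (c, a) \<Rightarrow> Suc c < N \<and> (\<forall>i<N. \<forall>j<N. qcomm (if j = Suc c then Q else 1) a (T_fun i j))"
      unfolding p step[symmetric] prod.case .
  qed
  show "sorted_wrt (\<lambda>(c, a) (c', a'). qcomm (if c = c' then Q else if c = Suc c' then 1 / Q else 1) a' a)
      (map a_step (a_steps N))"
    unfolding sorted_wrt_map
  proof (rule sorted_wrt_mono_rel[OF _ sorted_a_steps])
    fix x y assume xy: "x \<in> set (a_steps N)" "y \<in> set (a_steps N)"
      and lt: "(\<lambda>(m, s) (m', s'). s < s' \<or> s = s' \<and> m' < m) x y"
    obtain m s where x: "x = (m, s)" by fastforce
    obtain m' s' where y: "y = (m', s')" by fastforce
    have mem: "(m, s) \<in> set (a_steps N)" "(m', s') \<in> set (a_steps N)"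
      and later: "s < s' \<or> s = s' \<and> m' < m"
      using xy lt by (simp_all add: x y)
    obtain c a c' a' where step: "a_step (m, s) = (c, a)" "a_step (m', s') = (c', a')"
      by (metis surj_pair)
    have ca: "c = m - 1" "a = nc_var (A_var m s)" "c' = m' - 1" "a' = nc_var (A_var m' s')"
      using step by (simp_all add: a_step_def)
    have m: "1 \<le> m" "1 \<le> m'" using set_a_steps[OF mem(1)] set_a_steps[OF mem(2)] by simp_all
    have "qcomm (Q powi comm_exp (A_var m' s') (A_var m s)) a' a"
      unfolding ca by (rule relation[OF aV[OF mem(2)] aV[OF mem(1)]])
    moreover have "Q powi comm_exp (A_var m' s') (A_var m s) = (if c = c' then Q else if c = Suc c' then 1 / Q else 1)"
    proof -
      have "\<not> (s' < s \<or> s' = s \<and> m < m')"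
        using later by linarith
      then have "comm_exp (A_var m' s') (A_var m s) = of_bool (m = m') - of_bool (m = m' + 1)"
        unfolding comm_exp_def half_exp.simps by (simp only: if_P[OF later] if_not_P if_False diff_zero)
      moreover have "(m = m') = (c = c')" "(m = m' + 1) = (c = Suc c')"
        using m(1,2) unfolding ca by linarith+
      ultimately show ?thesis
        by (cases "c = c'"; cases "c = Suc c'") (simp_all add: power_int_minus inverse_eq_divide)
    qed
    ultimately have "qcomm (if c = c' then Q else if c = Suc c' then 1 / Q else 1) a' a" by (simp only:)
    then show "(\<lambda>(c, a) (c', a'). qcomm (if c = c' then Q else if c = Suc c' then 1 / Q else 1) a' a) (a_step x) (a_step y)"
      by (simp only: x y step prod.case)
  qed
qed

lemma glq_lower:
  assumes V: "b_vars N \<subseteq> V" and Z: "glq N Z"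
    and rows: "\<And>m n i j. B_var m n \<in> V \<Longrightarrow> i < N \<Longrightarrow> j < N \<Longrightarrow>
      qcomm (if i + 1 = m then Q else 1) (Z i j) (nc_var (B_var m n))"
  shows "glq N (fold_rows (map (b_step N) (b_steps N)) Z)"
proof (rule glq_fold_rows[OF Z])
  have bV: "B_var m (m + s - (N - 1)) \<in> V" if "(m, s) \<in> set (b_steps N)" for m s
  proof -
    have "1 \<le> m + s - (N - 1) \<and> m + s - (N - 1) \<le> m \<and> m \<le> N - 1"
      using set_b_steps[OF that] by linarith
    then show ?thesis using V unfolding b_vars_def by blast
  qed
  show "\<forall>(r, b)\<in>set (map (b_step N) (b_steps N)). Suc r < N \<and>
      (\<forall>i<N. \<forall>j<N. qcomm (if i = r then Q else 1) (Z i j) b)"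
  proof (intro ballI)
    fix p assume "p \<in> set (map (b_step N) (b_steps N))"
    then obtain m s where mem: "(m, s) \<in> set (b_steps N)" and p: "p = b_step N (m, s)" by auto
    obtain r b where step: "(r, b) = b_step N (m, s)" by (metis surj_pair)
    have rb: "r = m - 1" "b = nc_var (B_var m (m + s - (N - 1)))" using step by (simp_all add: b_step_def)
    have m: "1 \<le> m" "m < N" using set_b_steps[OF mem] by linarith+
    have "qcomm (if i = r then Q else 1) (Z i j) b" if "i < N" "j < N" for i j
    proof -
      have "(if i = r then Q else 1) = (if i + 1 = m then Q else 1)" using m by (auto simp: rb)
      then show ?thesis using rows[OF bV[OF mem] that] by (simp only: rb)
    qed
    then have "Suc r < N \<and> (\<forall>i<N. \<forall>j<N. qcomm (if i = r then Q else 1) (Z i j) b)"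
      using m rb(1) by simp
    then show "case p of (r, b) \<Rightarrow> Suc r < N \<and> (\<forall>i<N. \<forall>j<N. qcomm (if i = r then Q else 1) (Z i j) b)"
      unfolding p step[symmetric] prod.case .
  qed
  show "sorted_wrt (\<lambda>(r, b) (r', b'). qcomm (if r' = Suc r then Q else if r' = r then 1 / Q else 1) b b')
      (map (b_step N) (b_steps N))"
    unfolding sorted_wrt_map
  proof (rule sorted_wrt_mono_rel[OF _ sorted_b_steps])
    fix x y assume xy: "x \<in> set (b_steps N)" "y \<in> set (b_steps N)"
      and lt: "(\<lambda>(m, s) (m', s'). s' < s \<or> s = s' \<and> m' < m) x y"
    obtain m s where x: "x = (m, s)" by fastforce
    obtain m' s' where y: "y = (m', s')" by fastforce
    have mem: "(m, s) \<in> set (b_steps N)" "(m', s') \<in> set (b_steps N)"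
      and later: "s' < s \<or> s = s' \<and> m' < m"
      using xy lt by (simp_all add: x y)
    obtain r b r' b' where step: "b_step N (m, s) = (r, b)" "b_step N (m', s') = (r', b')"
      by (metis surj_pair)
    define n where "n = m + s - (N - 1)"
    define n' where "n' = m' + s' - (N - 1)"
    have rb: "r = m - 1" "b = nc_var (B_var m n)" "r' = m' - 1" "b' = nc_var (B_var m' n')"
      using step by (simp_all add: b_step_def n_def n'_def)
    have m: "1 \<le> m" "1 \<le> m'" "N - 1 \<le> m + s" "N - 1 \<le> m' + s'"
      using set_b_steps[OF mem(1)] set_b_steps[OF mem(2)] by linarith+
    \<comment> \<open>the order of the factors \<open>B\<^sub>s\<close> in terms of the indices of the variables, as \<open>s = n - m + N - 1\<close>\<close>
    have later': "n' + m < n + m' \<or> n' + m = n + m' \<and> m' < m"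
      using later m(3,4) unfolding n_def n'_def by linarith
    have "qcomm (Q powi comm_exp (B_var m n) (B_var m' n')) b b'"
      unfolding rb using relation[OF bV[OF mem(1)] bV[OF mem(2)]] by (simp add: n_def n'_def)
    moreover have "Q powi comm_exp (B_var m n) (B_var m' n') = (if r' = Suc r then Q else if r' = r then 1 / Q else 1)"
    proof -
      have "\<not> (n + m' < n' + m \<or> n + m' = n' + m \<and> m < m')"
        using later' by linarith
      then have "comm_exp (B_var m n) (B_var m' n') = of_bool (m' = m + 1) - of_bool (m = m')"
        unfolding comm_exp_def half_exp.simps by (simp only: if_P[OF later'] if_not_P if_False diff_zero)
      moreover have "(m' = m + 1) = (r' = Suc r)" "(m = m') = (r' = r)"
        using m(1,2) unfolding rb by linarith+
      ultimately show ?thesis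
        by (cases "r' = Suc r"; cases "r' = r") (simp_all add: power_int_minus inverse_eq_divide)
    qed
    ultimately have "qcomm (if r' = Suc r then Q else if r' = r then 1 / Q else 1) b b'" by (simp only:)
    then show "(\<lambda>(r, b) (r', b'). qcomm (if r' = Suc r then Q else if r' = r then 1 / Q else 1) b b') (b_step N x) (b_step N y)"
      by (simp only: x y step prod.case)
  qed
qed

lemma T_row_relation:
  assumes "U_vars N \<subseteq> V" "B_var m n \<in> V" "i < N" "j < N"
  shows "qcomm (if i + 1 = m then Q else 1) (T_fun i j) (nc_var (B_var m n))"
proof (cases "i = j")
  case True
  have "U_var (i + 1) \<in> V" using assms(1,3) unfolding U_vars_def by auto
  then have "qcomm (Q powi comm_exp (U_var (i + 1)) (B_var m n)) (T_fun i j) (nc_var (B_var m n))"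
    using relation[OF _ assms(2)] True by (simp add: T_fun_def)
  moreover have "Q powi comm_exp (U_var (i + 1)) (B_var m n) = (if i + 1 = m then Q else 1)"
    by (auto simp: comm_exp_def)
  ultimately show ?thesis by simp
qed (simp add: T_fun_def qcomm_zero_left)

lemma glq_lower_T:
  assumes "b_vars N \<subseteq> V" "U_vars N \<subseteq> V"
  shows "glq N (fold_rows (map (b_step N) (b_steps N)) T_fun)"
  by (rule glq_lower[OF assms(1) glq_T[OF assms(2)] T_row_relation[OF assms(2)]])

text \<open>
  The multipliers \<open>a\<close> of the column operations commute with the multipliers \<open>b\<close> of the row operations.
  The entries of \<open>T U\<^sup>+\<close> therefore inherit the relations of the entries of \<open>T\<close> with \<open>b\<close>.
\<close>

lemma glq_Z:
  assumes V: "b_vars N \<subseteq> V" "U_vars N \<subseteq> V" "a_vars N \<subseteq> V"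
  shows "glq N (fold_rows (map (b_step N) (b_steps N)) (fold_cols (map a_step (a_steps N)) T_fun))"
proof (rule glq_lower[OF V(1) glq_upper[OF V(2,3)]])
  fix m n i j assume b: "B_var m n \<in> V" and ij: "i < N" "j < N"
  show "qcomm (if i + 1 = m then Q else 1) (fold_cols (map a_step (a_steps N)) T_fun i j) (nc_var (B_var m n))"
  proof (rule qcomm_fold_cols[where f = "\<lambda>i. if i + 1 = m then Q else 1" and N = N])
    show "\<forall>i j. i < N \<longrightarrow> j < N \<longrightarrow> qcomm (if i + 1 = m then Q else 1) (T_fun i j) (nc_var (B_var m n))"
      using T_row_relation[OF V(2) b] by blast
    show "\<forall>(c, a)\<in>set (map a_step (a_steps N)). Suc c < N \<and> qcomm 1 a (nc_var (B_var m n))"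
    proof (intro ballI)
      fix p assume "p \<in> set (map a_step (a_steps N))"
      then obtain k s where mem: "(k, s) \<in> set (a_steps N)" and p: "p = a_step (k, s)" by auto
      have k: "1 \<le> s" "s \<le> k" "k < N" using set_a_steps[OF mem] by simp_all
      have "A_var k s \<in> V" using k V(3) unfolding a_vars_def by force
      then have "qcomm 1 (nc_var (A_var k s)) (nc_var (B_var m n))"
        using relation[OF _ b, of "A_var k s"] by (simp add: comm_exp_def)
      then show "case p of (c, a) \<Rightarrow> Suc c < N \<and> qcomm 1 a (nc_var (B_var m n))"
        using k by (simp add: p a_step_def)
    qed
  qed (rule ij)+
qed

end

section \<open>The ideal of the commutation relations\<close>

text \<open>
  Congruences are easiest to handle modulo the two-sided ideal that the relations generate in the
  algebra of all words.  Projecting onto the words in the letters \<open>V\<close> is multiplicative, and it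
  takes this ideal to the ideal of the smaller free algebra.
\<close>

inductive_set two_sided_ideal :: "'r::ring_1 set \<Rightarrow> 'r set" for S where
  base: "x \<in> S \<Longrightarrow> x \<in> two_sided_ideal S"
| zero: "0 \<in> two_sided_ideal S"
| add: "x \<in> two_sided_ideal S \<Longrightarrow> y \<in> two_sided_ideal S \<Longrightarrow> x + y \<in> two_sided_ideal S"
| left: "x \<in> two_sided_ideal S \<Longrightarrow> y * x \<in> two_sided_ideal S"
| right: "x \<in> two_sided_ideal S \<Longrightarrow> x * y \<in> two_sided_ideal S"

lift_definition restrict_words :: "var set \<Rightarrow> ncpoly \<Rightarrow> ncpoly" is
  "\<lambda>V f w. if w \<in> lists V then f w else 0"
  by (rule finite_subset[rotated]) auto

lemma lookup_restrict_words:
  "Poly_Mapping.lookup (restrict_words V p) w = (if w \<in> lists V then Poly_Mapping.lookup p w else 0)"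
  by transfer simp

lemma restrict_words_add: "restrict_words V (p + r) = restrict_words V p + restrict_words V r"
  by (rule poly_mapping_eqI) (simp add: lookup_restrict_words lookup_add)

lemma restrict_words_zero: "restrict_words V 0 = 0"
  by (rule poly_mapping_eqI) (simp add: lookup_restrict_words)

lemma restrict_words_single:
  "restrict_words V (Poly_Mapping.single w c) = (if w \<in> lists V then Poly_Mapping.single w c else 0)"
  by (rule poly_mapping_eqI) (auto simp: lookup_restrict_words lookup_single when_def)

lemma restrict_words_id: "Poly_Mapping.keys p \<subseteq> lists V \<Longrightarrow> restrict_words V p = p"
  by (rule poly_mapping_eqI) (auto simp: lookup_restrict_words in_keys_iff)

lemma keys_restrict_words: "Poly_Mapping.keys (restrict_words V p) \<subseteq> lists V"
  by (auto simp: in_keys_iff lookup_restrict_words split: if_splits)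

lemma poly_mapping_additive_induct [case_names zero add_single]:
  assumes "P 0" "\<And>p w c. P p \<Longrightarrow> P (Poly_Mapping.single w c + p)"
  shows "P (p :: 'a \<Rightarrow>\<^sub>0 'b::comm_monoid_add)"
proof (induction p rule: update_induct)
  case const
  then show ?case by (rule assms(1))
next
  case (update p w c)
  have "Poly_Mapping.update w c p = Poly_Mapping.single w c + p"
    using update(1) by (intro poly_mapping_eqI) (auto simp: Poly_Mapping.lookup_update lookup_add lookup_single in_keys_iff)
  then show ?case using assms(2)[OF update(3)] by simp
qed

lemma restrict_words_mult: "restrict_words V (p * r) = restrict_words V p * restrict_words V r"
proof (induction p rule: poly_mapping_additive_induct)
  case zero
  then show ?case by (simp add: restrict_words_zero)
next
  case (add_single p w c)
  have "restrict_words V (Poly_Mapping.single w c * r) = restrict_words V (Poly_Mapping.single w c) * restrict_words V r"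
  proof (induction r rule: poly_mapping_additive_induct)
    case zero
    then show ?case by (simp add: restrict_words_zero)
  next
    case (add_single r v d)
    then show ?case
      by (simp add: distrib_left restrict_words_add mult_single restrict_words_single plus_list_def)
  qed
  then show ?case using add_single by (simp add: distrib_right restrict_words_add)
qed

lemma nc_scalar_one: "nc_scalar 1 = 1"
  by (simp add: nc_scalar_def zero_list_def[symmetric] one_poly_mapping_def single_one)

lemma nc_scalar_mult: "nc_scalar (c * d) = nc_scalar c * nc_scalar d"
  by (simp add: nc_scalar_def mult_single plus_list_def)

lemma nc_scalar_add: "nc_scalar (c + d) = nc_scalar c + nc_scalar d"
  by (simp add: nc_scalar_def single_add)

lemma nc_scalar_central: "p * nc_scalar c = nc_scalar c * p"
proof (induction p rule: poly_mapping_additive_induct)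
  case (add_single p w d)
  then show ?case
    by (simp add: distrib_left distrib_right nc_scalar_def mult_single plus_list_def mult.commute)
qed simp

lemma scalar_ideal_two_sided: "Q \<noteq> 0 \<Longrightarrow> scalar_ideal (two_sided_ideal S) nc_scalar Q"
  by unfold_locales
    (blast intro: two_sided_ideal.intros nc_scalar_one nc_scalar_mult nc_scalar_central)+

lemma nc_var_in_free_algebra: "v \<in> V \<Longrightarrow> nc_var v \<in> carrier (free_algebra V)"
  by (simp add: free_algebra_def nc_var_def)

lemma nc_scalar_in_free_algebra: "nc_scalar c \<in> carrier (free_algebra V)"
  by (simp add: free_algebra_def nc_scalar_def)

lemma free_algebra_simps:
  "p \<otimes>\<^bsub>free_algebra V\<^esub> r = p * r" "p \<oplus>\<^bsub>free_algebra V\<^esub> r = p + r"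
  "\<one>\<^bsub>free_algebra V\<^esub> = 1" "\<zero>\<^bsub>free_algebra V\<^esub> = 0"
  by (simp_all add: free_algebra_def)

lemma free_algebra_minus:
  assumes "p \<in> carrier (free_algebra V)" "r \<in> carrier (free_algebra V)"
  shows "p \<ominus>\<^bsub>free_algebra V\<^esub> r = p - r"
proof -
  interpret ring "free_algebra V" by (rule ring_free_algebra)
  have "(p \<ominus>\<^bsub>free_algebra V\<^esub> r) \<oplus>\<^bsub>free_algebra V\<^esub> r = p"
    by (rule minus_add_cancel[OF assms])
  then show ?thesis by (simp add: free_algebra_simps eq_diff_eq)
qed

definition relation_gens ::
    "('h, 'm) hilbert_scheme \<Rightarrow> real \<Rightarrow> (var \<Rightarrow> 'h rel) \<Rightarrow> var set \<Rightarrow> ncpoly set" where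
  "relation_gens H \<theta> X V =
     {nc_var v * nc_var w - nc_var w * nc_var v | v w.
        v \<in> V \<and> w \<in> V \<and> op_commute H (X v) (X w)} \<union>
     {nc_var v * nc_var w - nc_scalar ((q_of \<theta>)\<^sup>2) * nc_var w * nc_var v | v w.
        v \<in> V \<and> w \<in> V \<and> op_q_relation H \<theta> (X v) (X w)}"

lemma relation_gens_carrier: "relation_gens H \<theta> X V \<subseteq> carrier (free_algebra V)"
proof -
  interpret ring "free_algebra V" by (rule ring_free_algebra)
  have diff: "p - r \<in> carrier (free_algebra V)" if "p \<in> carrier (free_algebra V)" "r \<in> carrier (free_algebra V)" for p r
    using minus_closed[OF that] free_algebra_minus[OF that] by simp
  have mult: "p * r \<in> carrier (free_algebra V)" if "p \<in> carrier (free_algebra V)" "r \<in> carrier (free_algebra V)" for p r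
    using m_closed[OF that] by (simp add: free_algebra_simps)
  show ?thesis
    unfolding relation_gens_def
    by (auto intro!: diff mult nc_var_in_free_algebra nc_scalar_in_free_algebra)
qed

lemma comm_ideal_eq: "comm_ideal H \<theta> X V = Idl\<^bsub>free_algebra V\<^esub> (relation_gens H \<theta> X V)"
  unfolding comm_ideal_def relation_gens_def ..

lemma comm_ideal_ideal: "ideal (comm_ideal H \<theta> X V) (free_algebra V)"
  unfolding comm_ideal_eq by (rule ring.genideal_ideal[OF ring_free_algebra relation_gens_carrier])

lemma restrict_words_two_sided:
  assumes "p \<in> two_sided_ideal (relation_gens H \<theta> X V)"
  shows "restrict_words V p \<in> comm_ideal H \<theta> X V"
proof -
  interpret ideal "comm_ideal H \<theta> X V" "free_algebra V" by (rule comm_ideal_ideal)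
  have r: "restrict_words V r \<in> carrier (free_algebra V)" for r
    using keys_restrict_words by (simp add: free_algebra_def)
  show ?thesis
    using assms
  proof (induction rule: two_sided_ideal.induct)
    case (base p)
    have "p \<in> carrier (free_algebra V)"
      using relation_gens_carrier base by blast
    then have "restrict_words V p = p"
      by (intro restrict_words_id) (simp add: free_algebra_def)
    then show ?case
      using subsetD[OF ring.genideal_self[OF ring_free_algebra relation_gens_carrier] base]
      unfolding comm_ideal_eq by simp
  next
    case zero
    then show ?case
      using additive_subgroup.zero_closed[OF is_additive_subgroup] by (simp add: restrict_words_zero free_algebra_simps)
  next
    case (add p r)
    then show ?case
      using additive_subgroup.a_closed[OF is_additive_subgroup] by (simp add: restrict_words_add free_algebra_simps)
  next
    case (left p y)
    then show ?case
      using I_l_closed[OF _ r, of "restrict_words V p" y] by (simp add: restrict_words_mult free_algebra_simps)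
  next
    case (right p y)
    then show ?case
      using I_r_closed[OF _ r, of "restrict_words V p" y] by (simp add: restrict_words_mult free_algebra_simps)
  qed
qed

lemma to_var_algebra_hom:
  "to_var_algebra H \<theta> X V \<in> Ring.ring_hom (free_algebra V) (var_algebra H \<theta> X V)"
  unfolding to_var_algebra_def[abs_def] var_algebra_def by (rule ideal.rcos_ring_hom[OF comm_ideal_ideal])

lemma to_var_algebra_eqI:
  assumes p: "p \<in> carrier (free_algebra V)" and r: "r \<in> carrier (free_algebra V)"
    and "p - r \<in> two_sided_ideal (relation_gens H \<theta> X V)"
  shows "to_var_algebra H \<theta> X V p = to_var_algebra H \<theta> X V r"
proof -
  interpret ring "free_algebra V" by (rule ring_free_algebra)
  have "p - r \<in> carrier (free_algebra V)"
    using minus_closed[OF p r] free_algebra_minus[OF p r] by simp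
  then have "restrict_words V (p - r) = p - r"
    by (intro restrict_words_id) (simp add: free_algebra_def)
  then have "p \<ominus>\<^bsub>free_algebra V\<^esub> r \<in> comm_ideal H \<theta> X V"
    using restrict_words_two_sided[OF assms(3)] free_algebra_minus[OF p r] by simp
  then show ?thesis
    unfolding to_var_algebra_def using quotient_eq_iff_same_a_r_cos[OF comm_ideal_ideal p r] by blast
qed

lemma complex_assoc_algebra_var_algebra:
  "complex_assoc_algebra (var_algebra H \<theta> X V) (\<lambda>c. to_var_algebra H \<theta> X V (nc_scalar c))"
proof -
  interpret F: ring "free_algebra V" by (rule ring_free_algebra)
  interpret Q: ring "var_algebra H \<theta> X V"
    unfolding var_algebra_def by (rule ideal.quotient_is_ring[OF comm_ideal_ideal])
  note hom = to_var_algebra_hom[of H \<theta> X V]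
  show ?thesis
  proof
    have "nc_scalar \<in> Ring.ring_hom class_ring (free_algebra V)"
      by (rule ring_hom_memI)
        (simp_all add: nc_scalar_in_free_algebra free_algebra_simps nc_scalar_mult nc_scalar_add nc_scalar_one)
    from ring_hom_trans[OF this hom]
    show "(\<lambda>c. to_var_algebra H \<theta> X V (nc_scalar c)) \<in> Ring.ring_hom class_ring (var_algebra H \<theta> X V)"
      by (simp add: comp_def)
    fix x c assume "x \<in> carrier (var_algebra H \<theta> X V)"
    then obtain p where p: "p \<in> carrier (free_algebra V)" "x = to_var_algebra H \<theta> X V p"
      unfolding var_algebra_def to_var_algebra_def FactRing_def A_RCOSETS_def' by auto
    show "to_var_algebra H \<theta> X V (nc_scalar c) \<otimes>\<^bsub>var_algebra H \<theta> X V\<^esub> x =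
        x \<otimes>\<^bsub>var_algebra H \<theta> X V\<^esub> to_var_algebra H \<theta> X V (nc_scalar c)"
      unfolding p(2) ring_hom_mult[OF hom nc_scalar_in_free_algebra p(1), symmetric]
        ring_hom_mult[OF hom p(1) nc_scalar_in_free_algebra, symmetric]
      by (simp add: free_algebra_simps nc_scalar_central)
  qed
qed

lemma is_GLq_in_vars_mat_fun:
  assumes glq: "scalar_ideal.glq (two_sided_ideal (relation_gens H \<theta> X V)) nc_scalar ((q_of \<theta>)\<^sup>2) N Z"
    and Z: "\<And>i j. i < N \<Longrightarrow> j < N \<Longrightarrow> Z i j \<in> carrier (free_algebra V)"
  shows "is_GLq_in_vars H \<theta> X V N (mat_fun N Z)"
proof -
  define J where "J = two_sided_ideal (relation_gens H \<theta> X V)"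
  define \<pi> where "\<pi> = to_var_algebra H \<theta> X V"
  let ?R = "var_algebra H \<theta> X V" and ?F = "free_algebra V" and ?Q = "(q_of \<theta>)\<^sup>2"
  interpret scalar_ideal J nc_scalar ?Q
    unfolding J_def by (rule scalar_ideal_two_sided) (simp add: q_of_def)
  interpret F: ring ?F by (rule ring_free_algebra)
  interpret \<pi>: ring_hom_ring ?F ?R \<pi>
    unfolding \<pi>_def var_algebra_def to_var_algebra_def[abs_def]
    by (rule ideal.rcos_ring_hom_ring[OF comm_ideal_ideal])
  note Z = glq[folded J_def] and mem = Z
  have mult: "\<pi> p \<otimes>\<^bsub>?R\<^esub> \<pi> r = \<pi> (p * r)" if "p \<in> carrier ?F" "r \<in> carrier ?F" for p r
    using \<pi>.hom_mult[OF that] by (simp add: free_algebra_simps)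
  have minus: "\<pi> p \<ominus>\<^bsub>?R\<^esub> \<pi> r = \<pi> (p - r)" if "p \<in> carrier ?F" "r \<in> carrier ?F" for p r
  proof -
    have "\<pi> (p \<ominus>\<^bsub>?F\<^esub> r) = \<pi> p \<ominus>\<^bsub>?R\<^esub> \<pi> r"
      unfolding a_minus_def using that by simp
    then show ?thesis by (simp only: free_algebra_minus[OF that])
  qed
  have mult_closed: "p * r \<in> carrier ?F" if "p \<in> carrier ?F" "r \<in> carrier ?F" for p r
    using F.m_closed[OF that] by (simp add: free_algebra_simps)
  have minus_closed: "p - r \<in> carrier ?F" if "p \<in> carrier ?F" "r \<in> carrier ?F" for p r
    using F.minus_closed[OF that] free_algebra_minus[OF that] by simp
  have eqI: "\<pi> p = \<pi> r" if "p \<in> carrier ?F" "r \<in> carrier ?F" "p - r \<in> J" for p r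
    unfolding \<pi>_def by (rule to_var_algebra_eqI[OF that(1,2) that(3)[unfolded J_def]])
  have comm: "\<pi> p \<otimes>\<^bsub>?R\<^esub> \<pi> r = \<pi> r \<otimes>\<^bsub>?R\<^esub> \<pi> p"
    if "p \<in> carrier ?F" "r \<in> carrier ?F" "qcomm 1 p r" for p r
    using that by (simp add: mult eqI mult_closed qcomm_one)
  have qcomm: "\<pi> p \<otimes>\<^bsub>?R\<^esub> \<pi> r = \<pi> (nc_scalar ?Q) \<otimes>\<^bsub>?R\<^esub> (\<pi> r \<otimes>\<^bsub>?R\<^esub> \<pi> p)"
    if "p \<in> carrier ?F" "r \<in> carrier ?F" "qcomm ?Q p r" for p r
    using that by (simp add: mult eqI mult_closed nc_scalar_in_free_algebra qcomm_def)
  have "GLq_matrix ?R (\<lambda>c. \<pi> (nc_scalar c)) (q_of \<theta>) N (map_mat \<pi> (mat_fun N Z))"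
    unfolding GLq_matrix_def
  proof (intro conjI allI impI)
    show "complex_assoc_algebra ?R (\<lambda>c. \<pi> (nc_scalar c))"
      unfolding \<pi>_def by (rule complex_assoc_algebra_var_algebra)
    show "map_mat \<pi> (mat_fun N Z) \<in> carrier_mat N N" by simp
    show "map_mat \<pi> (mat_fun N Z) $$ (i, j) \<in> carrier ?R" if "i < N" "j < N" for i j
      using that assms(2)[OF that] by simp
    fix i i' j j' assume ij: "i < i' \<and> i' < N \<and> j < j' \<and> j' < N"
    then have lt: "i < N" "i' < N" "j < N" "j' < N" "i < i'" "j < j'" by simp_all
    note c = assms(2)[OF lt(1,3)] assms(2)[OF lt(1,4)] assms(2)[OF lt(2,3)] assms(2)[OF lt(2,4)]
    have diag: "\<pi> (Z i j * Z i' j' - Z i j' * Z i' j) = \<pi> (Z i' j' * Z i j - Z i' j * Z i j')"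
      using glq_diag[OF Z lt(5,2,6,4)] by (intro eqI minus_closed mult_closed c)
    show "let \<alpha> = map_mat \<pi> (mat_fun N Z) $$ (i, j); \<beta> = map_mat \<pi> (mat_fun N Z) $$ (i, j');
          \<gamma> = map_mat \<pi> (mat_fun N Z) $$ (i', j); \<delta> = map_mat \<pi> (mat_fun N Z) $$ (i', j') in
        \<alpha> \<otimes>\<^bsub>?R\<^esub> \<beta> = \<beta> \<otimes>\<^bsub>?R\<^esub> \<alpha> \<and> \<gamma> \<otimes>\<^bsub>?R\<^esub> \<delta> = \<delta> \<otimes>\<^bsub>?R\<^esub> \<gamma> \<and>
        \<alpha> \<otimes>\<^bsub>?R\<^esub> \<gamma> = \<pi> (nc_scalar ?Q) \<otimes>\<^bsub>?R\<^esub> (\<gamma> \<otimes>\<^bsub>?R\<^esub> \<alpha>) \<and>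
        \<beta> \<otimes>\<^bsub>?R\<^esub> \<delta> = \<pi> (nc_scalar ?Q) \<otimes>\<^bsub>?R\<^esub> (\<delta> \<otimes>\<^bsub>?R\<^esub> \<beta>) \<and>
        \<beta> \<otimes>\<^bsub>?R\<^esub> \<gamma> = \<pi> (nc_scalar ?Q) \<otimes>\<^bsub>?R\<^esub> (\<gamma> \<otimes>\<^bsub>?R\<^esub> \<beta>) \<and>
        \<alpha> \<otimes>\<^bsub>?R\<^esub> \<delta> \<ominus>\<^bsub>?R\<^esub> \<beta> \<otimes>\<^bsub>?R\<^esub> \<gamma> = \<delta> \<otimes>\<^bsub>?R\<^esub> \<alpha> \<ominus>\<^bsub>?R\<^esub> \<gamma> \<otimes>\<^bsub>?R\<^esub> \<beta>"
      unfolding Let_def index_map_mat(1)[unfolded dim_row_mat dim_col_mat, OF _ _] using lt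
    proof (simp only: index_map_mat dim_row_mat dim_col_mat index_mat prod.case, intro conjI)
      show "\<pi> (Z i j) \<otimes>\<^bsub>?R\<^esub> \<pi> (Z i j') = \<pi> (Z i j') \<otimes>\<^bsub>?R\<^esub> \<pi> (Z i j)"
        by (rule comm[OF c(1,2) glq_row[OF Z lt(1,3,4)]])
      show "\<pi> (Z i' j) \<otimes>\<^bsub>?R\<^esub> \<pi> (Z i' j') = \<pi> (Z i' j') \<otimes>\<^bsub>?R\<^esub> \<pi> (Z i' j)"
        by (rule comm[OF c(3,4) glq_row[OF Z lt(2,3,4)]])
      show "\<pi> (Z i j) \<otimes>\<^bsub>?R\<^esub> \<pi> (Z i' j) = \<pi> (nc_scalar ?Q) \<otimes>\<^bsub>?R\<^esub> (\<pi> (Z i' j) \<otimes>\<^bsub>?R\<^esub> \<pi> (Z i j))"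
        by (rule qcomm[OF c(1,3) glq_col[OF Z lt(5,2,3)]])
      show "\<pi> (Z i j') \<otimes>\<^bsub>?R\<^esub> \<pi> (Z i' j') = \<pi> (nc_scalar ?Q) \<otimes>\<^bsub>?R\<^esub> (\<pi> (Z i' j') \<otimes>\<^bsub>?R\<^esub> \<pi> (Z i j'))"
        by (rule qcomm[OF c(2,4) glq_col[OF Z lt(5,2,4)]])
      show "\<pi> (Z i j') \<otimes>\<^bsub>?R\<^esub> \<pi> (Z i' j) = \<pi> (nc_scalar ?Q) \<otimes>\<^bsub>?R\<^esub> (\<pi> (Z i' j) \<otimes>\<^bsub>?R\<^esub> \<pi> (Z i j'))"
        by (rule qcomm[OF c(2,3) glq_anti[OF Z lt(5,2,6,4)]])
      show "\<pi> (Z i j) \<otimes>\<^bsub>?R\<^esub> \<pi> (Z i' j') \<ominus>\<^bsub>?R\<^esub> \<pi> (Z i j') \<otimes>\<^bsub>?R\<^esub> \<pi> (Z i' j) =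
          \<pi> (Z i' j') \<otimes>\<^bsub>?R\<^esub> \<pi> (Z i j) \<ominus>\<^bsub>?R\<^esub> \<pi> (Z i' j) \<otimes>\<^bsub>?R\<^esub> \<pi> (Z i j')"
        using diag by (simp only: mult c minus mult_closed)
    qed
  qed
  then show ?thesis
    unfolding is_GLq_in_vars_def \<pi>_def using assms(2) by simp
qed

section \<open>The decomposition\<close>

text \<open>
  For the exponents 0 and 1 the relations of the operators are generators of the ideal.  The exponent
  -1 is reduced to 1 by exchanging the variables, which inverts the scalar.
\<close>

lemma Gauss_Lusztig_from_relations:
  assumes positive: "\<And>v. v \<in> all_vars N \<Longrightarrow> positive_self_adjoint H (X v)"
    and commute: "\<And>v w. \<lbrakk>v \<in> all_vars N; w \<in> all_vars N; comm_exp v w = 0\<rbrakk> \<Longrightarrow> op_commute H (X v) (X w)"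
    and q_relation: "\<And>v w. \<lbrakk>v \<in> all_vars N; w \<in> all_vars N; comm_exp v w = 1\<rbrakk> \<Longrightarrow>
      op_q_relation H \<theta> (X v) (X w)"
  shows "gauss_lusztig_representation H N \<theta> X"
proof -
  let ?Q = "(q_of \<theta>)\<^sup>2"
  have flip: "comm_exp w v = - comm_exp v w" for v w
    by (simp add: comm_exp_def)
  have Q: "?Q \<noteq> 0" by (simp add: q_of_def)
  have torus: "torus_ideal (two_sided_ideal (relation_gens H \<theta> X V)) ?Q V" if V: "V \<subseteq> all_vars N" for V
  proof -
    interpret scalar_ideal "two_sided_ideal (relation_gens H \<theta> X V)" nc_scalar ?Q
      by (rule scalar_ideal_two_sided[OF Q])
    have q1: "qcomm ?Q (nc_var v) (nc_var w)" if "v \<in> V" "w \<in> V" "comm_exp v w = 1" for v w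
    proof -
      have "nc_var v * nc_var w - nc_scalar ?Q * nc_var w * nc_var v \<in> relation_gens H \<theta> X V"
        using that q_relation[of v w] V unfolding relation_gens_def by blast
      then show ?thesis
        unfolding qcomm_def by (auto intro: two_sided_ideal.base simp: mult.assoc)
    qed
    have c1: "qcomm 1 (nc_var v) (nc_var w)" if "v \<in> V" "w \<in> V" "comm_exp v w = 0" for v w
    proof -
      have "nc_var v * nc_var w - nc_var w * nc_var v \<in> relation_gens H \<theta> X V"
        using that commute[of v w] V unfolding relation_gens_def by blast
      then show ?thesis
        unfolding qcomm_one by (rule two_sided_ideal.base)
    qed
    show ?thesis
    proof
      fix v w assume vw: "v \<in> V" "w \<in> V"
      consider "comm_exp v w = 0" | "comm_exp v w = 1" | "comm_exp v w = - 1"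
        using comm_exp_range[of v w] by blast
      then show "qcomm (?Q powi comm_exp v w) (nc_var v) (nc_var w)"
      proof cases
        case 1
        then show ?thesis using c1[OF vw] by simp
      next
        case 2
        then show ?thesis using q1[OF vw] by simp
      next
        case 3
        then have "qcomm ?Q (nc_var w) (nc_var v)"
          using q1[OF vw(2,1)] flip[of v w] by simp
        from qcomm_swap[OF this Q] show ?thesis
          using 3 by (simp add: power_int_minus inverse_eq_divide)
      qed
    qed
  qed
  have closed: "x + y \<in> carrier (free_algebra V)" "x * y \<in> carrier (free_algebra V)"
    if "x \<in> carrier (free_algebra V)" "y \<in> carrier (free_algebra V)" for x y V
  proof -
    interpret ring "free_algebra V" by (rule ring_free_algebra)
    show "x + y \<in> carrier (free_algebra V)" "x * y \<in> carrier (free_algebra V)"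
      using a_closed[OF that] m_closed[OF that] by (simp_all add: free_algebra_simps)
  qed
  have T: "T_fun i j \<in> carrier (free_algebra V)" if "i < N" "j < N" "U_vars N \<subseteq> V" for i j V
  proof (cases "i = j")
    case True
    have "U_var (i + 1) \<in> V" using that unfolding U_vars_def by auto
    then show ?thesis using True by (simp add: T_fun_def nc_var_in_free_algebra)
  qed (simp add: T_fun_def free_algebra_def)
  have a: "Suc c < N \<and> x \<in> carrier (free_algebra V)"
    if mem: "(c, x) \<in> set (map a_step (a_steps N))" and V: "a_vars N \<subseteq> V" for c x V
  proof -
    obtain m s where ms: "(m, s) \<in> set (a_steps N)" "c = m - 1" "x = nc_var (A_var m s)"
      using mem by (auto simp: a_step_def)
    have "1 \<le> s \<and> s \<le> m \<and> m < N" by (rule set_a_steps[OF ms(1)])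
    moreover from this have "A_var m s \<in> V" using V unfolding a_vars_def by force
    ultimately show ?thesis using ms by (simp add: nc_var_in_free_algebra)
  qed
  have b: "Suc r < N \<and> x \<in> carrier (free_algebra V)"
    if mem: "(r, x) \<in> set (map (b_step N) (b_steps N))" and V: "b_vars N \<subseteq> V" for r x V
  proof -
    obtain m s where ms: "(m, s) \<in> set (b_steps N)" "r = m - 1" "x = nc_var (B_var m (m + s - (N - 1)))"
      using mem by (auto simp: b_step_def)
    have bounds: "1 \<le> s \<and> s < N \<and> N \<le> m + s \<and> m < N" by (rule set_b_steps[OF ms(1)])
    then have "1 \<le> m + s - (N - 1) \<and> m + s - (N - 1) \<le> m \<and> m \<le> N - 1" by linarith
    then have "B_var m (m + s - (N - 1)) \<in> V" using V unfolding b_vars_def by blast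
    moreover have "Suc r < N" using bounds ms(2) by linarith
    ultimately show ?thesis using ms(3) by (simp add: nc_var_in_free_algebra)
  qed
  have TU: "fold_cols (map a_step (a_steps N)) T_fun i j \<in> carrier (free_algebra V)"
    if "i < N" "j < N" "U_vars N \<subseteq> V" "a_vars N \<subseteq> V" for i j V
    by (rule fold_cols_closed[OF closed a[OF _ that(4)] T[OF _ _ that(3)] that(1,2)])
  have BT: "fold_rows (map (b_step N) (b_steps N)) Z i j \<in> carrier (free_algebra V)"
    if "i < N" "j < N" "b_vars N \<subseteq> V" "\<And>i j. i < N \<Longrightarrow> j < N \<Longrightarrow> Z i j \<in> carrier (free_algebra V)" for i j V Z
    by (rule fold_rows_closed[OF closed b[OF _ that(3)] that(4) that(1,2)])
  show ?thesis
  proof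
    show "positive_self_adjoint H (X v)" if "v \<in> all_vars N" for v by (rule positive[OF that])
    show "op_commute H (X v) (X w) \<or> op_q_commute H \<theta> (X v) (X w)"
      if "v \<in> all_vars N" "w \<in> all_vars N" "v \<noteq> w" for v w
      using comm_exp_range[of v w] commute[OF that(1,2)] q_relation[OF that(1,2)]
        q_relation[OF that(2,1)] flip[of v w] unfolding op_q_commute_def by auto
    show "op_commute H (X v) (X w)" if "v \<in> a_vars N" "w \<in> b_vars N" for v w
      using that comm_exp_a_b[OF that] by (intro commute) (auto simp: all_vars_def)
    have sub: "b_vars N \<subseteq> all_vars N" "U_vars N \<subseteq> all_vars N" "a_vars N \<subseteq> all_vars N"
      "U_vars N \<union> a_vars N \<subseteq> all_vars N" "b_vars N \<union> U_vars N \<subseteq> all_vars N"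
      unfolding all_vars_def by auto
    show "is_GLq_in_vars H \<theta> X (all_vars N) N (Z_matrix N)"
      unfolding Z_matrix_eq
      by (intro is_GLq_in_vars_mat_fun torus_ideal.glq_Z[OF torus] BT TU sub order_refl)
    show "is_GLq_in_vars H \<theta> X (U_vars N \<union> a_vars N) N (T_diag N * U_plus N)"
      unfolding TU_eq
      by (intro is_GLq_in_vars_mat_fun torus_ideal.glq_upper[OF torus] TU sub Un_upper1 Un_upper2)
    show "is_GLq_in_vars H \<theta> X (b_vars N \<union> U_vars N) N (U_minus N * T_diag N)"
      unfolding UT_eq
      by (intro is_GLq_in_vars_mat_fun torus_ideal.glq_lower_T[OF torus] BT T sub Un_upper1 Un_upper2)
    show "upper_triangular (T_diag N * U_plus N)"
      unfolding TU_eq upper_triangular_def by (auto intro!: fold_cols_upper simp: T_fun_def)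
    show "upper_triangular (transpose_mat (U_minus N * T_diag N))"
      unfolding UT_eq upper_triangular_def by (auto intro!: fold_rows_lower simp: T_fun_def)
  qed
qed

text \<open>
  Take one coordinate \<open>f v\<close> for each variable \<open>v\<close>, and let the vector of \<open>v\<close> have real part the unit
  vector and imaginary part the column \<open>half_exp \<cdot> v\<close>.  Its symplectic products are the exponents of
  the commutation relations.
\<close>

definition var_vector :: "(var \<Rightarrow> nat) \<Rightarrow> var set \<Rightarrow> var \<Rightarrow> nat \<Rightarrow> complex" where
  "var_vector f A v j =
     (let u = inv_into A f j in of_bool (u = v) + \<i> * of_real (of_int (half_exp u v)))"

lemma symplectic_var_vector:
  assumes A: "finite A" "inj_on f A" and v: "v \<in> A" and w: "w \<in> A"
  shows "gaussian_space.symplectic (f ` A) (var_vector f A v) (var_vector f A w) = of_int (comm_exp v w)"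
proof -
  interpret gaussian_space "f ` A" by unfold_locales (simp add: A)
  have "symplectic (var_vector f A v) (var_vector f A w) =
      (\<Sum>u\<in>A. Im (cnj (var_vector f A v (f u)) * var_vector f A w (f u)))"
    unfolding symplectic_def by (simp only: Im_sum sum.reindex[OF A(2)] comp_def)
  also have "\<dots> = (\<Sum>u\<in>A. (if u = v then real_of_int (half_exp u w) else 0)
      - (if u = w then real_of_int (half_exp u v) else 0))"
  proof (intro sum.cong refl)
    fix u assume "u \<in> A"
    then have "inv_into A f (f u) = u" by (rule inv_into_f_f[OF A(2)])
    then show "Im (cnj (var_vector f A v (f u)) * var_vector f A w (f u)) =
        (if u = v then real_of_int (half_exp u w) else 0) - (if u = w then real_of_int (half_exp u v) else 0)"
      by (simp add: var_vector_def)
  qed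
  also have "\<dots> = of_int (comm_exp v w)"
    using A(1) v w by (simp add: sum_subtractf comm_exp_def)
  finally show ?thesis .
qed

lemma finite_all_vars: "finite (all_vars N)"
proof -
  have "finite {c m n | m n. m \<le> N \<and> n \<le> N}" for c :: "nat \<Rightarrow> nat \<Rightarrow> var"
    by (rule finite_image_set2) simp_all
  moreover have "finite {U_var k | k. k \<le> N}"
    by (rule finite_image_set) simp
  moreover have "b_vars N \<subseteq> {B_var m n | m n. m \<le> N \<and> n \<le> N}" "U_vars N \<subseteq> {U_var k | k. k \<le> N}"
    "a_vars N \<subseteq> {A_var m n | m n. m \<le> N \<and> n \<le> N}"
    unfolding b_vars_def U_vars_def a_vars_def by auto
  ultimately show ?thesis
    unfolding all_vars_def by (simp add: finite_subset)
qed

theorem theorem1p1: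
  fixes N :: nat and b :: real
  assumes "N \<ge> 2" and "0 < b" and "b < 1" and "b\<^sup>2 \<notin> \<rat>"
  shows "\<exists>(H :: ((nat \<Rightarrow> real) \<Rightarrow> complex) set hilbert) X X'.
           complex_hilbert_space H \<and> carrier H \<noteq> {\<zero>\<^bsub>H\<^esub>} \<and>
           gauss_lusztig_representation H N (b\<^sup>2) X \<and>
           (\<forall>v\<in>all_vars N. has_power H (X v) (of_real (1 / b\<^sup>2)) (X' v)) \<and>
           gauss_lusztig_representation H N (1 / b\<^sup>2) X'"
proof -
  obtain f :: "var \<Rightarrow> nat" where f: "inj_on f (all_vars N)"
    using finite_imp_inj_to_nat_seg[OF finite_all_vars] by blast
  interpret gaussian_space "f ` all_vars N"
    by unfold_locales (simp add: finite_all_vars)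
  define w where "w = var_vector f (all_vars N)"
  \<comment> \<open>the products of these factors turn the symplectic form \<open>e\<close> into \<open>\<pi> \<theta> e\<close>\<close>
  define X where "X \<theta> v = exp_field (w v) (sqrt (pi * \<theta>))" for \<theta> v
  have weyl: "weyl_relation L2 (\<lambda>s t. exp (- 2 * \<i> * of_real (s * t * (pi * \<theta> * of_int (comm_exp u v))))) (X \<theta> u) (X \<theta> v)"
    if \<theta>: "\<theta> > 0" and uv: "u \<in> all_vars N" "v \<in> all_vars N" for \<theta> u v
  proof -
    have "sqrt (pi * \<theta>) * sqrt (pi * \<theta>) = pi * \<theta>" using \<theta> by simp
    then show ?thesis
      using weyl_relation_exp_field[of "sqrt (pi * \<theta>)" "sqrt (pi * \<theta>)" "w u" "w v"]
      unfolding X_def w_def symplectic_var_vector[OF finite_all_vars f uv] by simp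
  qed
  have rep: "gauss_lusztig_representation L2 N \<theta> (X \<theta>)" if \<theta>: "\<theta> > 0" for \<theta>
  proof (rule Gauss_Lusztig_from_relations)
    show "positive_self_adjoint L2 (X \<theta> v)" for v
      unfolding X_def by (rule positive_exp_field)
    show "op_commute L2 (X \<theta> u) (X \<theta> v)"
      if "u \<in> all_vars N" "v \<in> all_vars N" "comm_exp u v = 0" for u v
      using weyl[OF \<theta> that(1,2)] that(3) unfolding op_commute_def by simp
    show "op_q_relation L2 \<theta> (X \<theta> u) (X \<theta> v)"
      if "u \<in> all_vars N" "v \<in> all_vars N" "comm_exp u v = 1" for u v
    proof -
      have "s * t * (pi * \<theta> * of_int (comm_exp u v)) = pi * \<theta> * s * t" for s t :: real
        using that(3) by simp
      then show ?thesis
        using weyl[OF \<theta> that(1,2)] unfolding op_q_relation_def by (simp only:)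
    qed
  qed
  have "1 / b\<^sup>2 * sqrt (pi * b\<^sup>2) = sqrt (pi * (1 / b\<^sup>2))"
    using \<open>0 < b\<close> by (simp add: real_sqrt_mult real_sqrt_divide power2_eq_square field_simps)
  then have "has_power L2 (X (b\<^sup>2) v) (of_real (1 / b\<^sup>2)) (X (1 / b\<^sup>2) v)" for v
    using has_power_exp_field_real[of "w v" "sqrt (pi * b\<^sup>2)" "1 / b\<^sup>2"] unfolding X_def by (simp only:)
  moreover have "b\<^sup>2 > 0" "1 / b\<^sup>2 > 0" using \<open>0 < b\<close> by simp_all
  ultimately show ?thesis
    using complex_hilbert_space_l2_space l2_space_nontrivial rep by blast
qed

end
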